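(* Consider the exponential-family likelihood process $X$, data-generating law $P_\theta$, and product Gaussian comparison process $Y$ defined in the context. Suppose the local exponential-family regularity assumption stated in the context holds, $M_n=\omega(n)$ (i.e. $M_n/n\to\infty$), and $r_n\lesssim\sqrt{n/M_n}$. Let $H_0$ be a fixed symmetric $d\times d$ matrix whose column span is contained in the column span of $\Sigma_0$, let $H=\bigoplus_{m\le M_n}H_0$, and let $a\in\{-1,0\}$, with $\phi_\theta$, $\Phi_n(\theta)$ and $\Phi_n^{\mathrm G}(\theta,\beta)$ as defined in the context. Then there is a constant $C<\infty$, independent of $n$, $\theta$ and $\epsilon$, such that for every fixed sufficiently small $\epsilon>0$, for all sufficiently large $n$ and uniformly over $\theta\in\Theta_n$, $$\Phi_n^{\mathrm G}(\theta,-\epsilon)-C\Bigl(\epsilon+\frac{r_n}{\epsilon}\Bigr)\le\Phi_n(\theta)\le\Phi_n^{\mathrm G}(\theta,\epsilon)+C\Bigl(\epsilon+\frac{r_n}{\epsilon}\Bigr).$$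
   Context: For each $n$: $\Theta_n$ is a compact parameter space, $T_n\subseteq\Theta_n$ a compact metric space with a Borel probability measure $\pi$ (prior, may depend on $n$), and $M_n$ a number of local components. Fix $d\ge1$, $\mathcal H_0=\mathbb R^d$, a measurable space $\Omega_0$, probability measures $\lambda,\gamma$ on $\Omega_0$, and measurable maps $W_0,W_0^\star:\Omega_0\to\mathcal H_0$, all independent of $n$. The sample space is $\Omega=\Omega_0^{M_n}$. There are continuous local feature maps $\eta_m:\Theta_n\to\mathcal H_0$, $m\le M_n$; the global feature map is $\eta=(\eta_1,\dots,\eta_{M_n}):\Theta_n\to\mathcal H=\bigoplus_{m\le M_n}\mathcal H_0$, and the feature radius is $r_n=\max_{m\le M_n}\sup_{u\in\Theta_n}\|\eta_m(u)\|$. Define $$\Lambda(u)=\log\int e^{\langle W_0,u\rangle}\,\mathrm d\lambda,\quad \Gamma(u)=\log\int e^{\langle W_0^\star,u\rangle}\,\mathrm d\gamma,\quad \Xi(v,u)=\log\int e^{\langle W_0,v\rangle+\langle W_0^\star,u\rangle}\,\mathrm d\gamma.$$ Model log-likelihood: $X(t,\omega)=\sum_{m}\{\langle W_0(\omega_m),\eta_m(t)\rangle-\Lambda(\eta_m(t))\}$, $t\in T_n$. Data-generating law: $P_\theta=\bigotimes_{m=1}^{M_n}P_{\theta,m}$ with $\log\frac{\mathrm dP_{\theta,m}}{\mathrm d\gamma}(\omega_m)=\langle W_0^\star(\omega_m),\eta_m(\theta)\rangle-\Gamma(\eta_m(\theta))$. Local exponential-family regularity assumption: there exists $\rho>0$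 such that $\Lambda(u)<\infty$ and $\Gamma(u)<\infty$ for all $\|u\|<\rho$, and $\Xi(v,u)<\infty$ for all $\|v\|<\rho,\|u\|<\rho$; in addition $\int W_0\,\mathrm d\lambda=\int W_0\,\mathrm d\gamma$. Gaussian side: let $A_0=\nabla^2_{vu}\Xi(0,0)$ (entries $\partial_{v_i}\partial_{u_j}\Xi(0,0)$), $\Sigma_0=\nabla^2_{vv}\Xi(0,0)$, $K_0=\nabla^2\Lambda(0)$, and let $A,\Sigma,K$ be the block-diagonal operators $\bigoplus_{m\le M_n}A_0$, $\bigoplus_{m\le M_n}\Sigma_0$, $\bigoplus_{m\le M_n}K_0$ on $\mathcal H$. Under $Q_\theta$, with $\xi\sim N(0,\Sigma)$, $$Y(t)=\langle\xi,\eta(t)\rangle+\langle A\eta(\theta),\eta(t)\rangle-\tfrac12\langle K\eta(t),\eta(t)\rangle.$$ With $B=\Sigma^+H$ ($\Sigma^+$ the Moore–Penrose pseudoinverse, so $H=\Sigma B$), the perturbed Gaussian process is $Y_\beta(t)=Y(t)+\beta\widetilde Y(t)$ where $$\widetilde Y(t)=\langle\xi,B\eta(t)\rangle+a\langle H[\eta(\theta)-\eta(t)],\eta(\theta)-\eta(t)\rangle .$$ Test function: $$\phi_\theta(s,t)=a\langle H[\eta(\theta)-\eta(t)],\eta(\theta)-\eta(t)\rangle+\langle H\eta(t),\eta(t)\rangle-\langle H\eta(s),\eta(t)\rangle .$$ For a process $Z$ let $\pi_Z(\mathrm dt)=e^{Z(t)}\pi(\mathrm dt)/\int_{T_n}e^{Z(s)}\pi(\mathrm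 ds)$. Then $$\Phi_n(\theta)=\frac1n\iint\phi_\theta(s,t)\,\mathbb E_{P_\theta}[\pi_X^{\otimes2}](\mathrm ds,\mathrm dt),\qquad\Phi_n^{\mathrm G}(\theta,\beta)=\frac1n\iint\phi_\theta(s,t)\,\mathbb E_{Q_\theta}[\pi_{Y_\beta}^{\otimes2}](\mathrm ds,\mathrm dt).$$ $a_n\lesssim b_n$ means $a_n\le Cb_n$ with $C$ independent of $n$. The hypotheses force $r_n\to0$, so for sufficiently large $n$ one has $r_n<\rho$ and all objects are defined. *)

theory Defs
  imports "HOL-Probability.Probability" "HOL-Library.Landau_Symbols"
begin

section \<open>The direct sum of k copies of a Euclidean space\<close>

text \<open>
  The number k of blocks varies with n, so the direct sum of k copies of
  \<open>real ^ 'd\<close> is the set of functions \<open>nat \<Rightarrow> real ^ 'd\<close> vanishing at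
  all indices \<open>m \<ge> k\<close>.
\<close>

definition direct_sum :: "nat \<Rightarrow> (nat \<Rightarrow> real ^ 'd) set" where
  "direct_sum k = {x. \<forall>m\<ge>k. x m = 0}"

definition dsum_inner :: "nat \<Rightarrow> (nat \<Rightarrow> real ^ 'd) \<Rightarrow> (nat \<Rightarrow> real ^ 'd) \<Rightarrow> real" where
  "dsum_inner k x y = (\<Sum>m<k. x m \<bullet> y m)"

definition block_diag :: "nat \<Rightarrow> real ^ 'd ^ 'd \<Rightarrow> (nat \<Rightarrow> real ^ 'd) \<Rightarrow> (nat \<Rightarrow> real ^ 'd)" where
  "block_diag k A x = (\<lambda>m. if m < k then A *v x m else 0)"

text \<open>
  The Moore-Penrose pseudoinverse of a linear operator S on the direct sum, given by the
  four Penrose equations. They determine P on the direct sum and force it to be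
  linear there; the extensional function space fixes its values elsewhere.
\<close>

definition pseudoinverse ::
  "nat \<Rightarrow> ((nat \<Rightarrow> real ^ 'd) \<Rightarrow> (nat \<Rightarrow> real ^ 'd)) \<Rightarrow> (nat \<Rightarrow> real ^ 'd) \<Rightarrow> (nat \<Rightarrow> real ^ 'd)" where
  "pseudoinverse k S = (THE P. P \<in> direct_sum k \<rightarrow>\<^sub>E direct_sum k \<and>
     (\<forall>x\<in>direct_sum k. S (P (S x)) = S x) \<and>
     (\<forall>x\<in>direct_sum k. P (S (P x)) = P x) \<and>
     (\<forall>x\<in>direct_sum k. \<forall>y\<in>direct_sum k. dsum_inner k (S (P x)) y = dsum_inner k x (S (P y))) \<and>
     (\<forall>x\<in>direct_sum k. \<forall>y\<in>direct_sum k. dsum_inner k (P (S x)) y = dsum_inner k x (P (S y))))"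

definition global_feature :: "nat \<Rightarrow> (nat \<Rightarrow> 'p \<Rightarrow> real ^ 'd) \<Rightarrow> 'p \<Rightarrow> (nat \<Rightarrow> real ^ 'd)" where
  "global_feature k \<eta> t = (\<lambda>m. if m < k then \<eta> m t else 0)"

text \<open>For \<open>k = 0\<close> the maximum is unspecified.\<close>

definition feature_radius :: "'p set \<Rightarrow> nat \<Rightarrow> (nat \<Rightarrow> 'p \<Rightarrow> real ^ 'd) \<Rightarrow> real" where
  "feature_radius \<Theta> k \<eta> = Max ((\<lambda>m. SUP u\<in>\<Theta>. norm (\<eta> m u)) ` {..<k})"

section \<open>Cumulant generating functions and their Hessians\<close>

definition log_mgf :: "'w measure \<Rightarrow> ('w \<Rightarrow> real ^ 'd) \<Rightarrow> real ^ 'd \<Rightarrow> real" where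
  "log_mgf \<mu> W u = ln (\<integral>x. exp (W x \<bullet> u) \<partial>\<mu>)"

definition joint_log_mgf ::
  "'w measure \<Rightarrow> ('w \<Rightarrow> real ^ 'd) \<Rightarrow> ('w \<Rightarrow> real ^ 'd) \<Rightarrow> real ^ 'd \<Rightarrow> real ^ 'd \<Rightarrow> real" where
  "joint_log_mgf \<gamma> W Ws v u = ln (\<integral>x. exp (W x \<bullet> v + Ws x \<bullet> u) \<partial>\<gamma>)"

text \<open>
  Finiteness of a log moment generating function is integrability of the exponential,
  since the Bochner integral of a non-integrable function is 0.
\<close>

definition exp_family_regular ::
  "'w measure \<Rightarrow> 'w measure \<Rightarrow> ('w \<Rightarrow> real ^ 'd) \<Rightarrow> ('w \<Rightarrow> real ^ 'd) \<Rightarrow> bool" where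
  "exp_family_regular \<mu> \<gamma> W Ws \<longleftrightarrow>
     (\<exists>\<rho>>0.
        (\<forall>u. norm u < \<rho> \<longrightarrow>
           integrable \<mu> (\<lambda>x. exp (W x \<bullet> u)) \<and> integrable \<gamma> (\<lambda>x. exp (Ws x \<bullet> u))) \<and>
        (\<forall>v u. norm v < \<rho> \<longrightarrow> norm u < \<rho> \<longrightarrow>
           integrable \<gamma> (\<lambda>x. exp (W x \<bullet> v + Ws x \<bullet> u)))) \<and>
     (\<integral>x. W x \<partial>\<mu>) = (\<integral>x. W x \<partial>\<gamma>)"

definition partial_deriv :: "'d \<Rightarrow> (real ^ 'd \<Rightarrow> real) \<Rightarrow> real ^ 'd \<Rightarrow> real" where
  "partial_deriv i f x = deriv (\<lambda>h. f (x + h *\<^sub>R axis i 1)) 0"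

text \<open>
  The Hessians at the origin that define the blocks A, \<open>\<Sigma>\<close> and K of the Gaussian
  comparison process, in this order.
\<close>

definition cross_hessian ::
  "'w measure \<Rightarrow> ('w \<Rightarrow> real ^ 'd) \<Rightarrow> ('w \<Rightarrow> real ^ 'd) \<Rightarrow> real ^ 'd ^ 'd" where
  "cross_hessian \<gamma> W Ws =
     (\<chi> i j. partial_deriv i (\<lambda>v. partial_deriv j (\<lambda>u. joint_log_mgf \<gamma> W Ws v u) 0) 0)"

definition noise_hessian ::
  "'w measure \<Rightarrow> ('w \<Rightarrow> real ^ 'd) \<Rightarrow> ('w \<Rightarrow> real ^ 'd) \<Rightarrow> real ^ 'd ^ 'd" where
  "noise_hessian \<gamma> W Ws =
     (\<chi> i j. partial_deriv i (partial_deriv j (\<lambda>v. joint_log_mgf \<gamma> W Ws v 0)) 0)"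

definition model_hessian :: "'w measure \<Rightarrow> ('w \<Rightarrow> real ^ 'd) \<Rightarrow> real ^ 'd ^ 'd" where
  "model_hessian \<mu> W = (\<chi> i j. partial_deriv i (partial_deriv j (log_mgf \<mu> W)) 0)"

section \<open>The likelihood process and the data-generating law\<close>

definition log_lik ::
  "nat \<Rightarrow> (nat \<Rightarrow> 'p \<Rightarrow> real ^ 'd) \<Rightarrow> 'w measure \<Rightarrow> ('w \<Rightarrow> real ^ 'd) \<Rightarrow> 'p \<Rightarrow> (nat \<Rightarrow> 'w) \<Rightarrow> real" where
  "log_lik k \<eta> \<mu> W t \<omega> = (\<Sum>m<k. W (\<omega> m) \<bullet> \<eta> m t - log_mgf \<mu> W (\<eta> m t))"

definition data_law ::
  "nat \<Rightarrow> (nat \<Rightarrow> 'p \<Rightarrow> real ^ 'd) \<Rightarrow> 'w measure \<Rightarrow> ('w \<Rightarrow> real ^ 'd) \<Rightarrow> 'p \<Rightarrow> (nat \<Rightarrow> 'w) measure" where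
  "data_law k \<eta> \<gamma> Ws \<theta> =
     (\<Pi>\<^sub>M m\<in>{..<k}. density \<gamma> (\<lambda>x. ennreal (exp (Ws x \<bullet> \<eta> m \<theta> - log_mgf \<gamma> Ws (\<eta> m \<theta>)))))"

section \<open>The Gaussian comparison process\<close>

text \<open>The law of \<open>sqrt v * Z\<close> for standard normal Z; this includes the point mass \<open>v = 0\<close>.\<close>

definition centered_normal :: "real \<Rightarrow> real measure" where
  "centered_normal v = distr std_normal_distribution borel (\<lambda>z. sqrt v * z)"

text \<open>
  N is the law of a centered Gaussian vector with (possibly singular) covariance
  operator S: every linear functional is normal with the corresponding variance.
  It lives on the product sigma-algebra, whose points are unspecified at indices
  \<open>m \<ge> k\<close>; the inner product does not see those coordinates.
\<close>

definition centered_gaussian ::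
  "nat \<Rightarrow> ((nat \<Rightarrow> real ^ 'd) \<Rightarrow> (nat \<Rightarrow> real ^ 'd)) \<Rightarrow> (nat \<Rightarrow> real ^ 'd) measure \<Rightarrow> bool" where
  "centered_gaussian k S N \<longleftrightarrow>
     prob_space N \<and> sets N = sets (\<Pi>\<^sub>M m\<in>{..<k}. borel) \<and>
     (\<forall>h\<in>direct_sum k.
        distr N borel (\<lambda>x. dsum_inner k x h) = centered_normal (dsum_inner k (S h) h))"

definition gauss_process ::
  "nat \<Rightarrow> (nat \<Rightarrow> 'p \<Rightarrow> real ^ 'd) \<Rightarrow> real ^ 'd ^ 'd \<Rightarrow> real ^ 'd ^ 'd \<Rightarrow> 'p \<Rightarrow> 'p \<Rightarrow>
     (nat \<Rightarrow> real ^ 'd) \<Rightarrow> real" where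
  "gauss_process k \<eta> A0 K0 \<theta> t \<xi> =
     dsum_inner k \<xi> (global_feature k \<eta> t)
     + dsum_inner k (block_diag k A0 (global_feature k \<eta> \<theta>)) (global_feature k \<eta> t)
     - 1 / 2 * dsum_inner k (block_diag k K0 (global_feature k \<eta> t)) (global_feature k \<eta> t)"

definition bias_term ::
  "nat \<Rightarrow> (nat \<Rightarrow> 'p \<Rightarrow> real ^ 'd) \<Rightarrow> real \<Rightarrow> real ^ 'd ^ 'd \<Rightarrow> 'p \<Rightarrow> 'p \<Rightarrow> real" where
  "bias_term k \<eta> a H0 \<theta> t =
     a * dsum_inner k
           (block_diag k H0 (global_feature k \<eta> \<theta> - global_feature k \<eta> t))
           (global_feature k \<eta> \<theta> - global_feature k \<eta> t)"

definition perturbation ::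
  "nat \<Rightarrow> (nat \<Rightarrow> 'p \<Rightarrow> real ^ 'd) \<Rightarrow> real ^ 'd ^ 'd \<Rightarrow> real \<Rightarrow> real ^ 'd ^ 'd \<Rightarrow> 'p \<Rightarrow> 'p \<Rightarrow>
     (nat \<Rightarrow> real ^ 'd) \<Rightarrow> real" where
  "perturbation k \<eta> \<Sigma>0 a H0 \<theta> t \<xi> =
     dsum_inner k \<xi>
       (pseudoinverse k (block_diag k \<Sigma>0) (block_diag k H0 (global_feature k \<eta> t)))
     + bias_term k \<eta> a H0 \<theta> t"

section \<open>Gibbs averages\<close>

definition test_fun ::
  "nat \<Rightarrow> (nat \<Rightarrow> 'p \<Rightarrow> real ^ 'd) \<Rightarrow> real \<Rightarrow> real ^ 'd ^ 'd \<Rightarrow> 'p \<Rightarrow> 'p \<Rightarrow> 'p \<Rightarrow> real" where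
  "test_fun k \<eta> a H0 \<theta> s t =
     bias_term k \<eta> a H0 \<theta> t
     + dsum_inner k (block_diag k H0 (global_feature k \<eta> t)) (global_feature k \<eta> t)
     - dsum_inner k (block_diag k H0 (global_feature k \<eta> s)) (global_feature k \<eta> t)"

definition gibbs :: "'p measure \<Rightarrow> ('p \<Rightarrow> real) \<Rightarrow> 'p measure" where
  "gibbs p Z = density p (\<lambda>t. ennreal (exp (Z t) / (\<integral>s. exp (Z s) \<partial>p)))"

text \<open>The monadic bind is the averaged measure: \<open>E[\<pi>\<^sub>Z \<otimes> \<pi>\<^sub>Z](S)\<close> is the mean of \<open>(\<pi>\<^sub>Z \<otimes> \<pi>\<^sub>Z)(S)\<close>.\<close>

definition mean_gibbs_pair :: "'o measure \<Rightarrow> 'p measure \<Rightarrow> ('p \<Rightarrow> 'o \<Rightarrow> real) \<Rightarrow> ('p \<times> 'p) measure" where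
  "mean_gibbs_pair Q p Z =
     Q \<bind> (\<lambda>\<omega>. gibbs p (\<lambda>t. Z t \<omega>) \<Otimes>\<^sub>M gibbs p (\<lambda>t. Z t \<omega>))"

definition Phi_lik ::
  "nat \<Rightarrow> nat \<Rightarrow> (nat \<Rightarrow> 'p \<Rightarrow> real ^ 'd) \<Rightarrow> 'w measure \<Rightarrow> 'w measure \<Rightarrow>
     ('w \<Rightarrow> real ^ 'd) \<Rightarrow> ('w \<Rightarrow> real ^ 'd) \<Rightarrow> 'p measure \<Rightarrow> real \<Rightarrow> real ^ 'd ^ 'd \<Rightarrow> 'p \<Rightarrow> real" where
  "Phi_lik n k \<eta> \<mu> \<gamma> W Ws p a H0 \<theta> =
     1 / real n *
     (\<integral>st. test_fun k \<eta> a H0 \<theta> (fst st) (snd st)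
        \<partial>(mean_gibbs_pair (data_law k \<eta> \<gamma> Ws \<theta>) p (log_lik k \<eta> \<mu> W)))"

definition Phi_gauss ::
  "nat \<Rightarrow> nat \<Rightarrow> (nat \<Rightarrow> 'p \<Rightarrow> real ^ 'd) \<Rightarrow> 'w measure \<Rightarrow> 'w measure \<Rightarrow>
     ('w \<Rightarrow> real ^ 'd) \<Rightarrow> ('w \<Rightarrow> real ^ 'd) \<Rightarrow> (nat \<Rightarrow> real ^ 'd) measure \<Rightarrow> 'p measure \<Rightarrow>
     real \<Rightarrow> real ^ 'd ^ 'd \<Rightarrow> 'p \<Rightarrow> real \<Rightarrow> real" where
  "Phi_gauss n k \<eta> \<mu> \<gamma> W Ws N p a H0 \<theta> \<beta> =
     1 / real n *
     (\<integral>st. test_fun k \<eta> a H0 \<theta> (fst st) (snd st)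
        \<partial>(mean_gibbs_pair N p
             (\<lambda>t \<xi>. gauss_process k \<eta> (cross_hessian \<gamma> W Ws) (model_hessian \<mu> W) \<theta> t \<xi>
                    + \<beta> * perturbation k \<eta> (noise_hessian \<gamma> W Ws) a H0 \<theta> t \<xi>)))"

end

theory Submission
  imports Defs
begin

text \<open>
  Both Gibbs measures arise from a field \<open>Z t = (\<Sum>m<k. \<xi> m \<bullet> x m t) + D t\<close> with independent centred
  blocks \<open>\<xi> m\<close> and a deterministic drift. For the likelihood, \<open>\<xi> m\<close> is an observation minus its mean under
  the data-generating law and \<open>x m\<close> is the feature map \<open>\<eta> m\<close>. For the perturbed Gaussian process, \<open>\<xi> m\<close>
  is normal and \<open>x m = \<eta> m + \<beta> B \<eta> m\<close>, where the matrix \<open>B\<close> satisfies \<open>\<Sigma>\<^sub>0 B = H\<^sub>0\<close>. In a field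
  of features of size \<open>r\<close>, free energies and Gibbs means are smooth functions of each block whose derivatives of order
  \<open>j\<close> have size \<open>r ^ j\<close>. Hence two laws of a block that agree in mean, and in covariance up to \<open>O r\<close>, give the
  same expected free energy up to \<open>O (r ^ 3)\<close>.

  Let \<open>V\<close> be the field with features \<open>B \<eta> m\<close> and the bias as drift. Integration by parts in the
  blocks replaces \<open>\<xi> \<xi>\<^sup>T\<close> by \<open>\<Sigma>\<^sub>0\<close>, and \<open>\<Sigma>\<^sub>0 B = H\<^sub>0\<close> makes the mean of \<open>V\<close> equal to
  the two-replica mean of the test function, up to \<open>O (k r ^ 3)\<close>, plus \<open>O (\<epsilon> k r\<^sup>2)\<close> if the features are perturbed
  (\<open>gibbs_mean_integration_by_parts\<close>, \<open>gibbs_cov_transported\<close>). On the other hand the mean of \<open>V\<close> is the derivative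
  of the expected free energy in the direction \<open>V\<close>. Free energies, unlike the means themselves, can be compared directly: Lindeberg's
  method exchanges the blocks one by one at a total cost of \<open>O (k r ^ 3)\<close> (\<open>log_partition_lindeberg\<close>). By convexity, the
  slope at 0 for the likelihood is at most the difference quotient with increment \<open>\<epsilon>\<close>, and the slope at \<open>\<epsilon>\<close> for the
  Gaussian process is at least the corresponding quotient; increments \<open>- \<epsilon>\<close> give the lower bound
  (\<open>response_comparison\<close>). Since \<open>k r\<^sup>2\<close> is of order \<open>n\<close>, the Lindeberg error divided by \<open>\<epsilon>\<close> is of order
  \<open>n r / \<epsilon>\<close> and the remaining errors are of order \<open>n \<epsilon>\<close> or \<open>n r\<close>.

  Three inputs remain. The moment conditions for the recentred observations and the agreement of the drifts up to
  \<open>O (k r ^ 3)\<close> come from Taylor expansions of exponential families at the origin (\<open>tilted_law\<close>, \<open>log_mgf_expansion\<close>).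
  The Gaussian law is only known through linear functionals; these determine it, so its blocks are independent
  (\<open>eq_prod_marginals\<close>). The Moore-Penrose inverse of a block-diagonal operator is unique and acts by a single matrix in every
  block (\<open>perturbation_direction\<close>).
\<close>

section \<open>Gibbs means and free energies\<close>

text \<open>
  All derivatives under an integral sign below come from an explicit quadratic remainder, so that no
  dominated-convergence argument is repeated.
\<close>

lemma DERIV_at_0_of_quadratic_remainder:
  fixes g :: "real \<Rightarrow> real"
  assumes "\<delta> > 0" and rem: "\<And>h. \<bar>h\<bar> < \<delta> \<Longrightarrow> \<bar>g h - g 0 - h * D\<bar> \<le> C * h\<^sup>2"
  shows "(g has_real_derivative D) (at 0)"
proof -
  have "((\<lambda>h. (g h - g 0 - h * D) / h) \<longlongrightarrow> 0) (at 0)"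
  proof (rule Lim_null_comparison)
    show "\<forall>\<^sub>F h in at 0. norm ((g h - g 0 - h * D) / h) \<le> \<bar>C\<bar> * \<bar>h\<bar>"
      unfolding eventually_at
    proof (intro exI[of _ \<delta>] conjI ballI impI)
      fix h :: real assume h: "h \<noteq> 0 \<and> dist h 0 < \<delta>"
      have "\<bar>g h - g 0 - h * D\<bar> \<le> \<bar>C\<bar> * h\<^sup>2"
        using order.trans[OF rem[of h] mult_right_mono[OF abs_ge_self[of C]]] h by simp
      then show "norm ((g h - g 0 - h * D) / h) \<le> \<bar>C\<bar> * \<bar>h\<bar>"
        using h by (simp add: divide_simps power2_eq_square abs_mult)
    qed (use assms in auto)
    show "((\<lambda>h. \<bar>C\<bar> * \<bar>h\<bar>) \<longlongrightarrow> 0) (at 0)"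
      by (auto intro!: tendsto_eq_intros)
  qed
  then have "((\<lambda>h. (g h - g 0 - h * D) / h + D) \<longlongrightarrow> 0 + D) (at 0)"
    by (intro tendsto_intros)
  moreover have "\<forall>\<^sub>F h in at 0. (g h - g 0 - h * D) / h + D = (g h - g 0) / h"
    unfolding eventually_at by (rule exI[of _ 1]) (simp add: field_simps)
  ultimately have "((\<lambda>h. (g h - g 0) / h) \<longlongrightarrow> D) (at 0)"
    by (simp add: tendsto_cong)
  then show ?thesis by (simp add: DERIV_def)
qed

lemma exp_minus_1_bound: "\<bar>exp x - 1\<bar> \<le> \<bar>x\<bar> * exp \<bar>x\<bar>" for x :: real
proof -
  have "exp x - 1 \<le> x * exp x"
    using exp_ge_add_one_self[of "-x"] by (simp add: exp_minus field_simps)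
  moreover have "exp x - 1 \<ge> x" using exp_ge_add_one_self[of x] by linarith
  moreover have "x * exp x \<le> \<bar>x\<bar> * exp \<bar>x\<bar>" by (intro mult_mono) auto
  moreover have "- x \<le> \<bar>x\<bar> * exp \<bar>x\<bar>"
    using mult_left_mono[of 1 "exp \<bar>x\<bar>" "\<bar>x\<bar>"] by auto
  ultimately show ?thesis by linarith
qed

lemma exp_taylor_bound1: "\<bar>exp x - 1 - x\<bar> \<le> x\<^sup>2 * exp \<bar>x\<bar>" for x :: real
proof -
  obtain t where t: "\<bar>t\<bar> \<le> \<bar>x\<bar>" "exp x = (\<Sum>m<2. x ^ m / fact m) + exp t / fact 2 * x ^ 2"
    using Maclaurin_exp_le[of x 2] by auto
  have eq: "exp x - 1 - x = exp t / 2 * x\<^sup>2" using t by (simp add: numeral_2_eq_2)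
  have "exp t / 2 \<le> exp \<bar>x\<bar>" using t exp_le_cancel_iff[of t "\<bar>x\<bar>"] exp_gt_zero[of t] by linarith
  then have "exp t / 2 * x\<^sup>2 \<le> exp \<bar>x\<bar> * x\<^sup>2" by (rule mult_right_mono) simp
  then show ?thesis unfolding eq abs_mult by (simp add: mult.commute)
qed

lemma exp_taylor_bound2: "\<bar>exp x - 1 - x - x\<^sup>2 / 2\<bar> \<le> \<bar>x\<bar> ^ 3 * exp \<bar>x\<bar>" for x :: real
proof -
  obtain t where t: "\<bar>t\<bar> \<le> \<bar>x\<bar>" "exp x = (\<Sum>m<3. x ^ m / fact m) + exp t / fact 3 * x ^ 3"
    using Maclaurin_exp_le[of x 3] by auto
  have eq: "exp x - 1 - x - x\<^sup>2 / 2 = exp t / 6 * x ^ 3" using t by (simp add: numeral_3_eq_3 numeral_2_eq_2)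
  have "exp t / 6 \<le> exp \<bar>x\<bar>" using t exp_le_cancel_iff[of t "\<bar>x\<bar>"] exp_gt_zero[of t] by linarith
  then have "exp t / 6 * \<bar>x\<bar> ^ 3 \<le> exp \<bar>x\<bar> * \<bar>x\<bar> ^ 3" by (rule mult_right_mono) simp
  then show ?thesis unfolding eq abs_mult by (simp add: mult.commute power_abs)
qed

text \<open>
  The second-order Taylor remainder of the exponential is dominated by
  \<open>V\<^sup>2 exp (\<delta> \<bar>V\<bar>)\<close>. Stating the result at 0 loses nothing: a factor \<open>exp (s * V)\<close> can be
  absorbed into \<open>f\<close>. It serves bounded Gibbs weights and unbounded exponential families alike.
\<close>

lemma DERIV_integral_exp:
  fixes f V :: "'a \<Rightarrow> real"
  assumes \<delta>: "\<delta> > 0" and [measurable]: "f \<in> borel_measurable M" "V \<in> borel_measurable M"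
    and f: "integrable M f" and fV: "integrable M (\<lambda>x. f x * V x)"
    and dom: "integrable M (\<lambda>x. f x * ((V x)\<^sup>2 * exp (\<delta> * \<bar>V x\<bar>)))"
  shows "((\<lambda>h. \<integral>x. f x * exp (h * V x) \<partial>M) has_real_derivative (\<integral>x. f x * V x \<partial>M)) (at 0)"
proof (rule DERIV_at_0_of_quadratic_remainder[OF \<delta>])
  fix h :: real assume h: "\<bar>h\<bar> < \<delta>"
  have bound: "\<bar>f x * exp (h * V x) - f x - h * (f x * V x)\<bar> \<le> h\<^sup>2 * \<bar>f x * ((V x)\<^sup>2 * exp (\<delta> * \<bar>V x\<bar>))\<bar>" for x
  proof -
    have "f x * exp (h * V x) - f x - h * (f x * V x) = f x * (exp (h * V x) - 1 - h * V x)"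
      by (simp add: algebra_simps)
    then have "\<bar>f x * exp (h * V x) - f x - h * (f x * V x)\<bar> = \<bar>f x\<bar> * \<bar>exp (h * V x) - 1 - h * V x\<bar>"
      by (simp only: abs_mult)
    also have "\<dots> \<le> \<bar>f x\<bar> * ((h * V x)\<^sup>2 * exp \<bar>h * V x\<bar>)"
      by (intro mult_left_mono exp_taylor_bound1) auto
    also have "\<dots> \<le> \<bar>f x\<bar> * ((h * V x)\<^sup>2 * exp (\<delta> * \<bar>V x\<bar>))"
      using h by (intro mult_left_mono) (auto simp: abs_mult mult_right_mono)
    finally show ?thesis by (simp add: abs_mult power_mult_distrib mult_ac)
  qed
  have int_rem: "integrable M (\<lambda>x. f x * exp (h * V x) - f x - h * (f x * V x))"
    by (rule Bochner_Integration.integrable_bound[OF integrable_mult_right[OF integrable_abs[OF dom], of "h\<^sup>2"]])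
       (use bound in \<open>auto simp: abs_mult\<close>)
  have "integrable M (\<lambda>x. (f x * exp (h * V x) - f x - h * (f x * V x)) + f x + h * (f x * V x))"
    by (intro Bochner_Integration.integrable_add int_rem f integrable_mult_right fV)
  then have int_exp: "integrable M (\<lambda>x. f x * exp (h * V x))" by simp
  have "(\<integral>x. f x * exp (h * V x) \<partial>M) - (\<integral>x. f x * exp (0 * V x) \<partial>M) - h * (\<integral>x. f x * V x \<partial>M)
     = (\<integral>x. f x * exp (h * V x) - f x - h * (f x * V x) \<partial>M)"
    using int_exp f fV by (simp add: Bochner_Integration.integral_diff)
  also have "\<bar>\<dots>\<bar> \<le> (\<integral>x. \<bar>f x * exp (h * V x) - f x - h * (f x * V x)\<bar> \<partial>M)"
    by simp
  also have "\<dots> \<le> (\<integral>x. h\<^sup>2 * \<bar>f x * ((V x)\<^sup>2 * exp (\<delta> * \<bar>V x\<bar>))\<bar> \<partial>M)"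
    by (rule integral_mono) (use bound int_rem dom in \<open>auto intro!: integrable_mult_right integrable_abs\<close>)
  finally show "\<bar>(\<integral>x. f x * exp (h * V x) \<partial>M) - (\<integral>x. f x * exp (0 * V x) \<partial>M) - h * (\<integral>x. f x * V x \<partial>M)\<bar>
     \<le> (\<integral>x. \<bar>f x * ((V x)\<^sup>2 * exp (\<delta> * \<bar>V x\<bar>))\<bar> \<partial>M) * h\<^sup>2"
    by (simp add: mult.commute)
qed

text \<open>
  Bounded on the space only: a density or a feature map may be arbitrary outside it.
\<close>

definition bfun :: "'a measure \<Rightarrow> ('a \<Rightarrow> real) set" where
  "bfun M = {f \<in> borel_measurable M. \<exists>c. \<forall>x\<in>space M. \<bar>f x\<bar> \<le> c}"

lemma bfunI: "f \<in> borel_measurable M \<Longrightarrow> (\<And>x. x \<in> space M \<Longrightarrow> \<bar>f x\<bar> \<le> c) \<Longrightarrow> f \<in> bfun M"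
  unfolding bfun_def by auto

lemma bfunE:
  assumes "f \<in> bfun M"
  obtains c where "c \<ge> 0" "\<And>x. x \<in> space M \<Longrightarrow> \<bar>f x\<bar> \<le> c"
proof -
  obtain c where "\<forall>x\<in>space M. \<bar>f x\<bar> \<le> c" using assms unfolding bfun_def by auto
  then show ?thesis using that[of "max c 0"] by (auto simp: le_max_iff_disj)
qed

lemma bfun_measurable[measurable_dest]: "f \<in> bfun M \<Longrightarrow> f \<in> borel_measurable M"
  unfolding bfun_def by auto

lemma bfun_const[intro!, simp]: "(\<lambda>x. c) \<in> bfun M"
  by (rule bfunI[of _ _ "\<bar>c\<bar>"]) auto

lemma bfun_add[intro!]:
  assumes "f \<in> bfun M" "g \<in> bfun M" shows "(\<lambda>x. f x + g x) \<in> bfun M"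
proof -
  note [measurable] = assms[THEN bfun_measurable]
  from assms(1) obtain c where c: "\<And>x. x \<in> space M \<Longrightarrow> \<bar>f x\<bar> \<le> c" by (rule bfunE) blast
  from assms(2) obtain c' where c': "\<And>x. x \<in> space M \<Longrightarrow> \<bar>g x\<bar> \<le> c'" by (rule bfunE) blast
  show ?thesis by (rule bfunI[of _ _ "c + c'"]) (use c c' in \<open>measurable, force\<close>)
qed

lemma bfun_mult[intro!]:
  assumes "f \<in> bfun M" "g \<in> bfun M" shows "(\<lambda>x. f x * g x) \<in> bfun M"
proof -
  note [measurable] = assms[THEN bfun_measurable]
  from assms(1) obtain c where c: "c \<ge> 0" "\<And>x. x \<in> space M \<Longrightarrow> \<bar>f x\<bar> \<le> c" by (rule bfunE) blast
  from assms(2) obtain c' where c': "c' \<ge> 0" "\<And>x. x \<in> space M \<Longrightarrow> \<bar>g x\<bar> \<le> c'" by (rule bfunE) blast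
  show ?thesis by (rule bfunI[of _ _ "c * c'"]) (use c c' in \<open>auto simp: abs_mult intro: mult_mono\<close>)
qed

lemma bfun_uminus[intro!]: "f \<in> bfun M \<Longrightarrow> (\<lambda>x. - f x) \<in> bfun M"
  using bfun_mult[OF bfun_const[of "-1"]] by simp

lemma bfun_diff[intro!]: "f \<in> bfun M \<Longrightarrow> g \<in> bfun M \<Longrightarrow> (\<lambda>x. f x - g x) \<in> bfun M"
  using bfun_add[OF _ bfun_uminus] by fastforce

lemma bfun_power2[intro!]: "f \<in> bfun M \<Longrightarrow> (\<lambda>x. (f x)\<^sup>2) \<in> bfun M"
  by (auto simp: power2_eq_square)

lemma bfun_sum[intro!]: "(\<And>i. i \<in> I \<Longrightarrow> f i \<in> bfun M) \<Longrightarrow> (\<lambda>x. \<Sum>i\<in>I. f i x) \<in> bfun M"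
  by (induction I rule: infinite_finite_induct) auto

lemma bfun_abs[intro!]:
  assumes "f \<in> bfun M" shows "(\<lambda>x. \<bar>f x\<bar>) \<in> bfun M"
proof -
  note [measurable] = assms[THEN bfun_measurable]
  from assms(1) obtain c where "\<And>x. x \<in> space M \<Longrightarrow> \<bar>f x\<bar> \<le> c" by (rule bfunE) blast
  then show ?thesis by (intro bfunI[of _ _ c]) auto
qed

lemma bfun_exp[intro!]:
  assumes "f \<in> bfun M" shows "(\<lambda>x. exp (f x)) \<in> bfun M"
proof -
  note [measurable] = assms[THEN bfun_measurable]
  from assms(1) obtain c where c: "\<And>x. x \<in> space M \<Longrightarrow> \<bar>f x\<bar> \<le> c" by (rule bfunE) blast
  show ?thesis by (rule bfunI[of _ _ "exp c"]) (use c in \<open>auto simp: abs_le_iff\<close>)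
qed

definition log_partition :: "'a measure \<Rightarrow> ('a \<Rightarrow> real) \<Rightarrow> real" where
  "log_partition p Z = ln (\<integral>t. exp (Z t) \<partial>p)"

text \<open>
  Gibbs means are quotients of integrals against the reference measure; the measure \<open>gibbs p Z\<close> itself
  enters only once, where the averaged pair measure is unfolded.
\<close>

definition gibbs_mean :: "'a measure \<Rightarrow> ('a \<Rightarrow> real) \<Rightarrow> ('a \<Rightarrow> real) \<Rightarrow> real" where
  "gibbs_mean p Z f = (\<integral>t. f t * exp (Z t) \<partial>p) / (\<integral>t. exp (Z t) \<partial>p)"

definition gibbs_cov :: "'a measure \<Rightarrow> ('a \<Rightarrow> real) \<Rightarrow> ('a \<Rightarrow> real) \<Rightarrow> ('a \<Rightarrow> real) \<Rightarrow> real" where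
  "gibbs_cov p Z f g = gibbs_mean p Z (\<lambda>t. f t * g t) - gibbs_mean p Z f * gibbs_mean p Z g"

lemma mvt_bound_01:
  fixes g :: "real \<Rightarrow> real"
  assumes "\<And>s. 0 \<le> s \<Longrightarrow> s \<le> 1 \<Longrightarrow> (g has_real_derivative g' s) (at s)"
    and "\<And>s. 0 \<le> s \<Longrightarrow> s \<le> 1 \<Longrightarrow> \<bar>g' s\<bar> \<le> c" and u: "0 \<le> u" "u \<le> 1"
  shows "\<bar>g u - g 0\<bar> \<le> c * u"
proof (cases "u = 0")
  case False
  then have "0 < u" using u by auto
  from MVT2[OF this, of g g'] assms obtain z where "0 < z" "z < u" "g u - g 0 = (u - 0) * g' z" by force
  then show ?thesis using assms(2)[of z] u by (simp add: abs_mult mult.commute mult_right_mono)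
qed auto

context prob_space begin

lemma bfun_integrable:
  assumes "f \<in> bfun M" shows "integrable M f"
proof -
  obtain c where "\<And>x. x \<in> space M \<Longrightarrow> \<bar>f x\<bar> \<le> c" by (rule bfunE[OF assms]) blast
  then show ?thesis using bfun_measurable[OF assms] by (intro integrable_const_bound[of _ c]) auto
qed

lemma partition_pos: assumes "Z \<in> bfun M" shows "0 < (\<integral>t. exp (Z t) \<partial>M)"
proof -
  obtain c where c: "\<And>x. x \<in> space M \<Longrightarrow> \<bar>Z x\<bar> \<le> c" by (rule bfunE[OF assms]) blast
  have "(\<integral>t. exp (- c) \<partial>M) \<le> (\<integral>t. exp (Z t) \<partial>M)"
    by (rule integral_mono) (use c in \<open>auto intro!: bfun_integrable assms simp: abs_le_iff\<close>,
      metis c abs_le_iff minus_le_iff)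
  then show ?thesis using less_le_trans[OF exp_gt_zero[of "-c"]] by (simp add: prob_space)
qed

lemma gibbs_mean_add:
  "Z \<in> bfun M \<Longrightarrow> f \<in> bfun M \<Longrightarrow> g \<in> bfun M \<Longrightarrow>
    gibbs_mean M Z (\<lambda>t. f t + g t) = gibbs_mean M Z f + gibbs_mean M Z g"
  unfolding gibbs_mean_def
  by (subst add_divide_distrib[symmetric], subst Bochner_Integration.integral_add[symmetric])
     (auto intro!: bfun_integrable simp: algebra_simps)

lemma gibbs_mean_cmult: "gibbs_mean M Z (\<lambda>t. c * f t) = c * gibbs_mean M Z f"
  unfolding gibbs_mean_def by (simp add: mult.assoc)

lemma gibbs_mean_const: "Z \<in> bfun M \<Longrightarrow> gibbs_mean M Z (\<lambda>t. c) = c"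
  unfolding gibbs_mean_def using partition_pos[of Z] by simp

lemma gibbs_mean_diff:
  "Z \<in> bfun M \<Longrightarrow> f \<in> bfun M \<Longrightarrow> g \<in> bfun M \<Longrightarrow>
    gibbs_mean M Z (\<lambda>t. f t - g t) = gibbs_mean M Z f - gibbs_mean M Z g"
  using gibbs_mean_add[of Z f "\<lambda>t. - 1 * g t"] gibbs_mean_cmult[of Z "-1" g] by auto

lemma gibbs_mean_sum:
  "Z \<in> bfun M \<Longrightarrow> (\<And>i. i \<in> I \<Longrightarrow> f i \<in> bfun M) \<Longrightarrow>
    gibbs_mean M Z (\<lambda>t. \<Sum>i\<in>I. f i t) = (\<Sum>i\<in>I. gibbs_mean M Z (f i))"
proof (induction I rule: infinite_finite_induct)
  case (insert x F)
  then show ?case by (simp, subst gibbs_mean_add) auto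
qed (auto simp: gibbs_mean_const)

lemma gibbs_mean_bound:
  assumes Z: "Z \<in> bfun M" and f: "f \<in> bfun M" and c: "\<And>t. t \<in> space M \<Longrightarrow> \<bar>f t\<bar> \<le> c"
  shows "\<bar>gibbs_mean M Z f\<bar> \<le> c"
proof -
  have "\<bar>\<integral>t. f t * exp (Z t) \<partial>M\<bar> \<le> (\<integral>t. \<bar>f t * exp (Z t)\<bar> \<partial>M)" by simp
  also have "\<dots> \<le> (\<integral>t. c * exp (Z t) \<partial>M)"
    by (rule integral_mono) (use Z f c in \<open>auto intro!: bfun_integrable integrable_abs simp: abs_mult\<close>)
  finally show ?thesis unfolding gibbs_mean_def using partition_pos[OF Z]
    by (simp add: abs_divide divide_le_eq)
qed

lemma gibbs_cov_bound:
  assumes Z: "Z \<in> bfun M" and f: "f \<in> bfun M" "\<And>t. t \<in> space M \<Longrightarrow> \<bar>f t\<bar> \<le> c"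
    and g: "g \<in> bfun M" "\<And>t. t \<in> space M \<Longrightarrow> \<bar>g t\<bar> \<le> d"
  shows "\<bar>gibbs_cov M Z f g\<bar> \<le> 2 * (c * d)"
proof -
  have 1: "\<bar>gibbs_mean M Z (\<lambda>t. f t * g t)\<bar> \<le> c * d"
    by (rule gibbs_mean_bound) (use assms in \<open>auto simp: abs_mult intro!: mult_mono order.trans[OF abs_ge_zero f(2)]\<close>)
  have 2: "\<bar>gibbs_mean M Z f * gibbs_mean M Z g\<bar> \<le> c * d"
    unfolding abs_mult by (intro mult_mono gibbs_mean_bound Z f g order.trans[OF abs_ge_zero gibbs_mean_bound[OF Z f]]) auto
  show ?thesis unfolding gibbs_cov_def using 1 2 by linarith
qed

lemma gibbs_cov_sum_left:
  assumes "Z \<in> bfun M" "\<And>i. i \<in> I \<Longrightarrow> f i \<in> bfun M" "g \<in> bfun M"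
  shows "gibbs_cov M Z (\<lambda>t. \<Sum>i\<in>I. f i t) g = (\<Sum>i\<in>I. gibbs_cov M Z (f i) g)"
  unfolding gibbs_cov_def using assms
  by (simp add: sum_distrib_right gibbs_mean_sum bfun_mult sum_subtractf)

lemma gibbs_cov_commute: "gibbs_cov M Z f g = gibbs_cov M Z g f"
  unfolding gibbs_cov_def by (simp add: mult.commute)

lemma gibbs_cov_sum_right:
  assumes "Z \<in> bfun M" "\<And>i. i \<in> I \<Longrightarrow> f i \<in> bfun M" "g \<in> bfun M"
  shows "gibbs_cov M Z g (\<lambda>t. \<Sum>i\<in>I. f i t) = (\<Sum>i\<in>I. gibbs_cov M Z g (f i))"
  using gibbs_cov_sum_left[OF assms] by (simp add: gibbs_cov_commute)

lemma gibbs_cov_cmult_left: "gibbs_cov M Z (\<lambda>t. c * f t) g = c * gibbs_cov M Z f g"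
  unfolding gibbs_cov_def by (simp add: gibbs_mean_cmult mult.assoc algebra_simps)

lemma gibbs_cov_cmult_right: "gibbs_cov M Z f (\<lambda>t. c * g t) = c * gibbs_cov M Z f g"
  using gibbs_cov_cmult_left by (simp add: gibbs_cov_commute)

lemma gibbs_cov_add_right:
  assumes "Z \<in> bfun M" "f \<in> bfun M" "g \<in> bfun M" "h \<in> bfun M"
  shows "gibbs_cov M Z f (\<lambda>t. g t + h t) = gibbs_cov M Z f g + gibbs_cov M Z f h"
  unfolding gibbs_cov_def using assms
  by (simp add: distrib_left gibbs_mean_add bfun_mult)

lemma DERIV_integral_exp_path:
  assumes Z: "Z \<in> bfun M" and V: "V \<in> bfun M" and f: "f \<in> bfun M"
  shows "((\<lambda>s. \<integral>t. f t * exp (Z t + s * V t) \<partial>M) has_real_derivative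
          (\<integral>t. f t * V t * exp (Z t + s * V t) \<partial>M)) (at s)"
proof -
  have "((\<lambda>h. \<integral>t. (f t * exp (Z t + s * V t)) * exp (h * V t) \<partial>M) has_real_derivative
          (\<integral>t. (f t * exp (Z t + s * V t)) * V t \<partial>M)) (at 0)"
    by (rule DERIV_integral_exp[of 1])
       (use Z V f in \<open>auto intro!: bfun_integrable bfun_measurable\<close>)
  then have "((\<lambda>h. \<integral>t. f t * exp (Z t + (h + s) * V t) \<partial>M) has_real_derivative
          (\<integral>t. f t * V t * exp (Z t + s * V t) \<partial>M)) (at 0)"
    by (simp add: exp_add algebra_simps)
  then show ?thesis using DERIV_shift[of _ _ 0 s] by (simp add: add.commute)
qed

text \<open>
  The fluctuation-response identity: moving the field in direction \<open>V\<close> changes a Gibbs mean by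
  the Gibbs covariance with \<open>V\<close>.
\<close>

lemma DERIV_gibbs_mean:
  assumes Z: "Z \<in> bfun M" and V: "V \<in> bfun M" and f: "f \<in> bfun M"
  shows "((\<lambda>s. gibbs_mean M (\<lambda>t. Z t + s * V t) f) has_real_derivative
          gibbs_cov M (\<lambda>t. Z t + s * V t) f V) (at s)"
proof -
  have Zs: "(\<lambda>t. Z t + s * V t) \<in> bfun M" using Z V by auto
  have "((\<lambda>s. \<integral>t. exp (Z t + s * V t) \<partial>M) has_real_derivative
          (\<integral>t. V t * exp (Z t + s * V t) \<partial>M)) (at s)"
    using DERIV_integral_exp_path[OF Z V bfun_const[of 1], of s] by simp
  from DERIV_divide[OF DERIV_integral_exp_path[OF Z V f] this]
  show ?thesis unfolding gibbs_mean_def gibbs_cov_def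
    using partition_pos[OF Zs] by (simp add: field_simps)
qed

lemma DERIV_gibbs_cov:
  assumes Z: "Z \<in> bfun M" and V: "V \<in> bfun M" and f: "f \<in> bfun M" and g: "g \<in> bfun M"
  shows "((\<lambda>s. gibbs_cov M (\<lambda>t. Z t + s * V t) f g) has_real_derivative
    (let Zs = (\<lambda>t. Z t + s * V t) in gibbs_cov M Zs (\<lambda>t. f t * g t) V
      - (gibbs_cov M Zs f V * gibbs_mean M Zs g + gibbs_cov M Zs g V * gibbs_mean M Zs f))) (at s)"
  unfolding gibbs_cov_def[of M _ f g] Let_def
  by (intro DERIV_diff DERIV_gibbs_mean DERIV_mult assms bfun_mult)

lemma DERIV_log_partition:
  assumes Z: "Z \<in> bfun M" and V: "V \<in> bfun M"
  shows "((\<lambda>s. log_partition M (\<lambda>t. Z t + s * V t)) has_real_derivative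
          gibbs_mean M (\<lambda>t. Z t + s * V t) V) (at s)"
proof -
  have Zs: "(\<lambda>t. Z t + s * V t) \<in> bfun M" using Z V by auto
  show ?thesis
    using DERIV_chain2[OF DERIV_ln[OF partition_pos[OF Zs]] DERIV_integral_exp_path[OF Z V bfun_const[of 1], of s, simplified]]
    unfolding log_partition_def gibbs_mean_def by (simp add: field_simps)
qed

text \<open>
  The derivative of a covariance is a third cumulant: three terms, each at most twice the product of the
  bounds.
\<close>

lemma gibbs_cov_lipschitz:
  assumes Z: "Z \<in> bfun M" and V: "V \<in> bfun M" "\<And>t. t \<in> space M \<Longrightarrow> \<bar>V t\<bar> \<le> v"
    and f: "f \<in> bfun M" "\<And>t. t \<in> space M \<Longrightarrow> \<bar>f t\<bar> \<le> c"
    and g: "g \<in> bfun M" "\<And>t. t \<in> space M \<Longrightarrow> \<bar>g t\<bar> \<le> d"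
    and u: "0 \<le> u" "u \<le> 1"
  shows "\<bar>gibbs_cov M (\<lambda>t. Z t + u * V t) f g - gibbs_cov M Z f g\<bar> \<le> 6 * (c * d * v) * u"
proof -
  let ?Z = "\<lambda>s t. Z t + s * V t"
  have b: "\<bar>let Zs = ?Z s in gibbs_cov M Zs (\<lambda>t. f t * g t) V
      - (gibbs_cov M Zs f V * gibbs_mean M Zs g + gibbs_cov M Zs g V * gibbs_mean M Zs f)\<bar> \<le> 6 * (c * d * v)" for s
  proof -
    have Zs: "?Z s \<in> bfun M" using Z V by auto
    have fg: "\<bar>f t * g t\<bar> \<le> c * d" if "t \<in> space M" for t
      unfolding abs_mult by (intro mult_mono f(2)[OF that] g(2)[OF that] order.trans[OF abs_ge_zero f(2)[OF that]]) simp
    have 1: "\<bar>gibbs_cov M (?Z s) (\<lambda>t. f t * g t) V\<bar> \<le> 2 * (c * d * v)"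
      by (rule gibbs_cov_bound[OF Zs bfun_mult[OF f(1) g(1)] fg V])
    have 2: "\<bar>gibbs_cov M (?Z s) f V * gibbs_mean M (?Z s) g\<bar> \<le> 2 * (c * v) * d"
      unfolding abs_mult
      by (rule mult_mono[OF gibbs_cov_bound[OF Zs f V] gibbs_mean_bound[OF Zs g]
            order.trans[OF abs_ge_zero gibbs_cov_bound[OF Zs f V]] abs_ge_zero])
    have 3: "\<bar>gibbs_cov M (?Z s) g V * gibbs_mean M (?Z s) f\<bar> \<le> 2 * (d * v) * c"
      unfolding abs_mult
      by (rule mult_mono[OF gibbs_cov_bound[OF Zs g V] gibbs_mean_bound[OF Zs f]
            order.trans[OF abs_ge_zero gibbs_cov_bound[OF Zs g V]] abs_ge_zero])
    have tri: "\<bar>A - (B + C)\<bar> \<le> \<bar>A\<bar> + \<bar>B\<bar> + \<bar>C\<bar>" for A B C :: real by linarith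
    have "2 * (c * d * v) + 2 * (c * v) * d + 2 * (d * v) * c = 6 * (c * d * v)" by algebra
    then show ?thesis unfolding Let_def
      using order.trans[OF tri add_mono[OF add_mono[OF 1 2] 3]] by (simp only:)
  qed
  note DERIV = DERIV_gibbs_cov[OF Z V(1) f(1) g(1)]
  show ?thesis
    using mvt_bound_01[where g = "\<lambda>s. gibbs_cov M (?Z s) f g" and c = "6 * (c * d * v)", OF DERIV b u]
    by (simp only: mult_zero_left add_0_right)
qed

text \<open>
  No exponential of the bound \<open>v\<close> appears in the remainder, because Gibbs means never exceed
  the bounds of their integrands. Third moments of the random field therefore suffice later on.
\<close>

lemma gibbs_mean_taylor:
  assumes Z: "Z \<in> bfun M" and V: "V \<in> bfun M" "\<And>t. t \<in> space M \<Longrightarrow> \<bar>V t\<bar> \<le> v"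
    and f: "f \<in> bfun M" "\<And>t. t \<in> space M \<Longrightarrow> \<bar>f t\<bar> \<le> c"
    and u: "0 \<le> u" "u \<le> 1"
  shows "\<bar>gibbs_mean M (\<lambda>t. Z t + u * V t) f - gibbs_mean M Z f - u * gibbs_cov M Z f V\<bar> \<le> 6 * (c * v\<^sup>2) * u"
proof -
  let ?Z = "\<lambda>s t. Z t + s * V t"
  have cv: "0 \<le> c * v * v"
  proof -
    obtain t where "t \<in> space M" using not_empty by auto
    then show ?thesis using order.trans[OF abs_ge_zero f(2)] order.trans[OF abs_ge_zero V(2)] by simp
  qed
  have bound: "\<bar>gibbs_cov M (?Z s) f V - gibbs_cov M Z f V\<bar> \<le> 6 * (c * v\<^sup>2)" if "0 \<le> s" "s \<le> 1" for s
  proof -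
    have "6 * (c * v * v) * s \<le> 6 * (c * v * v) * 1" using cv that by (intro mult_left_mono) auto
    also have "\<dots> = 6 * (c * v\<^sup>2)" by (simp add: power2_eq_square)
    finally show ?thesis using gibbs_cov_lipschitz[OF Z V f V that] by linarith
  qed
  have deriv: "((\<lambda>s. gibbs_mean M (?Z s) f - s * gibbs_cov M Z f V) has_real_derivative
      gibbs_cov M (?Z s) f V - gibbs_cov M Z f V) (at s)" for s
    using DERIV_gibbs_mean[OF Z V(1) f(1), of s] by (auto intro!: derivative_eq_intros)
  from mvt_bound_01[OF deriv bound u] show ?thesis by simp
qed

lemma log_partition_taylor:
  assumes Z: "Z \<in> bfun M" and V: "V \<in> bfun M" "\<And>t. t \<in> space M \<Longrightarrow> \<bar>V t\<bar> \<le> v"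
  shows "\<bar>log_partition M (\<lambda>t. Z t + V t) - log_partition M Z - gibbs_mean M Z V - gibbs_cov M Z V V / 2\<bar> \<le> 6 * v ^ 3"
proof -
  let ?Z = "\<lambda>s t. Z t + s * V t"
  have v: "0 \<le> v"
  proof -
    obtain t where "t \<in> space M" using not_empty by auto
    then show ?thesis using order.trans[OF abs_ge_zero V(2)] by simp
  qed
  have "\<bar>gibbs_mean M (?Z s) V - gibbs_mean M Z V - s * gibbs_cov M Z V V\<bar> \<le> 6 * v ^ 3" if "0 \<le> s" "s \<le> 1" for s
  proof -
    have "6 * (v * v\<^sup>2) * s \<le> 6 * (v * v\<^sup>2) * 1" using v that by (intro mult_left_mono) auto
    also have "\<dots> = 6 * v ^ 3" by (simp add: power2_eq_square power3_eq_cube)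
    finally show ?thesis using gibbs_mean_taylor[OF Z V V that] by linarith
  qed
  note bound = this
  have deriv: "((\<lambda>s. log_partition M (?Z s) - s * gibbs_mean M Z V - s\<^sup>2 / 2 * gibbs_cov M Z V V) has_real_derivative
      gibbs_mean M (?Z s) V - gibbs_mean M Z V - s * gibbs_cov M Z V V) (at s)" for s
    using DERIV_log_partition[OF Z V(1), of s] by (auto intro!: derivative_eq_intros)
  from mvt_bound_01[OF deriv bound, of 1] show ?thesis by simp
qed

text \<open>
  Convexity of the free energy along \<open>V\<close>, in the form of its tangent line: Jensen's
  inequality for the exponential.
\<close>

lemma log_partition_ge:
  assumes Z: "Z \<in> bfun M" and V: "V \<in> bfun M"
  shows "log_partition M Z + gibbs_mean M Z V \<le> log_partition M (\<lambda>t. Z t + V t)"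
proof -
  let ?c = "gibbs_mean M Z V" let ?I = "\<integral>t. exp (Z t) \<partial>M"
  have I: "0 < ?I" by (rule partition_pos[OF Z])
  have "exp ?c * ?I = (\<integral>t. exp ?c * ((1 - ?c) * exp (Z t) + V t * exp (Z t)) \<partial>M)"
  proof -
    have "(\<integral>t. V t * exp (Z t) \<partial>M) = ?c * ?I" using I by (simp add: gibbs_mean_def)
    then show ?thesis using Z V
      by (simp add: Bochner_Integration.integral_add bfun_integrable bfun_mult bfun_exp) (simp add: algebra_simps)
  qed
  also have "\<dots> \<le> (\<integral>t. exp (Z t + V t) \<partial>M)"
  proof (rule integral_mono)
    fix t
    have "exp ?c * (1 - ?c + V t) \<le> exp ?c * exp (V t - ?c)"
      using exp_ge_add_one_self[of "V t - ?c"] by (intro mult_left_mono) (linarith, simp)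
    also have "\<dots> = exp (V t)" by (simp flip: exp_add)
    finally have "exp ?c * (1 - ?c + V t) * exp (Z t) \<le> exp (V t) * exp (Z t)"
      by (rule mult_right_mono) auto
    then show "exp ?c * ((1 - ?c) * exp (Z t) + V t * exp (Z t)) \<le> exp (Z t + V t)"
      by (simp add: exp_add algebra_simps)
  qed (use Z V in \<open>auto intro!: bfun_integrable\<close>)
  finally have "ln (exp ?c * ?I) \<le> ln (\<integral>t. exp (Z t + V t) \<partial>M)"
    using I by (subst ln_le_cancel_iff) (auto intro!: partition_pos Z V)
  then show ?thesis unfolding log_partition_def using I by (simp add: ln_mult)
qed

text \<open>
  The same tangent inequality at the other end point.
\<close>

lemma log_partition_le:
  assumes Z: "Z \<in> bfun M" and V: "V \<in> bfun M"
  shows "log_partition M (\<lambda>t. Z t + V t) \<le> log_partition M Z + gibbs_mean M (\<lambda>t. Z t + V t) V"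
  using log_partition_ge[of "\<lambda>t. Z t + V t" "\<lambda>t. - V t"] gibbs_mean_cmult[of "\<lambda>t. Z t + V t" "-1" V] bfun_add[OF Z V] bfun_uminus[OF V]
  by simp

lemma log_partition_lipschitz:
  assumes Z: "Z \<in> bfun M" and V: "V \<in> bfun M" and c: "\<And>t. t \<in> space M \<Longrightarrow> \<bar>V t\<bar> \<le> c"
  shows "\<bar>log_partition M (\<lambda>t. Z t + V t) - log_partition M Z\<bar> \<le> c"
  using log_partition_ge[OF Z V] log_partition_le[OF Z V] gibbs_mean_bound[OF Z V c]
    gibbs_mean_bound[OF bfun_add[OF Z V] V c] by linarith

end

section \<open>One random block: second-order expansions\<close>

text \<open>
  The only properties of a block variable that the comparison uses. Both the recentred observations and
  the Gaussian blocks have them.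
\<close>

definition centered_law :: "real ^ 'd ^ 'd \<Rightarrow> real \<Rightarrow> real \<Rightarrow> (real ^ 'd) measure \<Rightarrow> bool" where
  "centered_law S \<delta> c Q \<longleftrightarrow> prob_space Q \<and> sets Q = sets borel \<and>
     (\<forall>i. (\<integral>\<zeta>. \<zeta> $ i \<partial>Q) = 0) \<and>
     (\<forall>i j. \<bar>(\<integral>\<zeta>. \<zeta> $ i * \<zeta> $ j \<partial>Q) - S $ i $ j\<bar> \<le> \<delta>) \<and>
     integrable Q (\<lambda>\<zeta>. norm \<zeta> ^ 3) \<and> (\<integral>\<zeta>. norm \<zeta> ^ 3 \<partial>Q) \<le> c"

lemma le_one_plus_cube: "x \<le> 1 + x ^ 3" "x\<^sup>2 \<le> 1 + x ^ 3" if "0 \<le> x" for x :: real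
proof -
  have "x ^ 1 \<le> 1 + x ^ 3 \<and> x ^ 2 \<le> 1 + x ^ 3"
  proof (cases "x \<le> 1")
    case True
    moreover have "0 \<le> x ^ 3" "x ^ 2 \<le> 1" using power_le_one[OF that True] that by auto
    ultimately show ?thesis using \<open>x \<le> 1\<close> by (auto intro: add_increasing2)
  next
    case False
    then have "x ^ 1 \<le> x ^ 3" "x ^ 2 \<le> x ^ 3" by (intro power_increasing, simp_all)+
    then show ?thesis by (metis add_increasing power_one_right zero_le_one)
  qed
  then show "x \<le> 1 + x ^ 3" "x\<^sup>2 \<le> 1 + x ^ 3" by simp_all
qed

lemma
  fixes Q :: "(real ^ 'd) measure"
  assumes "centered_law S \<delta> c Q"
  shows centered_law_integrable_norm: "integrable Q norm"
    and centered_law_integrable_comp: "integrable Q (\<lambda>\<zeta>. \<zeta> $ i)"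
    and centered_law_integrable_prod: "integrable Q (\<lambda>\<zeta>. \<zeta> $ i * \<zeta> $ j)"
    and centered_law_norm_le: "(\<integral>\<zeta>. norm \<zeta> \<partial>Q) \<le> 1 + c"
proof -
  interpret prob_space Q using assms by (simp add: centered_law_def)
  have [measurable_cong]: "sets Q = sets borel" and int3: "integrable Q (\<lambda>\<zeta>. norm \<zeta> ^ 3)"
    and c: "(\<integral>\<zeta>. norm \<zeta> ^ 3 \<partial>Q) \<le> c"
    using assms by (auto simp: centered_law_def)
  have dom: "integrable Q (\<lambda>\<zeta>. 1 + norm \<zeta> ^ 3)" using int3 by simp
  show n: "integrable Q norm"
    by (rule Bochner_Integration.integrable_bound[OF dom]) (auto simp: le_one_plus_cube)
  show "integrable Q (\<lambda>\<zeta>. \<zeta> $ i)"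
    by (rule Bochner_Integration.integrable_bound[OF n]) (auto simp: component_le_norm_cart)
  have "\<bar>\<zeta> $ i * \<zeta> $ j\<bar> \<le> 1 + norm \<zeta> ^ 3" for \<zeta> :: "real ^ 'd"
  proof -
    have "\<bar>\<zeta> $ i * \<zeta> $ j\<bar> \<le> norm \<zeta> * norm \<zeta>"
      unfolding abs_mult by (intro mult_mono component_le_norm_cart) auto
    then show ?thesis using le_one_plus_cube(2)[of "norm \<zeta>"] by (simp add: power2_eq_square)
  qed
  then show "integrable Q (\<lambda>\<zeta>. \<zeta> $ i * \<zeta> $ j)"
    by (intro Bochner_Integration.integrable_bound[OF dom]) auto
  have "(\<integral>\<zeta>. norm \<zeta> \<partial>Q) \<le> (\<integral>\<zeta>. 1 + norm \<zeta> ^ 3 \<partial>Q)"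
    by (rule integral_mono[OF n dom]) (simp add: le_one_plus_cube)
  also have "\<dots> = 1 + (\<integral>\<zeta>. norm \<zeta> ^ 3 \<partial>Q)" using int3 prob_space by simp
  finally show "(\<integral>\<zeta>. norm \<zeta> \<partial>Q) \<le> 1 + c" using c by linarith
qed

definition bounded_feature :: "'p measure \<Rightarrow> real \<Rightarrow> ('p \<Rightarrow> real ^ 'd) \<Rightarrow> bool" where
  "bounded_feature p \<rho> x \<longleftrightarrow> x \<in> borel_measurable p \<and> (\<forall>t\<in>space p. norm (x t) \<le> \<rho>)"

lemma inner_cart: "x \<bullet> y = (\<Sum>i\<in>UNIV. x $ i * y $ i)" for x y :: "real ^ 'd"
  by (simp add: inner_vec_def)

lemma bounded_feature_inner:
  fixes x :: "'p \<Rightarrow> real ^ 'd"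
  assumes "bounded_feature p \<rho> x"
  shows "(\<lambda>t. \<zeta> \<bullet> x t) \<in> bfun p" "t \<in> space p \<Longrightarrow> \<bar>\<zeta> \<bullet> x t\<bar> \<le> norm \<zeta> * \<rho>"
proof -
  have [measurable]: "x \<in> borel_measurable p" and b: "\<And>t. t \<in> space p \<Longrightarrow> norm (x t) \<le> \<rho>"
    using assms by (auto simp: bounded_feature_def)
  have *: "\<bar>\<zeta> \<bullet> x t\<bar> \<le> norm \<zeta> * \<rho>" if "t \<in> space p" for t
    using order.trans[OF Cauchy_Schwarz_ineq2[of \<zeta> "x t"] mult_left_mono[OF b[OF that] norm_ge_zero]] .
  show "(\<lambda>t. \<zeta> \<bullet> x t) \<in> bfun p" by (rule bfunI[OF _ *]) measurable
  show "t \<in> space p \<Longrightarrow> \<bar>\<zeta> \<bullet> x t\<bar> \<le> norm \<zeta> * \<rho>" by (rule *)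
qed

lemma bounded_feature_comp:
  fixes x :: "'p \<Rightarrow> real ^ 'd"
  assumes "bounded_feature p \<rho> x"
  shows "(\<lambda>t. x t $ i) \<in> bfun p" "t \<in> space p \<Longrightarrow> \<bar>x t $ i\<bar> \<le> \<rho>"
  using bounded_feature_inner[OF assms, where \<zeta>="axis i 1"] by (simp_all add: inner_axis' norm_axis_1)

lemma double_sum_abs_le:
  fixes A B :: "'d::finite \<Rightarrow> 'd \<Rightarrow> real"
  assumes "\<And>i j. \<bar>A i j\<bar> \<le> a" "\<And>i j. \<bar>B i j\<bar> \<le> b"
  shows "\<bar>\<Sum>i\<in>UNIV. \<Sum>j\<in>UNIV. A i j * B i j\<bar> \<le> (real CARD('d))\<^sup>2 * (a * b)"
proof -
  have "\<bar>A i j * B i j\<bar> \<le> a * b" for i j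
    unfolding abs_mult by (intro mult_mono assms order.trans[OF abs_ge_zero assms(1)]) simp
  then have "\<bar>\<Sum>i\<in>UNIV. \<Sum>j\<in>UNIV. A i j * B i j\<bar> \<le> (\<Sum>i\<in>(UNIV::'d set). \<Sum>j\<in>(UNIV::'d set). a * b)"
    by (intro order.trans[OF sum_abs] sum_mono) auto
  then show ?thesis by (simp add: power2_eq_square)
qed

lemma expected_quadratic_form:
  fixes Q :: "(real ^ 'd) measure" and T :: "'d \<Rightarrow> 'd \<Rightarrow> real"
  assumes Q: "centered_law S \<delta> c Q" and T: "\<And>i j. \<bar>T i j\<bar> \<le> \<tau>"
  shows "integrable Q (\<lambda>\<zeta>. \<Sum>i\<in>UNIV. \<Sum>j\<in>UNIV. \<zeta> $ i * \<zeta> $ j * T i j)"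
    and "\<bar>(\<integral>\<zeta>. (\<Sum>i\<in>UNIV. \<Sum>j\<in>UNIV. \<zeta> $ i * \<zeta> $ j * T i j) \<partial>Q)
       - (\<Sum>i\<in>UNIV. \<Sum>j\<in>UNIV. S $ i $ j * T i j)\<bar> \<le> (real CARD('d))\<^sup>2 * (\<delta> * \<tau>)"
proof -
  note int = centered_law_integrable_prod[OF Q]
  show "integrable Q (\<lambda>\<zeta>. \<Sum>i\<in>UNIV. \<Sum>j\<in>UNIV. \<zeta> $ i * \<zeta> $ j * T i j)"
    by (intro Bochner_Integration.integrable_sum integrable_mult_left int)
  have "(\<integral>\<zeta>. (\<Sum>i\<in>UNIV. \<Sum>j\<in>UNIV. \<zeta> $ i * \<zeta> $ j * T i j) \<partial>Q)
      = (\<Sum>i\<in>UNIV. \<Sum>j\<in>UNIV. (\<integral>\<zeta>. \<zeta> $ i * \<zeta> $ j \<partial>Q) * T i j)"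
    by (simp add: Bochner_Integration.integral_sum Bochner_Integration.integrable_sum int)
  then have "(\<integral>\<zeta>. (\<Sum>i\<in>UNIV. \<Sum>j\<in>UNIV. \<zeta> $ i * \<zeta> $ j * T i j) \<partial>Q)
       - (\<Sum>i\<in>UNIV. \<Sum>j\<in>UNIV. S $ i $ j * T i j)
      = (\<Sum>i\<in>UNIV. \<Sum>j\<in>UNIV. ((\<integral>\<zeta>. \<zeta> $ i * \<zeta> $ j \<partial>Q) - S $ i $ j) * T i j)"
    by (simp add: left_diff_distrib sum_subtractf)
  then show "\<bar>(\<integral>\<zeta>. (\<Sum>i\<in>UNIV. \<Sum>j\<in>UNIV. \<zeta> $ i * \<zeta> $ j * T i j) \<partial>Q)
       - (\<Sum>i\<in>UNIV. \<Sum>j\<in>UNIV. S $ i $ j * T i j)\<bar> \<le> (real CARD('d))\<^sup>2 * (\<delta> * \<tau>)"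
    using Q T by (simp only:) (rule double_sum_abs_le, auto simp: centered_law_def)
qed

lemma integral_remainder_bound:
  fixes F G :: "'b \<Rightarrow> real"
  assumes "integrable Q G" "integrable Q h" "F \<in> borel_measurable Q"
    and le: "\<And>x. \<bar>F x - G x\<bar> \<le> h x"
  shows "integrable Q F" "\<bar>(\<integral>x. F x \<partial>Q) - (\<integral>x. G x \<partial>Q)\<bar> \<le> (\<integral>x. h x \<partial>Q)"
proof -
  have "h x \<ge> 0" for x using order.trans[OF abs_ge_zero le] .
  then have d: "integrable Q (\<lambda>x. F x - G x)"
    using assms by (intro Bochner_Integration.integrable_bound[OF assms(2)]) auto
  from Bochner_Integration.integrable_add[OF this assms(1)] show F: "integrable Q F" by simp
  have "\<bar>\<integral>x. F x - G x \<partial>Q\<bar> \<le> (\<integral>x. \<bar>F x - G x\<bar> \<partial>Q)" by simp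
  also have "\<dots> \<le> (\<integral>x. h x \<partial>Q)" by (rule integral_mono) (use d assms in auto)
  finally show "\<bar>(\<integral>x. F x \<partial>Q) - (\<integral>x. G x \<partial>Q)\<bar> \<le> (\<integral>x. h x \<partial>Q)" using F assms by simp
qed

context prob_space begin

lemma gibbs_mean_inner:
  fixes x :: "'a \<Rightarrow> real ^ 'd"
  assumes "U \<in> bfun M" "bounded_feature M \<rho> x"
  shows "gibbs_mean M U (\<lambda>t. \<zeta> \<bullet> x t) = (\<Sum>i\<in>UNIV. \<zeta> $ i * gibbs_mean M U (\<lambda>t. x t $ i))"
  unfolding inner_cart using assms bounded_feature_comp[OF assms(2)]
  by (subst gibbs_mean_sum) (auto simp: gibbs_mean_cmult)

lemma gibbs_cov_inner:
  fixes x y :: "'a \<Rightarrow> real ^ 'd"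
  assumes "U \<in> bfun M" "bounded_feature M \<rho> x" "bounded_feature M \<rho>' y"
  shows "gibbs_cov M U (\<lambda>t. \<zeta> \<bullet> y t) (\<lambda>t. \<zeta> \<bullet> x t)
    = (\<Sum>i\<in>UNIV. \<Sum>j\<in>UNIV. \<zeta> $ i * \<zeta> $ j * gibbs_cov M U (\<lambda>t. y t $ i) (\<lambda>t. x t $ j))"
proof -
  have "gibbs_cov M U (\<lambda>t. \<zeta> \<bullet> y t) (\<lambda>t. \<zeta> \<bullet> x t)
     = (\<Sum>i\<in>UNIV. gibbs_cov M U (\<lambda>t. \<zeta> $ i * y t $ i) (\<lambda>t. \<zeta> \<bullet> x t))"
    unfolding inner_cart[of _ "y _"] using assms bounded_feature_comp[OF assms(3)] bounded_feature_inner[OF assms(2)]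
    by (intro gibbs_cov_sum_left) auto
  also have "\<dots> = (\<Sum>i\<in>UNIV. \<Sum>j\<in>UNIV. gibbs_cov M U (\<lambda>t. \<zeta> $ i * y t $ i) (\<lambda>t. \<zeta> $ j * x t $ j))"
    unfolding inner_cart[of _ "x _"] using assms bounded_feature_comp[OF assms(2)] bounded_feature_comp[OF assms(3)]
    by (intro sum.cong refl gibbs_cov_sum_right) auto
  finally show ?thesis by (simp add: gibbs_cov_cmult_left gibbs_cov_cmult_right mult.assoc)
qed

lemma borel_measurable_log_partition:
  assumes "sets Q = sets borel" "U \<in> bfun M" "x \<in> borel_measurable M"
  shows "(\<lambda>\<zeta>::real ^ 'd. log_partition M (\<lambda>t. U t + \<zeta> \<bullet> x t)) \<in> borel_measurable Q"
proof -
  note [measurable_cong] = assms(1) and [measurable] = assms(3) bfun_measurable[OF assms(2)]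
  show ?thesis unfolding log_partition_def by measurable
qed

lemma borel_measurable_gibbs_mean:
  assumes "sets Q = sets borel" "U \<in> bfun M" "x \<in> borel_measurable M"
    and f: "case_prod f \<in> borel_measurable (Q \<Otimes>\<^sub>M M)"
  shows "(\<lambda>\<zeta>::real ^ 'd. gibbs_mean M (\<lambda>t. U t + \<zeta> \<bullet> x t) (f \<zeta>)) \<in> borel_measurable Q"
proof -
  note [measurable_cong] = assms(1) and [measurable] = assms(3) bfun_measurable[OF assms(2)] f
  show ?thesis unfolding gibbs_mean_def by measurable
qed

lemma borel_measurable_gibbs_cov:
  assumes "sets Q = sets borel" "U \<in> bfun M" "x \<in> borel_measurable M"
    and f: "f \<in> bfun M" "g \<in> bfun M"
  shows "(\<lambda>\<zeta>::real ^ 'd. gibbs_cov M (\<lambda>t. U t + \<zeta> \<bullet> x t) f g) \<in> borel_measurable Q"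
proof -
  note [measurable] = f[THEN bfun_measurable]
  show ?thesis unfolding gibbs_cov_def
    by (intro borel_measurable_diff borel_measurable_times borel_measurable_gibbs_mean assms) measurable
qed

text \<open>
  Up to third order the expected free energy sees only the mean and the covariance of the block, so two
  laws with nearly equal covariances give nearly equal values.
\<close>

lemma expected_log_partition_block:
  fixes Q :: "(real ^ 'd) measure"
  assumes Q: "centered_law S \<delta> c Q" and U: "U \<in> bfun M" and x: "bounded_feature M \<rho> x" and \<rho>: "0 \<le> \<rho>"
  shows "\<bar>(\<integral>\<zeta>. log_partition M (\<lambda>t. U t + \<zeta> \<bullet> x t) \<partial>Q)
      - (log_partition M U + (\<Sum>i\<in>UNIV. \<Sum>j\<in>UNIV. S $ i $ j * gibbs_cov M U (\<lambda>t. x t $ i) (\<lambda>t. x t $ j)) / 2)\<bar>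
    \<le> 6 * \<rho> ^ 3 * c + (real CARD('d))\<^sup>2 * \<delta> * \<rho>\<^sup>2"
proof -
  interpret Q: prob_space Q using Q by (simp add: centered_law_def)
  have sQ: "sets Q = sets borel" using Q by (simp add: centered_law_def)
  have xm: "x \<in> borel_measurable M" using x by (simp add: bounded_feature_def)
  define T where "T i j = gibbs_cov M U (\<lambda>t. x t $ i) (\<lambda>t. x t $ j)" for i j
  define m where "m i = gibbs_mean M U (\<lambda>t. x t $ i)" for i
  define G where "G \<zeta> = log_partition M U + (\<Sum>i\<in>UNIV. \<zeta> $ i * m i)
      + (\<Sum>i\<in>UNIV. \<Sum>j\<in>UNIV. \<zeta> $ i * \<zeta> $ j * T i j) / 2" for \<zeta> :: "real ^ 'd"
  have T: "\<bar>T i j\<bar> \<le> 2 * \<rho>\<^sup>2" for i j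
    unfolding T_def using gibbs_cov_bound[OF U bounded_feature_comp[OF x] bounded_feature_comp[OF x]]
    by (simp add: power2_eq_square)
  have int3: "integrable Q (\<lambda>\<zeta>. norm \<zeta> ^ 3)" and c: "(\<integral>\<zeta>. norm \<zeta> ^ 3 \<partial>Q) \<le> c"
    and mean: "\<And>i. (\<integral>\<zeta>. \<zeta> $ i \<partial>Q) = 0" using Q by (auto simp: centered_law_def)
  note q = expected_quadratic_form[OF Q, where T = T and \<tau> = "2 * \<rho>\<^sup>2", OF T]
  have lin: "integrable Q (\<lambda>\<zeta>. \<Sum>i\<in>UNIV. \<zeta> $ i * m i)" "(\<integral>\<zeta>. (\<Sum>i\<in>UNIV. \<zeta> $ i * m i) \<partial>Q) = 0"
    using centered_law_integrable_comp[OF Q] mean by (auto simp: Bochner_Integration.integral_sum)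
  have G: "integrable Q G" unfolding G_def using lin q by auto
  have G_int: "(\<integral>\<zeta>. G \<zeta> \<partial>Q) = log_partition M U + (\<integral>\<zeta>. (\<Sum>i\<in>UNIV. \<Sum>j\<in>UNIV. \<zeta> $ i * \<zeta> $ j * T i j) \<partial>Q) / 2"
    unfolding G_def using lin q(1) Q.prob_space by simp
  have rem: "\<bar>log_partition M (\<lambda>t. U t + \<zeta> \<bullet> x t) - G \<zeta>\<bar> \<le> 6 * \<rho> ^ 3 * norm \<zeta> ^ 3" for \<zeta>
    using log_partition_taylor[OF U bounded_feature_inner[OF x, where \<zeta>=\<zeta>]]
    unfolding gibbs_mean_inner[OF U x] gibbs_cov_inner[OF U x x] G_def T_def m_def
    by (simp add: power_mult_distrib mult_ac diff_diff_add)
  have "\<bar>(\<integral>\<zeta>. log_partition M (\<lambda>t. U t + \<zeta> \<bullet> x t) \<partial>Q) - (\<integral>\<zeta>. G \<zeta> \<partial>Q)\<bar> \<le> (\<integral>\<zeta>. 6 * \<rho> ^ 3 * norm \<zeta> ^ 3 \<partial>Q)"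
    by (rule integral_remainder_bound[OF G _ borel_measurable_log_partition[OF sQ U xm] rem]) (use int3 in auto)
  also have "\<dots> \<le> 6 * \<rho> ^ 3 * c" using c \<rho> by (simp add: mult_left_mono)
  finally have "\<bar>(\<integral>\<zeta>. log_partition M (\<lambda>t. U t + \<zeta> \<bullet> x t) \<partial>Q) - (\<integral>\<zeta>. G \<zeta> \<partial>Q)\<bar> \<le> 6 * \<rho> ^ 3 * c" .
  moreover have "(real CARD('d))\<^sup>2 * (\<delta> * (2 * \<rho>\<^sup>2)) = 2 * ((real CARD('d))\<^sup>2 * \<delta> * \<rho>\<^sup>2)" by simp
  ultimately show ?thesis using q(2) unfolding G_int T_def[symmetric] by linarith
qed

text \<open>
  Approximate integration by parts in one block. To first order in the field the Gibbs mean of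
  \<open>\<zeta> \<bullet> y\<close> has expectation zero, and the second-order term is a quadratic form in \<open>\<zeta>\<close>
  whose expectation replaces \<open>\<zeta> \<zeta>\<^sup>T\<close> by \<open>S\<close>. The covariances on the right are then moved back from the
  field \<open>U\<close> to the full field at third-order cost. For Gaussian \<open>\<zeta>\<close> with covariance \<open>S\<close> the identity would be exact.
\<close>

lemma expected_gibbs_mean_block:
  fixes Q :: "(real ^ 'd) measure"
  assumes Q: "centered_law S \<delta> c Q" and U: "U \<in> bfun M" and x: "bounded_feature M \<rho> x"
    and y: "bounded_feature M \<rho> y" and \<rho>: "0 \<le> \<rho>" and S: "\<And>i j. \<bar>S $ i $ j\<bar> \<le> \<sigma>"
  shows "\<bar>(\<integral>\<zeta>. gibbs_mean M (\<lambda>t. U t + \<zeta> \<bullet> x t) (\<lambda>t. \<zeta> \<bullet> y t) \<partial>Q)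
      - (\<integral>\<zeta>. (\<Sum>i\<in>UNIV. \<Sum>j\<in>UNIV. S $ i $ j *
           gibbs_cov M (\<lambda>t. U t + \<zeta> \<bullet> x t) (\<lambda>t. y t $ i) (\<lambda>t. x t $ j)) \<partial>Q)\<bar>
    \<le> 6 * \<rho> ^ 3 * c + 2 * (real CARD('d))\<^sup>2 * \<delta> * \<rho>\<^sup>2 + 6 * (real CARD('d))\<^sup>2 * \<sigma> * \<rho> ^ 3 * (1 + c)"
proof -
  interpret Q: prob_space Q using Q by (simp add: centered_law_def)
  have sQ: "sets Q = sets borel" using Q by (simp add: centered_law_def)
  have xm: "x \<in> borel_measurable M" and ym: "y \<in> borel_measurable M" using x y by (auto simp: bounded_feature_def)
  note [measurable] = xm ym and [measurable_cong] = sQ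
  define T where "T i j = gibbs_cov M U (\<lambda>t. y t $ i) (\<lambda>t. x t $ j)" for i j
  define m where "m i = gibbs_mean M U (\<lambda>t. y t $ i)" for i
  define G where "G \<zeta> = (\<Sum>i\<in>UNIV. \<zeta> $ i * m i)
      + (\<Sum>i\<in>UNIV. \<Sum>j\<in>UNIV. \<zeta> $ i * \<zeta> $ j * T i j)" for \<zeta> :: "real ^ 'd"
  define ST where "ST = (\<Sum>i\<in>UNIV. \<Sum>j\<in>UNIV. S $ i $ j * T i j)"
  have T: "\<bar>T i j\<bar> \<le> 2 * \<rho>\<^sup>2" for i j
    unfolding T_def using gibbs_cov_bound[OF U bounded_feature_comp[OF y] bounded_feature_comp[OF x]]
    by (simp add: power2_eq_square)
  have int3: "integrable Q (\<lambda>\<zeta>. norm \<zeta> ^ 3)" and c: "(\<integral>\<zeta>. norm \<zeta> ^ 3 \<partial>Q) \<le> c"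
    and mean: "\<And>i. (\<integral>\<zeta>. \<zeta> $ i \<partial>Q) = 0" using Q by (auto simp: centered_law_def)
  note q = expected_quadratic_form[OF Q, where T = T and \<tau> = "2 * \<rho>\<^sup>2", OF T]
  have lin: "integrable Q (\<lambda>\<zeta>. \<Sum>i\<in>UNIV. \<zeta> $ i * m i)" "(\<integral>\<zeta>. (\<Sum>i\<in>UNIV. \<zeta> $ i * m i) \<partial>Q) = 0"
    using centered_law_integrable_comp[OF Q] mean by (auto simp: Bochner_Integration.integral_sum)
  have G: "integrable Q G" unfolding G_def using lin q by auto
  have G_int: "(\<integral>\<zeta>. G \<zeta> \<partial>Q) = (\<integral>\<zeta>. (\<Sum>i\<in>UNIV. \<Sum>j\<in>UNIV. \<zeta> $ i * \<zeta> $ j * T i j) \<partial>Q)"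
    unfolding G_def using lin q(1) by simp
  have rem: "\<bar>gibbs_mean M (\<lambda>t. U t + \<zeta> \<bullet> x t) (\<lambda>t. \<zeta> \<bullet> y t) - G \<zeta>\<bar> \<le> 6 * \<rho> ^ 3 * norm \<zeta> ^ 3" for \<zeta>
    using gibbs_mean_taylor[OF U bounded_feature_inner[OF x, where \<zeta>=\<zeta>] bounded_feature_inner[OF y, where \<zeta>=\<zeta>], of 1]
    unfolding gibbs_mean_inner[OF U y] gibbs_cov_inner[OF U x y] G_def T_def m_def
    by (simp add: power_mult_distrib power2_eq_square power3_eq_cube mult_ac diff_diff_add)
  have "\<bar>(\<integral>\<zeta>. gibbs_mean M (\<lambda>t. U t + \<zeta> \<bullet> x t) (\<lambda>t. \<zeta> \<bullet> y t) \<partial>Q) - (\<integral>\<zeta>. G \<zeta> \<partial>Q)\<bar> \<le> (\<integral>\<zeta>. 6 * \<rho> ^ 3 * norm \<zeta> ^ 3 \<partial>Q)"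
    by (rule integral_remainder_bound[OF G _ borel_measurable_gibbs_mean[OF sQ U xm] rem]) (use int3 in \<open>auto, measurable\<close>)
  also have "\<dots> \<le> 6 * \<rho> ^ 3 * c" using c \<rho> by (simp add: mult_left_mono)
  finally have 1: "\<bar>(\<integral>\<zeta>. gibbs_mean M (\<lambda>t. U t + \<zeta> \<bullet> x t) (\<lambda>t. \<zeta> \<bullet> y t) \<partial>Q) - (\<integral>\<zeta>. G \<zeta> \<partial>Q)\<bar> \<le> 6 * \<rho> ^ 3 * c" .
  have 2: "\<bar>(\<integral>\<zeta>. G \<zeta> \<partial>Q) - ST\<bar> \<le> 2 * (real CARD('d))\<^sup>2 * \<delta> * \<rho>\<^sup>2"
    using q(2) unfolding G_int ST_def by (simp only: mult_ac)
  let ?C = "\<lambda>\<zeta>. \<Sum>i\<in>UNIV. \<Sum>j\<in>UNIV. S $ i $ j *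
           gibbs_cov M (\<lambda>t. U t + \<zeta> \<bullet> x t) (\<lambda>t. y t $ i) (\<lambda>t. x t $ j)"
  have C_le: "\<bar>?C \<zeta> - ST\<bar> \<le> 6 * (real CARD('d))\<^sup>2 * \<sigma> * \<rho> ^ 3 * norm \<zeta>" for \<zeta>
  proof -
    have "\<bar>gibbs_cov M (\<lambda>t. U t + \<zeta> \<bullet> x t) (\<lambda>t. y t $ i) (\<lambda>t. x t $ j) - T i j\<bar> \<le> 6 * \<rho> ^ 3 * norm \<zeta>" for i j
      using gibbs_cov_lipschitz[OF U bounded_feature_inner[OF x, where \<zeta>=\<zeta>] bounded_feature_comp[OF y] bounded_feature_comp[OF x], of 1]
      unfolding T_def by (simp add: power3_eq_cube mult_ac)
    from double_sum_abs_le[OF S this]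
    have "\<bar>\<Sum>i\<in>UNIV. \<Sum>j\<in>UNIV. S $ i $ j * (gibbs_cov M (\<lambda>t. U t + \<zeta> \<bullet> x t) (\<lambda>t. y t $ i) (\<lambda>t. x t $ j) - T i j)\<bar>
       \<le> (real CARD('d))\<^sup>2 * (\<sigma> * (6 * \<rho> ^ 3 * norm \<zeta>))" .
    then show ?thesis unfolding ST_def by (simp add: right_diff_distrib sum_subtractf mult_ac)
  qed
  have "\<bar>(\<integral>\<zeta>. ?C \<zeta> \<partial>Q) - (\<integral>\<zeta>. ST \<partial>Q)\<bar> \<le> (\<integral>\<zeta>. 6 * (real CARD('d))\<^sup>2 * \<sigma> * \<rho> ^ 3 * norm \<zeta> \<partial>Q)"
    by (rule integral_remainder_bound[OF _ _ _ C_le])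
       (use centered_law_integrable_norm[OF Q] bounded_feature_comp[OF x] bounded_feature_comp[OF y]
        in \<open>auto intro!: borel_measurable_sum borel_measurable_times borel_measurable_gibbs_cov sQ U xm\<close>)
  also have "\<dots> \<le> 6 * (real CARD('d))\<^sup>2 * \<sigma> * \<rho> ^ 3 * (1 + c)"
    using centered_law_norm_le[OF Q] \<rho> order.trans[OF abs_ge_zero S] by (simp add: mult_left_mono)
  finally have 3: "\<bar>(\<integral>\<zeta>. ?C \<zeta> \<partial>Q) - ST\<bar> \<le> 6 * (real CARD('d))\<^sup>2 * \<sigma> * \<rho> ^ 3 * (1 + c)"
    using Q.prob_space by simp
  have "\<bar>A - C\<bar> \<le> a + b + d" if "\<bar>A - B\<bar> \<le> a" "\<bar>B - E\<bar> \<le> b" "\<bar>C - E\<bar> \<le> d" for A B C E a b d :: real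
    using that by linarith
  from this[OF 1 2 3] show ?thesis .
qed

end

section \<open>Independent blocks: Lindeberg replacement and integration by parts\<close>

lemma distr_prod_component:
  assumes "\<And>m::nat. prob_space (Q m)" "m < k"
  shows "distr (\<Pi>\<^sub>M m\<in>{..<k}. Q m) (Q m) (\<lambda>w. w m) = Q m"
  by (rule distr_PiM_component) (use assms in auto)

lemma integrable_prod_component:
  fixes f :: "'b \<Rightarrow> real"
  assumes Q: "\<And>m::nat. prob_space (Q m)" and m: "m < k" and f: "integrable (Q m) f"
  shows "integrable (\<Pi>\<^sub>M m\<in>{..<k}. Q m) (\<lambda>w. f (w m))"
proof -
  have "integrable (distr (\<Pi>\<^sub>M m\<in>{..<k}. Q m) (Q m) (\<lambda>w. w m)) f"
    using f by (subst distr_prod_component[of Q, OF Q m])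
  then show ?thesis
    by (subst (asm) integrable_distr_eq) (use m f in auto)
qed

text \<open>
  Fubini for one coordinate of a finite product.
\<close>

lemma integral_prod_split:
  fixes F :: "(nat \<Rightarrow> 'b) \<Rightarrow> real"
  assumes Q: "\<And>m::nat. prob_space (Q m)" and m: "m < k" and F: "integrable (\<Pi>\<^sub>M m\<in>{..<k}. Q m) F"
  shows "(\<integral>w. F w \<partial>(\<Pi>\<^sub>M m\<in>{..<k}. Q m)) = (\<integral>w. (\<integral>\<zeta>. F (w(m := \<zeta>)) \<partial>Q m) \<partial>(\<Pi>\<^sub>M l\<in>({..<k} - {m}). Q l))"
    and "integrable (\<Pi>\<^sub>M l\<in>({..<k} - {m}). Q l) (\<lambda>w. \<integral>\<zeta>. F (w(m := \<zeta>)) \<partial>Q m)"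
proof -
  interpret product_sigma_finite Q
    using Q by (simp add: product_sigma_finite_def prob_space_imp_sigma_finite)
  have eq: "insert m ({..<k} - {m}) = {..<k}" using m by auto
  show "(\<integral>w. F w \<partial>(\<Pi>\<^sub>M m\<in>{..<k}. Q m)) = (\<integral>w. (\<integral>\<zeta>. F (w(m := \<zeta>)) \<partial>Q m) \<partial>(\<Pi>\<^sub>M l\<in>({..<k} - {m}). Q l))"
    using product_integral_insert[of "{..<k} - {m}" m F, unfolded eq] F by simp
  let ?J = "{..<k} - {m}"
  interpret P: pair_sigma_finite "Q m" "PiM ?J Q"
    unfolding pair_sigma_finite_def
    using Q by (auto intro!: prob_space_imp_sigma_finite prob_space_PiM)
  let ?f = "\<lambda>(\<zeta>, w). w(m := \<zeta>)"
  have f: "?f \<in> measurable (Q m \<Otimes>\<^sub>M PiM ?J Q) (PiM {..<k} Q)"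
    using measurable_compose[OF measurable_pair_swap' measurable_add_dim[of m ?J Q, unfolded eq]]
    by (simp add: case_prod_beta')
  have "distr (Q m \<Otimes>\<^sub>M PiM ?J Q) (PiM {..<k} Q) ?f = PiM {..<k} Q"
    using distr_pair_PiM_eq_PiM[of ?J Q m, unfolded eq] Q by simp
  then have "integrable (distr (Q m \<Otimes>\<^sub>M PiM ?J Q) (PiM {..<k} Q) ?f) F"
    using F by simp
  then have "integrable (Q m \<Otimes>\<^sub>M PiM ?J Q) (\<lambda>(\<zeta>, w). F (w(m := \<zeta>)))"
    by (subst (asm) integrable_distr_eq[OF f]) (use F in \<open>auto simp: case_prod_beta'\<close>)
  from P.integrable_snd[OF this] show "integrable (PiM ?J Q) (\<lambda>w. \<integral>\<zeta>. F (w(m := \<zeta>)) \<partial>Q m)" .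
qed

text \<open>
  Reduces a comparison under two product laws that differ in at most one factor to that factor. With
  equal laws it serves integration by parts, with different laws one Lindeberg step.
\<close>

lemma integral_prod_diff_le:
  fixes F G :: "(nat \<Rightarrow> 'b) \<Rightarrow> real"
  assumes Q: "\<And>m::nat. prob_space (Q m)" and R: "\<And>m::nat. prob_space (R m)" and m: "m < k"
    and QR: "\<And>l. l \<noteq> m \<Longrightarrow> Q l = R l"
    and F: "integrable (\<Pi>\<^sub>M m\<in>{..<k}. Q m) F" and G: "integrable (\<Pi>\<^sub>M m\<in>{..<k}. R m) G"
    and le: "\<And>w. w \<in> space (\<Pi>\<^sub>M l\<in>({..<k} - {m}). Q l) \<Longrightarrow>
      \<bar>(\<integral>\<zeta>. F (w(m := \<zeta>)) \<partial>Q m) - (\<integral>\<zeta>. G (w(m := \<zeta>)) \<partial>R m)\<bar> \<le> e"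
  shows "\<bar>(\<integral>w. F w \<partial>(\<Pi>\<^sub>M m\<in>{..<k}. Q m)) - (\<integral>w. G w \<partial>(\<Pi>\<^sub>M m\<in>{..<k}. R m))\<bar> \<le> e"
proof -
  let ?P = "\<Pi>\<^sub>M l\<in>({..<k} - {m}). Q l"
  have P: "(\<Pi>\<^sub>M l\<in>({..<k} - {m}). R l) = ?P" using QR by (intro PiM_cong) auto
  interpret P: prob_space ?P by (rule prob_space_PiM) (use Q in auto)
  note fs = integral_prod_split[OF Q m F] and gs = integral_prod_split[OF R m G, unfolded P]
  have "\<bar>(\<integral>w. (\<integral>\<zeta>. F (w(m := \<zeta>)) \<partial>Q m) \<partial>?P) - (\<integral>w. (\<integral>\<zeta>. G (w(m := \<zeta>)) \<partial>R m) \<partial>?P)\<bar>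
    = \<bar>\<integral>w. (\<integral>\<zeta>. F (w(m := \<zeta>)) \<partial>Q m) - (\<integral>\<zeta>. G (w(m := \<zeta>)) \<partial>R m) \<partial>?P\<bar>"
    using fs(2) gs(2) by simp
  also have "\<dots> \<le> (\<integral>w. \<bar>(\<integral>\<zeta>. F (w(m := \<zeta>)) \<partial>Q m) - (\<integral>\<zeta>. G (w(m := \<zeta>)) \<partial>R m)\<bar> \<partial>?P)" by simp
  also have "\<dots> \<le> (\<integral>w. e \<partial>?P)"
    by (rule integral_mono) (use fs(2) gs(2) le in auto)
  also have "\<dots> = e" by (simp add: P.prob_space)
  finally show ?thesis using fs(1) gs(1) by simp
qed

lemma integral_add_sum:
  fixes e :: "'b \<Rightarrow> real"
  assumes "integrable P e" "\<And>m. m < k \<Longrightarrow> integrable P (f m)"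
  shows "(\<integral>\<xi>. e \<xi> + (\<Sum>m<k. f m \<xi>) \<partial>P) = (\<integral>\<xi>. e \<xi> \<partial>P) + (\<Sum>m<(k::nat). \<integral>\<xi>. f m \<xi> \<partial>P)"
proof -
  have "integrable P (\<lambda>\<xi>. \<Sum>m<k. f m \<xi>)" by (rule Bochner_Integration.integrable_sum) (use assms in auto)
  moreover have "(\<integral>\<xi>. (\<Sum>m<k. f m \<xi>) \<partial>P) = (\<Sum>m<k. \<integral>\<xi>. f m \<xi> \<partial>P)"
    by (rule Bochner_Integration.integral_sum) (use assms in auto)
  ultimately show ?thesis using assms(1) by simp
qed

text \<open>
  The common form of the log-likelihood and of the perturbed Gaussian process: linear in the blocks
  \<open>\<xi> m\<close>, plus a deterministic drift.
\<close>

definition linear_field :: "nat \<Rightarrow> (nat \<Rightarrow> 'p \<Rightarrow> real ^ 'd) \<Rightarrow> ('p \<Rightarrow> real) \<Rightarrow> (nat \<Rightarrow> real ^ 'd) \<Rightarrow> 'p \<Rightarrow> real" where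
  "linear_field k x D \<xi> t = (\<Sum>m<k. \<xi> m \<bullet> x m t) + D t"

lemma linear_field_split:
  assumes "m < k"
  shows "linear_field k x D (\<xi>(m := \<zeta>)) t = linear_field k (\<lambda>l. if l = m then (\<lambda>t. 0) else x l) D \<xi> t + \<zeta> \<bullet> x m t"
proof -
  have "(\<Sum>l<k. (\<xi>(m := \<zeta>)) l \<bullet> x l t) = \<zeta> \<bullet> x m t + (\<Sum>l\<in>{..<k} - {m}. \<xi> l \<bullet> x l t)"
    using assms by (subst sum.remove[of _ m]) auto
  moreover have "(\<Sum>l<k. \<xi> l \<bullet> (if l = m then (\<lambda>t. 0) else x l) t) = (\<Sum>l\<in>{..<k} - {m}. \<xi> l \<bullet> x l t)"
    using assms by (subst sum.remove[of _ m]) auto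
  ultimately show ?thesis unfolding linear_field_def by simp
qed

lemma linear_field_bfun:
  assumes "\<And>m. m < k \<Longrightarrow> bounded_feature p \<rho> (x m)" "D \<in> bfun p"
  shows "linear_field k x D \<xi> \<in> bfun p"
  unfolding linear_field_def[abs_def] using assms bounded_feature_inner(1)[OF assms(1)] by auto

lemma integrable_linear_field_functional:
  fixes Q :: "nat \<Rightarrow> (real ^ 'd) measure"
  assumes Q: "\<And>m. centered_law S \<delta> c (Q m)" 
    and F: "F \<in> borel_measurable (\<Pi>\<^sub>M m\<in>{..<k}. borel)"
    and le: "\<And>\<xi>. \<bar>F \<xi>\<bar> \<le> a * (\<Sum>m<k. norm (\<xi> m)) + b"
  shows "integrable (\<Pi>\<^sub>M m\<in>{..<k}. Q m) F"
proof -
  have P: "prob_space (Q m)" and sQ: "sets (Q m) = sets borel" for m using Q by (auto simp: centered_law_def)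
  interpret Pi: prob_space "\<Pi>\<^sub>M m\<in>{..<k}. Q m" by (rule prob_space_PiM) (use P in auto)
  have [measurable]: "F \<in> borel_measurable (\<Pi>\<^sub>M m\<in>{..<k}. Q m)"
    using F by (subst measurable_cong_sets[OF sets_PiM_cong[OF refl] refl]) (use sQ in \<open>auto\<close>)
  have "integrable (\<Pi>\<^sub>M m\<in>{..<k}. Q m) (\<lambda>\<xi>. norm (\<xi> m))" if "m < k" for m
    using integrable_prod_component[of Q m k norm] P that centered_law_integrable_norm[OF Q, of m] by simp
  then have "integrable (\<Pi>\<^sub>M m\<in>{..<k}. Q m) (\<lambda>\<xi>. a * (\<Sum>m<k. norm (\<xi> m)) + b)"
    by (intro Bochner_Integration.integrable_add integrable_mult_right Bochner_Integration.integrable_sum) auto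
  then show ?thesis
    by (rule Bochner_Integration.integrable_bound) (use le in \<open>auto intro: order.trans[OF le abs_ge_self]\<close>)
qed

context prob_space begin

lemma log_partition_abs_le:
  assumes "Z \<in> bfun M" "\<And>t. t \<in> space M \<Longrightarrow> \<bar>Z t\<bar> \<le> c"
  shows "\<bar>log_partition M Z\<bar> \<le> c"
  using log_partition_lipschitz[OF bfun_const[of 0] assms] by (simp add: log_partition_def prob_space)

lemma linear_field_abs_le:
  assumes x: "\<And>m. m < k \<Longrightarrow> bounded_feature M \<rho> (x m)" and D: "\<And>t. t \<in> space M \<Longrightarrow> \<bar>D t\<bar> \<le> b"
    and t: "t \<in> space M"
  shows "\<bar>linear_field k x D \<xi> t\<bar> \<le> \<rho> * (\<Sum>m<k. norm (\<xi> m)) + b"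
proof -
  have "\<bar>\<Sum>m<k. \<xi> m \<bullet> x m t\<bar> \<le> (\<Sum>m<k. norm (\<xi> m) * \<rho>)"
    by (rule order.trans[OF sum_abs]) (use bounded_feature_inner(2)[OF x t] in \<open>auto intro: sum_mono\<close>)
  then show ?thesis unfolding linear_field_def using D[OF t]
    by (simp add: sum_distrib_left mult.commute)
qed

lemma linear_field_measurable:
  fixes x :: "nat \<Rightarrow> 'a \<Rightarrow> real ^ 'd"
  assumes x: "\<And>m. m < k \<Longrightarrow> x m \<in> borel_measurable M" and D: "D \<in> borel_measurable M"
  shows "(\<lambda>(\<xi>, t). linear_field k x D \<xi> t) \<in> borel_measurable ((\<Pi>\<^sub>M m\<in>{..<k}. borel) \<Otimes>\<^sub>M M)"
proof -
  have "(\<lambda>z. x m (snd z)) \<in> borel_measurable ((\<Pi>\<^sub>M m\<in>{..<k}. borel) \<Otimes>\<^sub>M M)" if "m < k" for m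
    using measurable_compose[OF measurable_snd x[OF that]] .
  moreover have "(\<lambda>z. fst z m) \<in> borel_measurable ((\<Pi>\<^sub>M m\<in>{..<k}. (borel :: (real ^ 'd) measure)) \<Otimes>\<^sub>M M)" if "m < k" for m
    using that by (intro measurable_compose[OF measurable_fst measurable_component_singleton]) auto
  moreover have "(\<lambda>z. D (snd z)) \<in> borel_measurable ((\<Pi>\<^sub>M m\<in>{..<k}. (borel :: (real ^ 'd) measure)) \<Otimes>\<^sub>M M)"
    using measurable_compose[OF measurable_snd D] .
  ultimately show ?thesis unfolding linear_field_def case_prod_beta
    by (intro borel_measurable_add borel_measurable_sum borel_measurable_inner) auto
qed

lemma log_partition_field_measurable:
  fixes x :: "nat \<Rightarrow> 'a \<Rightarrow> real ^ 'd"
  assumes x: "\<And>m. m < k \<Longrightarrow> x m \<in> borel_measurable M" and D: "D \<in> borel_measurable M"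
  shows "(\<lambda>\<xi>. log_partition M (linear_field k x D \<xi>)) \<in> borel_measurable (\<Pi>\<^sub>M m\<in>{..<k}. borel)"
proof -
  note [measurable] = linear_field_measurable[OF x D]
  show ?thesis unfolding log_partition_def by measurable
qed

lemma gibbs_mean_field_measurable:
  fixes x :: "nat \<Rightarrow> 'a \<Rightarrow> real ^ 'd"
  assumes x: "\<And>m. m < k \<Longrightarrow> x m \<in> borel_measurable M" and D: "D \<in> borel_measurable M"
    and f: "(\<lambda>(\<xi>, t). f \<xi> t) \<in> borel_measurable ((\<Pi>\<^sub>M m\<in>{..<k}. borel) \<Otimes>\<^sub>M M)"
  shows "(\<lambda>\<xi>. gibbs_mean M (linear_field k x D \<xi>) (f \<xi>)) \<in> borel_measurable (\<Pi>\<^sub>M m\<in>{..<k}. borel)"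
proof -
  note [measurable] = linear_field_measurable[OF x D] f
  show ?thesis unfolding gibbs_mean_def by measurable
qed

lemma gibbs_cov_field_measurable:
  fixes x :: "nat \<Rightarrow> 'a \<Rightarrow> real ^ 'd"
  assumes x: "\<And>m. m < k \<Longrightarrow> x m \<in> borel_measurable M" and D: "D \<in> borel_measurable M"
    and f: "f \<in> borel_measurable M" and g: "g \<in> borel_measurable M"
  shows "(\<lambda>\<xi>. gibbs_cov M (linear_field k x D \<xi>) f g) \<in> borel_measurable (\<Pi>\<^sub>M m\<in>{..<k}. borel)"
proof -
  note [measurable] = f g
  show ?thesis unfolding gibbs_cov_def
    by (intro borel_measurable_diff borel_measurable_times gibbs_mean_field_measurable x D) measurable
qed

lemma integrable_log_partition_field:
  fixes x :: "nat \<Rightarrow> 'a \<Rightarrow> real ^ 'd"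
  assumes Q: "\<And>m. centered_law S \<delta> c (Q m)"
    and x: "\<And>m. m < k \<Longrightarrow> bounded_feature M \<rho> (x m)" and D: "D \<in> bfun M"
  shows "integrable (\<Pi>\<^sub>M m\<in>{..<k}. Q m) (\<lambda>\<xi>. log_partition M (linear_field k x D \<xi>))"
proof -
  obtain b where b: "\<And>t. t \<in> space M \<Longrightarrow> \<bar>D t\<bar> \<le> b" by (rule bfunE[OF D]) blast
  show ?thesis
    by (rule integrable_linear_field_functional[OF Q])
       (use x in \<open>auto intro!: log_partition_field_measurable log_partition_abs_le linear_field_bfun[OF x D]
         linear_field_abs_le[OF x b] bfun_measurable[OF D] simp: bounded_feature_def\<close>)
qed

text \<open>
  Lindeberg's method: the factors of the product law are exchanged one at a time, and each exchange
  costs twice the error of the second-order expansion in that block.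
\<close>

lemma log_partition_lindeberg:
  fixes x :: "nat \<Rightarrow> 'a \<Rightarrow> real ^ 'd"
  assumes Q: "\<And>m. centered_law S \<delta> c (Q m)" and R: "\<And>m. centered_law S \<delta> c (R m)"
    and x: "\<And>m. m < k \<Longrightarrow> bounded_feature M \<rho> (x m)" and D: "D \<in> bfun M" and \<rho>: "0 \<le> \<rho>"
  shows "\<bar>(\<integral>\<xi>. log_partition M (linear_field k x D \<xi>) \<partial>(\<Pi>\<^sub>M m\<in>{..<k}. Q m))
      - (\<integral>\<xi>. log_partition M (linear_field k x D \<xi>) \<partial>(\<Pi>\<^sub>M m\<in>{..<k}. R m))\<bar>
    \<le> real k * (12 * \<rho> ^ 3 * c + 2 * (real CARD('d))\<^sup>2 * \<delta> * \<rho>\<^sup>2)"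
proof -
  let ?F = "\<lambda>\<xi>. log_partition M (linear_field k x D \<xi>)"
  let ?e = "12 * \<rho> ^ 3 * c + 2 * (real CARD('d))\<^sup>2 * \<delta> * \<rho>\<^sup>2"
  \<comment> \<open>Hybrid laws: the first \<open>j\<close> factors have been exchanged.\<close>
  define H where "H j m = (if m < j then R m else Q m)" for j m :: nat
  define I where "I j = (\<integral>\<xi>. ?F \<xi> \<partial>(\<Pi>\<^sub>M m\<in>{..<k}. H j m))" for j
  have H: "centered_law S \<delta> c (H j m)" for j m using Q R by (simp add: H_def)
  then have PH: "prob_space (H j m)" for j m by (simp add: centered_law_def)
  have step: "\<bar>I (Suc j) - I j\<bar> \<le> ?e" if j: "j < k" for j
    unfolding I_def
  proof (rule integral_prod_diff_le[OF PH PH j])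
    show "H (Suc j) l = H j l" if "l \<noteq> j" for l using that by (auto simp: H_def)
    show "integrable (Pi\<^sub>M {..<k} (H (Suc j))) ?F" "integrable (Pi\<^sub>M {..<k} (H j)) ?F"
      using integrable_log_partition_field[OF H x D] by auto
    fix w
    let ?x = "\<lambda>l. if l = j then (\<lambda>t. 0) else x l"
    let ?U = "linear_field k ?x D w"
    have "bounded_feature M \<rho> (?x l)" if "l < k" for l using x[OF that] \<rho> by (auto simp: bounded_feature_def)
    then have U: "?U \<in> bfun M" by (intro linear_field_bfun D)
    have F: "?F (w(j := \<zeta>)) = log_partition M (\<lambda>t. ?U t + \<zeta> \<bullet> x j t)" for \<zeta>
      by (intro arg_cong[of _ _ "log_partition M"] ext linear_field_split[OF j])
    have tri: "\<bar>A - B\<bar> \<le> 2 * a" if "\<bar>A - C\<bar> \<le> a" "\<bar>B - C\<bar> \<le> a" for A B C a :: real using that by linarith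
    from tri[OF expected_log_partition_block[OF H U x[OF j] \<rho>] expected_log_partition_block[OF H U x[OF j] \<rho>]]
    show "\<bar>(\<integral>\<zeta>. ?F (w(j := \<zeta>)) \<partial>H (Suc j) j) - (\<integral>\<zeta>. ?F (w(j := \<zeta>)) \<partial>H j j)\<bar> \<le> ?e"
      unfolding F by (simp add: algebra_simps)
  qed
  have "\<bar>I k - I 0\<bar> = \<bar>\<Sum>j<k. I (Suc j) - I j\<bar>" by (simp add: sum_lessThan_telescope)
  also have "\<dots> \<le> (\<Sum>j<k. ?e)" using step by (intro order.trans[OF sum_abs] sum_mono) auto
  finally have "\<bar>I k - I 0\<bar> \<le> real k * ?e" by simp
  moreover have "I k = (\<integral>\<xi>. ?F \<xi> \<partial>(\<Pi>\<^sub>M m\<in>{..<k}. R m))"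
    unfolding I_def by (intro arg_cong[where f="\<lambda>P. integral\<^sup>L P _"] PiM_cong) (auto simp: H_def)
  moreover have "I 0 = (\<integral>\<xi>. ?F \<xi> \<partial>(\<Pi>\<^sub>M m\<in>{..<k}. Q m))"
    unfolding I_def by (intro arg_cong[where f="\<lambda>P. integral\<^sup>L P _"] PiM_cong) (auto simp: H_def)
  ultimately show ?thesis by (simp add: abs_minus_commute)
qed

lemma integrable_gibbs_mean_field:
  fixes x :: "nat \<Rightarrow> 'a \<Rightarrow> real ^ 'd"
  assumes Q: "\<And>m. centered_law S \<delta> c (Q m)"
    and x: "\<And>m. m < k \<Longrightarrow> bounded_feature M \<rho> (x m)" and D: "D \<in> bfun M"
    and y: "\<And>m. m < k \<Longrightarrow> bounded_feature M \<rho> (y m)" and E: "E \<in> bfun M"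
  shows "integrable (\<Pi>\<^sub>M m\<in>{..<k}. Q m) (\<lambda>\<xi>. gibbs_mean M (linear_field k x D \<xi>) (linear_field k y E \<xi>))"
proof -
  obtain b where b: "\<And>t. t \<in> space M \<Longrightarrow> \<bar>E t\<bar> \<le> b" by (rule bfunE[OF E]) blast
  show ?thesis
    by (rule integrable_linear_field_functional[OF Q])
       (use x y in \<open>auto intro!: gibbs_mean_field_measurable gibbs_mean_bound linear_field_bfun[OF x D] linear_field_bfun[OF y E]
         linear_field_abs_le[OF y b] linear_field_measurable bfun_measurable[OF D] bfun_measurable[OF E] simp: bounded_feature_def\<close>)
qed

lemma integrable_gibbs_cov_field:
  fixes x :: "nat \<Rightarrow> 'a \<Rightarrow> real ^ 'd"
  assumes Q: "\<And>m. centered_law S \<delta> c (Q m)"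
    and x: "\<And>m. m < k \<Longrightarrow> bounded_feature M \<rho> (x m)" and D: "D \<in> bfun M"
    and f: "f \<in> bfun M" and g: "g \<in> bfun M"
  shows "integrable (\<Pi>\<^sub>M m\<in>{..<k}. Q m) (\<lambda>\<xi>. gibbs_cov M (linear_field k x D \<xi>) f g)"
proof -
  obtain b where b: "\<And>t. t \<in> space M \<Longrightarrow> \<bar>f t\<bar> \<le> b" by (rule bfunE[OF f]) blast
  obtain b' where b': "\<And>t. t \<in> space M \<Longrightarrow> \<bar>g t\<bar> \<le> b'" by (rule bfunE[OF g]) blast
  have "\<bar>gibbs_cov M (linear_field k x D \<xi>) f g\<bar> \<le> 0 * (\<Sum>m<k. norm (\<xi> m)) + 2 * (b * b')" for \<xi>
    using gibbs_cov_bound[OF linear_field_bfun[OF x D] f b g b'] by simp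
  then show ?thesis
    by (rule integrable_linear_field_functional[OF Q, rotated])
       (use x f g D in \<open>auto intro!: gibbs_cov_field_measurable dest: bfun_measurable simp: bounded_feature_def\<close>)
qed

text \<open>
  Every block contributes separately: the other blocks are frozen into the field \<open>U\<close> of the
  one-block statement.
\<close>

lemma gibbs_mean_integration_by_parts:
  fixes x y :: "nat \<Rightarrow> 'a \<Rightarrow> real ^ 'd"
  assumes Q: "\<And>m. centered_law S \<delta> c (Q m)"
    and x: "\<And>m. m < k \<Longrightarrow> bounded_feature M \<rho> (x m)" and D: "D \<in> bfun M"
    and y: "\<And>m. m < k \<Longrightarrow> bounded_feature M \<rho> (y m)" and E: "E \<in> bfun M"
    and \<rho>: "0 \<le> \<rho>" and S: "\<And>i j. \<bar>S $ i $ j\<bar> \<le> \<sigma>"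
  shows "\<bar>(\<integral>\<xi>. gibbs_mean M (linear_field k x D \<xi>) (linear_field k y E \<xi>) \<partial>(\<Pi>\<^sub>M m\<in>{..<k}. Q m))
      - (\<integral>\<xi>. gibbs_mean M (linear_field k x D \<xi>) E +
          (\<Sum>m<k. \<Sum>i\<in>UNIV. \<Sum>j\<in>UNIV. S $ i $ j * gibbs_cov M (linear_field k x D \<xi>) (\<lambda>t. y m t $ i) (\<lambda>t. x m t $ j))
          \<partial>(\<Pi>\<^sub>M m\<in>{..<k}. Q m))\<bar>
    \<le> real k * (6 * \<rho> ^ 3 * c + 2 * (real CARD('d))\<^sup>2 * \<delta> * \<rho>\<^sup>2 + 6 * (real CARD('d))\<^sup>2 * \<sigma> * \<rho> ^ 3 * (1 + c))"
proof -
  let ?P = "\<Pi>\<^sub>M m\<in>{..<k}. Q m" let ?Z = "linear_field k x D"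
  let ?e = "6 * \<rho> ^ 3 * c + 2 * (real CARD('d))\<^sup>2 * \<delta> * \<rho>\<^sup>2 + 6 * (real CARD('d))\<^sup>2 * \<sigma> * \<rho> ^ 3 * (1 + c)"
  let ?A = "\<lambda>m \<xi>. gibbs_mean M (?Z \<xi>) (\<lambda>t. \<xi> m \<bullet> y m t)"
  let ?B = "\<lambda>m \<xi>. \<Sum>i\<in>UNIV. \<Sum>j\<in>UNIV. S $ i $ j * gibbs_cov M (?Z \<xi>) (\<lambda>t. y m t $ i) (\<lambda>t. x m t $ j)"
  let ?E = "\<lambda>\<xi>. gibbs_mean M (?Z \<xi>) E"
  have PQ: "prob_space (Q m)" for m using Q by (simp add: centered_law_def)
  have A: "integrable ?P (?A m)" if m: "m < k" for m
  proof -
    let ?y = "\<lambda>l. if l = m then y m else (\<lambda>t. 0)"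
    have "(\<Sum>l<k. \<xi> l \<bullet> ?y l t) = \<xi> m \<bullet> y m t" for \<xi> t
      using m by (subst sum.remove[of _ m]) auto
    then have "(\<lambda>t. \<xi> m \<bullet> y m t) = linear_field k ?y (\<lambda>t. 0) \<xi>" for \<xi>
      unfolding linear_field_def by auto
    moreover have "bounded_feature M \<rho> (?y l)" if "l < k" for l using y[OF that] \<rho> by (auto simp: bounded_feature_def)
    ultimately show ?thesis using integrable_gibbs_mean_field[where y = ?y and E = "\<lambda>t. 0" and x = x and D = D and \<rho> = \<rho> and k = k, OF Q x D] by simp
  qed
  have B: "integrable ?P (?B m)" if m: "m < k" for m
    using bounded_feature_comp[OF x[OF m]] bounded_feature_comp[OF y[OF m]]
    by (intro Bochner_Integration.integrable_sum integrable_mult_right integrable_gibbs_cov_field[OF Q x D]) auto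
  have E': "integrable ?P ?E"
  proof -
    have "linear_field k (\<lambda>_ _. 0) E \<xi> = E" for \<xi> :: "nat \<Rightarrow> real ^ 'd" unfolding linear_field_def by simp
    moreover have "bounded_feature M \<rho> (\<lambda>_. 0 :: real ^ 'd)" using \<rho> by (simp add: bounded_feature_def)
    ultimately show ?thesis using integrable_gibbs_mean_field[where y = "\<lambda>_ _. 0" and E = E and x = x and D = D and \<rho> = \<rho> and k = k, OF Q x D _ E] by simp
  qed
  have split: "gibbs_mean M (?Z \<xi>) (linear_field k y E \<xi>) = ?E \<xi> + (\<Sum>m<k. ?A m \<xi>)" for \<xi>
  proof -
    have Z: "?Z \<xi> \<in> bfun M" by (rule linear_field_bfun[OF x D])
    have b: "(\<lambda>t. \<xi> m \<bullet> y m t) \<in> bfun M" if "m < k" for m by (rule bounded_feature_inner(1)[OF y[OF that]])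
    have "gibbs_mean M (?Z \<xi>) (\<lambda>t. \<Sum>m<k. \<xi> m \<bullet> y m t) = (\<Sum>m<k. ?A m \<xi>)"
      by (rule gibbs_mean_sum[OF Z]) (use b in auto)
    then show ?thesis using gibbs_mean_add[OF Z bfun_sum[of "{..<k}"] E, of "\<lambda>m t. \<xi> m \<bullet> y m t"] b
      by (simp add: linear_field_def[of k y E, abs_def])
  qed
  have step: "\<bar>(\<integral>\<xi>. ?A m \<xi> \<partial>?P) - (\<integral>\<xi>. ?B m \<xi> \<partial>?P)\<bar> \<le> ?e" if m: "m < k" for m
  proof (rule integral_prod_diff_le[OF PQ PQ m refl A[OF m] B[OF m]])
    fix w
    let ?x = "\<lambda>l. if l = m then (\<lambda>t. 0) else x l"
    let ?U = "linear_field k ?x D w"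
    have "bounded_feature M \<rho> (?x l)" if "l < k" for l using x[OF that] \<rho> by (auto simp: bounded_feature_def)
    then have U: "?U \<in> bfun M" by (intro linear_field_bfun D)
    have Z: "?Z (w(m := \<zeta>)) = (\<lambda>t. ?U t + \<zeta> \<bullet> x m t)" for \<zeta>
      using linear_field_split[OF m, of x D w \<zeta>] by auto
    show "\<bar>(\<integral>\<zeta>. ?A m (w(m := \<zeta>)) \<partial>Q m) - (\<integral>\<zeta>. ?B m (w(m := \<zeta>)) \<partial>Q m)\<bar> \<le> ?e"
      using expected_gibbs_mean_block[OF Q U x[OF m] y[OF m] \<rho> S] unfolding Z by simp
  qed
  have "(\<integral>\<xi>. ?E \<xi> + (\<Sum>m<k. ?A m \<xi>) \<partial>?P) - (\<integral>\<xi>. ?E \<xi> + (\<Sum>m<k. ?B m \<xi>) \<partial>?P)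
    = (\<Sum>m<k. (\<integral>\<xi>. ?A m \<xi> \<partial>?P) - (\<integral>\<xi>. ?B m \<xi> \<partial>?P))"
    using integral_add_sum[OF E', of k ?A, OF A] integral_add_sum[OF E', of k ?B, OF B]
    by (simp only: sum_subtractf)
  moreover have "\<bar>\<Sum>m<k. (\<integral>\<xi>. ?A m \<xi> \<partial>?P) - (\<integral>\<xi>. ?B m \<xi> \<partial>?P)\<bar> \<le> (\<Sum>m<k. ?e)"
    using step by (intro order.trans[OF sum_abs] sum_mono) simp
  ultimately show ?thesis unfolding split by (simp only: sum_constant card_lessThan)
qed

end

section \<open>Comparing responses by convexity of the free energy\<close>

lemma bounded_feature_mono: "bounded_feature p \<rho> x \<Longrightarrow> \<rho> \<le> \<rho>' \<Longrightarrow> bounded_feature p \<rho>' x"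
  unfolding bounded_feature_def by force

lemma matrix_bound_exists:
  fixes B :: "real ^ 'd ^ 'd"
  obtains \<beta> where "0 \<le> \<beta>" "\<And>v. norm (B *v v) \<le> \<beta> * norm v"
  using that[of "onorm ((*v) B)"] onorm[OF matrix_vector_mul_bounded_linear[of B]] onorm_pos_le[OF matrix_vector_mul_bounded_linear[of B]]
  by blast

text \<open>
  The Gibbs mean, over two replicas, of the test function: a bias plus the covariances of the features
  contracted with \<open>H\<close>.
\<close>

definition response :: "'a measure \<Rightarrow> nat \<Rightarrow> (nat \<Rightarrow> 'a \<Rightarrow> real ^ 'd) \<Rightarrow> real ^ 'd ^ 'd \<Rightarrow> ('a \<Rightarrow> real) \<Rightarrow> ('a \<Rightarrow> real) \<Rightarrow> real" where
  "response p k x H b Z = gibbs_mean p Z b +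
     (\<Sum>m<k. \<Sum>i\<in>UNIV. \<Sum>j\<in>UNIV. H $ i $ j * gibbs_cov p Z (\<lambda>t. x m t $ j) (\<lambda>t. x m t $ i))"

lemma integral_abs_diff_le:
  fixes F G :: "'b \<Rightarrow> real"
  assumes "prob_space Q" "integrable Q F" "integrable Q G" "\<And>w. \<bar>F w - G w\<bar> \<le> e"
  shows "\<bar>(\<integral>w. F w \<partial>Q) - (\<integral>w. G w \<partial>Q)\<bar> \<le> e"
proof -
  interpret Q: prob_space Q by fact
  have "\<bar>(\<integral>w. F w \<partial>Q) - (\<integral>w. G w \<partial>Q)\<bar> = \<bar>\<integral>w. F w - G w \<partial>Q\<bar>" using assms by simp
  also have "\<dots> \<le> (\<integral>w. \<bar>F w - G w\<bar> \<partial>Q)" by simp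
  also have "\<dots> \<le> (\<integral>w. e \<partial>Q)" by (rule integral_mono) (use assms in auto)
  finally show ?thesis by (simp add: Q.prob_space)
qed

context prob_space begin

text \<open>
  The reason for the choice \<open>S ** B = H\<close>: contracting \<open>S\<close> with the direction
  \<open>B x\<close> turns the right-hand side of integration by parts into the response with matrix \<open>H\<close>. The perturbation
  of the features by \<open>\<beta> B x\<close> adds an error of order \<open>\<beta>\<close>.
\<close>

lemma gibbs_cov_transported:
  fixes x :: "'a \<Rightarrow> real ^ 'd"
  assumes Z: "Z \<in> bfun M" and x: "bounded_feature M \<rho> x" and y: "bounded_feature M \<rho> (\<lambda>t. B *v x t)"
    and S: "transpose S = S" and H: "transpose H = H" and SB: "S ** B = H" and \<sigma>: "\<And>i j. \<bar>S $ i $ j\<bar> \<le> \<sigma>"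
  shows "\<bar>(\<Sum>i\<in>UNIV. \<Sum>j\<in>UNIV. S $ i $ j * gibbs_cov M Z (\<lambda>t. (B *v x t) $ i) (\<lambda>t. (x t + \<beta> *\<^sub>R (B *v x t)) $ j))
      - (\<Sum>i\<in>UNIV. \<Sum>j\<in>UNIV. H $ i $ j * gibbs_cov M Z (\<lambda>t. x t $ j) (\<lambda>t. x t $ i))\<bar>
    \<le> \<bar>\<beta>\<bar> * ((real CARD('d))\<^sup>2 * (\<sigma> * (2 * \<rho>\<^sup>2)))"
proof -
  note cx = bounded_feature_comp[OF x] and cy = bounded_feature_comp[OF y]
  let ?C = "\<lambda>i j. gibbs_cov M Z (\<lambda>t. x t $ i) (\<lambda>t. x t $ j)"
  let ?D = "\<lambda>i j. gibbs_cov M Z (\<lambda>t. (B *v x t) $ i) (\<lambda>t. (B *v x t) $ j)"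
  have D: "\<bar>?D i j\<bar> \<le> 2 * \<rho>\<^sup>2" for i j
    using gibbs_cov_bound[OF Z cy cy] by (simp add: power2_eq_square)
  have left: "gibbs_cov M Z (\<lambda>t. (B *v x t) $ i) (\<lambda>t. x t $ j) = (\<Sum>l\<in>UNIV. B $ i $ l * ?C l j)" for i j
  proof -
    have "gibbs_cov M Z (\<lambda>t. \<Sum>l\<in>UNIV. B $ i $ l * x t $ l) (\<lambda>t. x t $ j) = (\<Sum>l\<in>UNIV. gibbs_cov M Z (\<lambda>t. B $ i $ l * x t $ l) (\<lambda>t. x t $ j))"
      by (rule gibbs_cov_sum_left[OF Z]) (use cx(1) in auto)
    then show ?thesis by (simp add: matrix_vector_mult_def gibbs_cov_cmult_left)
  qed
  have split: "gibbs_cov M Z (\<lambda>t. (B *v x t) $ i) (\<lambda>t. (x t + \<beta> *\<^sub>R (B *v x t)) $ j)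
     = (\<Sum>l\<in>UNIV. B $ i $ l * ?C l j) + \<beta> * ?D i j" for i j
  proof -
    have "gibbs_cov M Z (\<lambda>t. (B *v x t) $ i) (\<lambda>t. x t $ j + \<beta> * (B *v x t) $ j)
      = gibbs_cov M Z (\<lambda>t. (B *v x t) $ i) (\<lambda>t. x t $ j) + gibbs_cov M Z (\<lambda>t. (B *v x t) $ i) (\<lambda>t. \<beta> * (B *v x t) $ j)"
      by (rule gibbs_cov_add_right[OF Z cy(1) cx(1)]) (use cy(1) in auto)
    then show ?thesis by (simp add: left gibbs_cov_cmult_right)
  qed
  have "(\<Sum>i\<in>UNIV. \<Sum>j\<in>UNIV. S $ i $ j * (\<Sum>l\<in>UNIV. B $ i $ l * ?C l j)) = (\<Sum>l\<in>UNIV. \<Sum>j\<in>UNIV. H $ l $ j * ?C l j)"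
  proof -
    have SH: "(\<Sum>i\<in>UNIV. S $ i $ j * B $ i $ l) = H $ l $ j" for j l
    proof -
      have "H $ l $ j = transpose H $ j $ l" by (simp add: transpose_def)
      also have "\<dots> = (S ** B) $ j $ l" by (simp add: H SB)
      also have "\<dots> = (\<Sum>i\<in>UNIV. S $ j $ i * B $ i $ l)" by (simp add: matrix_matrix_mult_def)
      also have "\<dots> = (\<Sum>i\<in>UNIV. S $ i $ j * B $ i $ l)"
        by (intro sum.cong refl arg_cong2[of _ _ _ _ "(*)"]) (subst S[symmetric], simp add: transpose_def)
      finally show ?thesis ..
    qed
    have "(\<Sum>i\<in>UNIV. \<Sum>j\<in>UNIV. S $ i $ j * (\<Sum>l\<in>UNIV. B $ i $ l * ?C l j))
        = (\<Sum>i\<in>UNIV. \<Sum>j\<in>UNIV. \<Sum>l\<in>UNIV. S $ i $ j * B $ i $ l * ?C l j)" by (simp add: sum_distrib_left mult.assoc)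
    also have "\<dots> = (\<Sum>j\<in>UNIV. \<Sum>i\<in>UNIV. \<Sum>l\<in>UNIV. S $ i $ j * B $ i $ l * ?C l j)" by (rule sum.swap)
    also have "\<dots> = (\<Sum>j\<in>UNIV. \<Sum>l\<in>UNIV. \<Sum>i\<in>UNIV. S $ i $ j * B $ i $ l * ?C l j)"
      by (intro sum.cong refl sum.swap)
    also have "\<dots> = (\<Sum>j\<in>UNIV. \<Sum>l\<in>UNIV. H $ l $ j * ?C l j)" by (simp only: sum_distrib_right[symmetric] SH)
    also have "\<dots> = (\<Sum>l\<in>UNIV. \<Sum>j\<in>UNIV. H $ l $ j * ?C l j)" by (rule sum.swap)
    finally show ?thesis .
  qed
  moreover have "(\<Sum>i\<in>UNIV. \<Sum>j\<in>UNIV. S $ i $ j * ((\<Sum>l\<in>UNIV. B $ i $ l * ?C l j) + \<beta> * ?D i j))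
     = (\<Sum>i\<in>UNIV. \<Sum>j\<in>UNIV. S $ i $ j * (\<Sum>l\<in>UNIV. B $ i $ l * ?C l j)) + \<beta> * (\<Sum>i\<in>UNIV. \<Sum>j\<in>UNIV. S $ i $ j * ?D i j)"
    by (simp add: distrib_left sum.distrib sum_distrib_left mult.left_commute)
  moreover have "?C l j = gibbs_cov M Z (\<lambda>t. x t $ j) (\<lambda>t. x t $ l)" for l j by (rule gibbs_cov_commute)
  ultimately have "(\<Sum>i\<in>UNIV. \<Sum>j\<in>UNIV. S $ i $ j * gibbs_cov M Z (\<lambda>t. (B *v x t) $ i) (\<lambda>t. (x t + \<beta> *\<^sub>R (B *v x t)) $ j))
      - (\<Sum>i\<in>UNIV. \<Sum>j\<in>UNIV. H $ i $ j * gibbs_cov M Z (\<lambda>t. x t $ j) (\<lambda>t. x t $ i)) = \<beta> * (\<Sum>i\<in>UNIV. \<Sum>j\<in>UNIV. S $ i $ j * ?D i j)"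
    unfolding split by simp
  then show ?thesis using mult_left_mono[OF double_sum_abs_le[OF \<sigma> D] abs_ge_zero[of \<beta>]] by (simp only: abs_mult)
qed

text \<open>
  One common bound for the features, the direction and the perturbed features keeps the error terms
  uniform in \<open>\<beta>\<close>.
\<close>

lemma bounded_feature_perturbed:
  fixes x :: "'a \<Rightarrow> real ^ 'd"
  assumes x: "bounded_feature M r x" and B: "\<And>v. norm (B *v v) \<le> b * norm v" and b: "0 \<le> b" and \<beta>: "\<bar>\<beta>\<bar> \<le> 1" and r: "0 \<le> r"
  shows "bounded_feature M ((1 + b) * r) x" "bounded_feature M ((1 + b) * r) (\<lambda>t. B *v x t)"
    "bounded_feature M ((1 + b) * r) (\<lambda>t. x t + \<beta> *\<^sub>R (B *v x t))"
proof -
  have xm[measurable]: "x \<in> borel_measurable M" and xr: "\<And>t. t \<in> space M \<Longrightarrow> norm (x t) \<le> r" using x by (auto simp: bounded_feature_def)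
  have "continuous_on UNIV ((*v) B)" by (rule linear_continuous_on[OF matrix_vector_mul_bounded_linear])
  from borel_measurable_continuous_on[OF this xm] have Bm[measurable]: "(\<lambda>t. B *v x t) \<in> borel_measurable M" .
  have Br: "norm (B *v x t) \<le> b * r" if "t \<in> space M" for t
    using order.trans[OF B mult_left_mono[OF xr[OF that] b]] .
  have "0 \<le> b * r" using b r by simp
  then show "bounded_feature M ((1 + b) * r) x"
    using bounded_feature_mono[OF x, of "(1 + b) * r"] by (simp add: distrib_right)
  show "bounded_feature M ((1 + b) * r) (\<lambda>t. B *v x t)"
    unfolding bounded_feature_def
    using Bm Br r by (auto simp: distrib_right intro: order.trans[OF Br])
  have "norm (x t + \<beta> *\<^sub>R (B *v x t)) \<le> (1 + b) * r" if t: "t \<in> space M" for t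
  proof -
    have "norm (\<beta> *\<^sub>R (B *v x t)) \<le> 1 * norm (B *v x t)" using \<beta> unfolding norm_scaleR by (intro mult_right_mono) auto
    then have "norm (x t + \<beta> *\<^sub>R (B *v x t)) \<le> norm (x t) + norm (B *v x t)" by (intro norm_triangle_le) simp
    then show ?thesis using xr[OF t] Br[OF t] by (simp add: distrib_right)
  qed
  then show "bounded_feature M ((1 + b) * r) (\<lambda>t. x t + \<beta> *\<^sub>R (B *v x t))"
    unfolding bounded_feature_def by auto
qed

text \<open>
  The field \<open>V\<close> of the direction \<open>B x\<close> plus the bias has mean equal to the response, up to
  the errors of integration by parts. This mean is also the slope of the expected free energy at
  \<open>\<beta> = 0\<close> for the law \<open>Q\<close>, and at \<open>\<beta>\<close> for the law \<open>R\<close>. By convexity the first slope times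
  \<open>\<beta>\<close> is at most an increment of free energy, and the second one at least the corresponding increment; the two
  increments agree up to the Lindeberg error. The sign of \<open>\<beta>\<close> selects the upper or the lower bound.
\<close>

lemma response_comparison:
  fixes x :: "nat \<Rightarrow> 'a \<Rightarrow> real ^ 'd" and Q R :: "nat \<Rightarrow> (real ^ 'd) measure"
  assumes Q: "\<And>m. centered_law S \<delta> c (Q m)" and R: "\<And>m. centered_law S \<delta> c (R m)"
    and x: "\<And>m. m < k \<Longrightarrow> bounded_feature M r (x m)" and r: "0 \<le> r"
    and S: "transpose S = S" and H: "transpose H = H" and SB: "S ** B = H" and \<sigma>: "\<And>i j. \<bar>S $ i $ j\<bar> \<le> \<sigma>"
    and B: "\<And>v. norm (B *v v) \<le> \<kappa> * norm v" and \<kappa>: "0 \<le> \<kappa>"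
    and D: "D \<in> bfun M" and E: "E \<in> bfun M" and DE: "\<And>t. t \<in> space M \<Longrightarrow> \<bar>D t - E t\<bar> \<le> \<Delta>"
    and b: "b \<in> bfun M" and \<beta>: "\<bar>\<beta>\<bar> \<le> 1"
  defines "\<rho> \<equiv> (1 + \<kappa>) * r" and "x\<beta> \<equiv> \<lambda>m t. x m t + \<beta> *\<^sub>R (B *v x m t)"
  shows "\<beta> * ((\<integral>\<xi>. response M k x H b (linear_field k x D \<xi>) \<partial>(\<Pi>\<^sub>M m\<in>{..<k}. Q m))
      - (\<integral>\<xi>. response M k x H b (linear_field k x\<beta> (\<lambda>t. E t + \<beta> * b t) \<xi>) \<partial>(\<Pi>\<^sub>M m\<in>{..<k}. R m)))
    \<le> \<bar>\<beta>\<bar> * (2 * (real k * (6 * \<rho> ^ 3 * c + 2 * (real CARD('d))\<^sup>2 * \<delta> * \<rho>\<^sup>2 + 6 * (real CARD('d))\<^sup>2 * \<sigma> * \<rho> ^ 3 * (1 + c)))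
        + \<bar>\<beta>\<bar> * (real k * ((real CARD('d))\<^sup>2 * (\<sigma> * (2 * \<rho>\<^sup>2)))))
      + 2 * (\<Delta> + real k * (12 * \<rho> ^ 3 * c + 2 * (real CARD('d))\<^sup>2 * \<delta> * \<rho>\<^sup>2))"
proof -
  let ?P = "\<Pi>\<^sub>M m\<in>{..<k}. Q m" and ?G = "\<Pi>\<^sub>M m\<in>{..<k}. R m"
  let ?I = "real k * (6 * \<rho> ^ 3 * c + 2 * (real CARD('d))\<^sup>2 * \<delta> * \<rho>\<^sup>2 + 6 * (real CARD('d))\<^sup>2 * \<sigma> * \<rho> ^ 3 * (1 + c))"
  let ?J = "real k * ((real CARD('d))\<^sup>2 * (\<sigma> * (2 * \<rho>\<^sup>2)))"
  let ?L = "real k * (12 * \<rho> ^ 3 * c + 2 * (real CARD('d))\<^sup>2 * \<delta> * \<rho>\<^sup>2)"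
  let ?y = "\<lambda>m t. B *v x m t"
  let ?V = "linear_field k ?y b"
  have \<rho>: "0 \<le> \<rho>" using r \<kappa> by (simp add: \<rho>_def)
  note bf = bounded_feature_perturbed[OF x B \<kappa> _ r, folded \<rho>_def]
  have fx: "bounded_feature M \<rho> (x m)" and fy: "bounded_feature M \<rho> (?y m)" if "m < k" for m using bf[OF that \<beta>] by auto
  have fx': "bounded_feature M \<rho> (x\<beta> m)" if "m < k" for m unfolding x\<beta>_def by (rule bf(3)[OF that \<beta>])
  have PQ: "prob_space ?P" by (rule prob_space_PiM) (use Q in \<open>auto simp: centered_law_def\<close>)
  have PR: "prob_space ?G" by (rule prob_space_PiM) (use R in \<open>auto simp: centered_law_def\<close>)
  \<comment> \<open>Used with \<open>s = 0\<close> for the law \<open>Q\<close> and with \<open>s = \<beta>\<close> for the law \<open>R\<close>.\<close>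
  have ibp: "\<bar>(\<integral>\<xi>. gibbs_mean M (linear_field k (\<lambda>m t. x m t + s *\<^sub>R (B *v x m t)) D' \<xi>) (?V \<xi>) \<partial>(\<Pi>\<^sub>M m\<in>{..<k}. Q' m))
      - (\<integral>\<xi>. response M k x H b (linear_field k (\<lambda>m t. x m t + s *\<^sub>R (B *v x m t)) D' \<xi>) \<partial>(\<Pi>\<^sub>M m\<in>{..<k}. Q' m))\<bar> \<le> ?I + \<bar>s\<bar> * ?J"
    if Q': "\<And>m. centered_law S \<delta> c (Q' m)" and s: "\<bar>s\<bar> \<le> 1" and D': "D' \<in> bfun M" for s D' and Q' :: "nat \<Rightarrow> (real ^ 'd) measure"
  proof -
    let ?x = "\<lambda>m t. x m t + s *\<^sub>R (B *v x m t)" let ?Z = "linear_field k ?x D'" let ?Q = "\<Pi>\<^sub>M m\<in>{..<k}. Q' m"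
    have fs: "bounded_feature M \<rho> (?x m)" if "m < k" for m by (rule bf(3)[OF that s])
    have Z: "?Z \<xi> \<in> bfun M" for \<xi> by (rule linear_field_bfun[OF fs D'])
    let ?R1 = "\<lambda>\<xi>. gibbs_mean M (?Z \<xi>) b + (\<Sum>m<k. \<Sum>i\<in>UNIV. \<Sum>j\<in>UNIV. S $ i $ j * gibbs_cov M (?Z \<xi>) (\<lambda>t. ?y m t $ i) (\<lambda>t. ?x m t $ j))"
    have ib: "integrable ?Q (\<lambda>\<xi>. gibbs_mean M (?Z \<xi>) b)"
    proof -
      have "linear_field k (\<lambda>_ _. 0) b \<xi> = b" for \<xi> :: "nat \<Rightarrow> real ^ 'd" unfolding linear_field_def by simp
      moreover have "bounded_feature M \<rho> (\<lambda>_. 0 :: real ^ 'd)" using \<rho> by (simp add: bounded_feature_def)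
      ultimately show ?thesis
        using integrable_gibbs_mean_field[where y = "\<lambda>_ _. 0" and E = b and x = ?x and D = D' and \<rho> = \<rho> and k = k, OF Q' fs D' _ b] by simp
    qed
    have i1: "integrable ?Q ?R1"
      by (intro Bochner_Integration.integrable_add ib Bochner_Integration.integrable_sum integrable_mult_right
          integrable_gibbs_cov_field[OF Q' fs D'] bounded_feature_comp(1)[OF fy] bounded_feature_comp(1)[OF fs]) auto
    have i2: "integrable ?Q (\<lambda>\<xi>. response M k x H b (?Z \<xi>))"
      unfolding response_def
      by (intro Bochner_Integration.integrable_add ib Bochner_Integration.integrable_sum integrable_mult_right
          integrable_gibbs_cov_field[OF Q' fs D'] bounded_feature_comp(1)[OF fx]) auto
    have close: "\<bar>?R1 \<xi> - response M k x H b (?Z \<xi>)\<bar> \<le> \<bar>s\<bar> * ?J" for \<xi>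
    proof -
      have "?R1 \<xi> - response M k x H b (?Z \<xi>) = (\<Sum>m<k.
         (\<Sum>i\<in>UNIV. \<Sum>j\<in>UNIV. S $ i $ j * gibbs_cov M (?Z \<xi>) (\<lambda>t. ?y m t $ i) (\<lambda>t. ?x m t $ j))
         - (\<Sum>i\<in>UNIV. \<Sum>j\<in>UNIV. H $ i $ j * gibbs_cov M (?Z \<xi>) (\<lambda>t. x m t $ j) (\<lambda>t. x m t $ i)))"
        unfolding response_def by (simp only: sum_subtractf)
      also have "\<bar>\<dots>\<bar> \<le> (\<Sum>m<k. \<bar>s\<bar> * ((real CARD('d))\<^sup>2 * (\<sigma> * (2 * \<rho>\<^sup>2))))"
      proof (rule order.trans[OF sum_abs], rule sum_mono)
        fix m assume "m \<in> {..<k}"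
        then have m: "m < k" by simp
        show "\<bar>(\<Sum>i\<in>UNIV. \<Sum>j\<in>UNIV. S $ i $ j * gibbs_cov M (?Z \<xi>) (\<lambda>t. ?y m t $ i) (\<lambda>t. ?x m t $ j))
         - (\<Sum>i\<in>UNIV. \<Sum>j\<in>UNIV. H $ i $ j * gibbs_cov M (?Z \<xi>) (\<lambda>t. x m t $ j) (\<lambda>t. x m t $ i))\<bar>
         \<le> \<bar>s\<bar> * ((real CARD('d))\<^sup>2 * (\<sigma> * (2 * \<rho>\<^sup>2)))"
          by (rule gibbs_cov_transported[OF Z fx[OF m] fy[OF m] S H SB \<sigma>])
      qed
      finally show ?thesis by (simp add: mult_ac)
    qed
    have PQ': "prob_space ?Q" by (rule prob_space_PiM) (use Q' in \<open>auto simp: centered_law_def\<close>)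
    have tri: "\<bar>A - C\<bar> \<le> a + b" if "\<bar>A - B\<bar> \<le> a" "\<bar>B - C\<bar> \<le> b" for A B C a b :: real using that by linarith
    show ?thesis
      by (rule tri[OF gibbs_mean_integration_by_parts[OF Q' fs D' fy b \<rho> \<sigma>] integral_abs_diff_le[OF PQ' i1 i2 close]])
  qed
  have x0: "linear_field k x D = linear_field k (\<lambda>m t. x m t + 0 *\<^sub>R (B *v x m t)) D" by simp
  let ?Z = "\<lambda>D' \<beta>' \<xi>. linear_field k (\<lambda>m t. x m t + \<beta>' *\<^sub>R (B *v x m t)) (\<lambda>t. D' t + \<beta>' * b t) \<xi>"
  have add: "?Z D' \<beta> \<xi> = (\<lambda>t. ?Z D' 0 \<xi> t + \<beta> * ?V \<xi> t)" for D' \<xi>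
    unfolding linear_field_def by (rule ext) (simp add: inner_add_right sum.distrib sum_distrib_left distrib_left)
  have D0: "(\<lambda>t. D' t + \<beta>' * b t) \<in> bfun M" if "D' \<in> bfun M" for D' \<beta>' using that b by auto
  have V: "?V \<xi> \<in> bfun M" for \<xi> by (rule linear_field_bfun[OF fy b])
  have Zb: "?Z D' \<beta>' \<xi> \<in> bfun M" if "D' \<in> bfun M" "\<bar>\<beta>'\<bar> \<le> 1" for D' \<beta>' \<xi>
    by (rule linear_field_bfun[OF bf(3)[OF _ that(2)] D0[OF that(1)]])
  let ?F = "\<lambda>P D' \<beta>'. \<integral>\<xi>. log_partition M (?Z D' \<beta>' \<xi>) \<partial>P"
  have iF: "integrable (\<Pi>\<^sub>M m\<in>{..<k}. Q' m) (\<lambda>\<xi>. log_partition M (?Z D' \<beta>' \<xi>))"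
    if "\<And>m. centered_law S \<delta> c (Q' m)" "D' \<in> bfun M" "\<bar>\<beta>'\<bar> \<le> 1" for Q' :: "nat \<Rightarrow> (real ^ 'd) measure" and D' \<beta>'
    by (rule integrable_log_partition_field[OF that(1) bf(3)[OF _ that(3)] D0[OF that(2)]])
  have iV: "integrable (\<Pi>\<^sub>M m\<in>{..<k}. Q' m) (\<lambda>\<xi>. gibbs_mean M (?Z D' \<beta>' \<xi>) (?V \<xi>))"
    if "\<And>m. centered_law S \<delta> c (Q' m)" "D' \<in> bfun M" "\<bar>\<beta>'\<bar> \<le> 1" for Q' :: "nat \<Rightarrow> (real ^ 'd) measure" and D' \<beta>'
    by (rule integrable_gibbs_mean_field[OF that(1) bf(3)[OF _ that(3)] D0[OF that(2)] fy b])
  have zero: "\<bar>0 :: real\<bar> \<le> 1" by simp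
  have lower: "\<beta> * (\<integral>\<xi>. gibbs_mean M (?Z D 0 \<xi>) (?V \<xi>) \<partial>?P) \<le> ?F ?P D \<beta> - ?F ?P D 0"
  proof -
    have "(\<integral>\<xi>. \<beta> * gibbs_mean M (?Z D 0 \<xi>) (?V \<xi>) \<partial>?P) \<le> (\<integral>\<xi>. log_partition M (?Z D \<beta> \<xi>) - log_partition M (?Z D 0 \<xi>) \<partial>?P)"
    proof (rule integral_mono)
      show "\<beta> * gibbs_mean M (?Z D 0 \<xi>) (?V \<xi>) \<le> log_partition M (?Z D \<beta> \<xi>) - log_partition M (?Z D 0 \<xi>)" for \<xi>
        using log_partition_ge[OF Zb[OF D zero] bfun_mult[OF bfun_const V], of \<xi> \<beta> \<xi>] unfolding add[of D] gibbs_mean_cmult by linarith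
    qed (intro integrable_mult_right Bochner_Integration.integrable_diff iV[OF Q D zero] iF[OF Q D zero] iF[OF Q D \<beta>])+
    then show ?thesis by (simp only: integral_mult_right_zero Bochner_Integration.integral_diff[OF iF[OF Q D \<beta>] iF[OF Q D zero]])
  qed
  have upper: "?F ?G E \<beta> - ?F ?G E 0 \<le> \<beta> * (\<integral>\<xi>. gibbs_mean M (?Z E \<beta> \<xi>) (?V \<xi>) \<partial>?G)"
  proof -
    have "(\<integral>\<xi>. log_partition M (?Z E \<beta> \<xi>) - log_partition M (?Z E 0 \<xi>) \<partial>?G) \<le> (\<integral>\<xi>. \<beta> * gibbs_mean M (?Z E \<beta> \<xi>) (?V \<xi>) \<partial>?G)"
    proof (rule integral_mono)
      show "log_partition M (?Z E \<beta> \<xi>) - log_partition M (?Z E 0 \<xi>) \<le> \<beta> * gibbs_mean M (?Z E \<beta> \<xi>) (?V \<xi>)" for \<xi>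
        using log_partition_le[OF Zb[OF E zero] bfun_mult[OF bfun_const V], of \<xi> \<beta> \<xi>] unfolding add[of E] gibbs_mean_cmult by linarith
    qed (intro integrable_mult_right Bochner_Integration.integrable_diff iV[OF R E \<beta>] iF[OF R E zero] iF[OF R E \<beta>])+
    then show ?thesis by (simp only: integral_mult_right_zero Bochner_Integration.integral_diff[OF iF[OF R E \<beta>] iF[OF R E zero]])
  qed
  have F_close: "\<bar>?F ?P D \<beta>' - ?F ?G E \<beta>'\<bar> \<le> \<Delta> + ?L" if \<beta>': "\<bar>\<beta>'\<bar> \<le> 1" for \<beta>'
  proof -
    have 1: "\<bar>?F ?P D \<beta>' - ?F ?P E \<beta>'\<bar> \<le> \<Delta>"
    proof (rule integral_abs_diff_le[OF PQ iF[OF Q D \<beta>'] iF[OF Q E \<beta>']])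
      fix \<xi> :: "nat \<Rightarrow> real ^ 'd"
      have "?Z D \<beta>' \<xi> = (\<lambda>t. ?Z E \<beta>' \<xi> t + (D t - E t))" unfolding linear_field_def by auto
      then show "\<bar>log_partition M (?Z D \<beta>' \<xi>) - log_partition M (?Z E \<beta>' \<xi>)\<bar> \<le> \<Delta>"
        using log_partition_lipschitz[OF Zb[OF E \<beta>'] bfun_diff[OF D E] DE] by simp
    qed
    have 2: "\<bar>?F ?P E \<beta>' - ?F ?G E \<beta>'\<bar> \<le> ?L"
      by (rule log_partition_lindeberg[OF Q R bf(3)[OF _ \<beta>'] D0[OF E] \<rho>])
    show ?thesis using 1 2 by linarith
  qed
  define RX where "RX = (\<integral>\<xi>. response M k x H b (linear_field k x D \<xi>) \<partial>?P)"
  define RG where "RG = (\<integral>\<xi>. response M k x H b (linear_field k x\<beta> (\<lambda>t. E t + \<beta> * b t) \<xi>) \<partial>?G)"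
  define VX where "VX = (\<integral>\<xi>. gibbs_mean M (?Z D 0 \<xi>) (?V \<xi>) \<partial>?P)"
  define VG where "VG = (\<integral>\<xi>. gibbs_mean M (?Z E \<beta> \<xi>) (?V \<xi>) \<partial>?G)"
  have X: "\<bar>VX - RX\<bar> \<le> ?I" using ibp[OF Q zero D] unfolding VX_def RX_def by simp
  have G: "\<bar>VG - RG\<bar> \<le> ?I + \<bar>\<beta>\<bar> * ?J" using ibp[OF R \<beta> D0[OF E]] unfolding VG_def RG_def x\<beta>_def .
  have V_le: "\<beta> * (VX - VG) \<le> 2 * (\<Delta> + ?L)"
  proof -
    have "\<beta> * (VX - VG) \<le> 2 * e"
      if "\<beta> * VX \<le> FP - FP0" "FG - FG0 \<le> \<beta> * VG" "\<bar>FP - FG\<bar> \<le> e" "\<bar>FP0 - FG0\<bar> \<le> e" for FP FP0 FG FG0 e :: real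
      unfolding right_diff_distrib using that by linarith
    from this[OF lower[folded VX_def] upper[folded VG_def] F_close[OF \<beta>] F_close[OF zero]] show ?thesis .
  qed
  have rest: "\<beta> * ((VG - RG) - (VX - RX)) \<le> \<bar>\<beta>\<bar> * (2 * ?I + \<bar>\<beta>\<bar> * ?J)"
  proof -
    have tri: "\<bar>(p - q) - (u - v)\<bar> \<le> 2 * i + j" if "\<bar>u - v\<bar> \<le> i" "\<bar>p - q\<bar> \<le> i + j" for p q u v i j :: real
      using that by linarith
    have "\<beta> * ((VG - RG) - (VX - RX)) \<le> \<bar>\<beta> * ((VG - RG) - (VX - RX))\<bar>" by (rule abs_ge_self)
    also have "\<dots> = \<bar>\<beta>\<bar> * \<bar>(VG - RG) - (VX - RX)\<bar>" by (rule abs_mult)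
    also note mult_left_mono[OF tri[OF X G] abs_ge_zero[of \<beta>]]
    finally show ?thesis .
  qed
  have "\<beta> * (RX - RG) = \<beta> * ((VG - RG) - (VX - RX)) + \<beta> * (VX - VG)" by (simp add: algebra_simps)
  also note add_mono[OF rest V_le]
  finally show ?thesis unfolding RX_def RG_def .
qed

end

section \<open>Averaged Gibbs pair measures\<close>

lemma (in prob_space) gibbs_prob_space:
  assumes Z: "Z \<in> bfun M"
  shows "prob_space (gibbs M Z)"
proof (rule prob_spaceI)
  let ?I = "\<integral>s. exp (Z s) \<partial>M"
  note [measurable] = bfun_measurable[OF Z]
  have I: "0 < ?I" by (rule partition_pos[OF Z])
  have int: "integrable M (\<lambda>t. exp (Z t) / ?I)" using bfun_integrable[OF bfun_exp[OF Z]] by simp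
  have "emeasure (gibbs M Z) (space (gibbs M Z)) = (\<integral>\<^sup>+t. ennreal (exp (Z t) / ?I) \<partial>M)"
    unfolding gibbs_def by (simp add: emeasure_density cong: nn_integral_cong_simp)
  also have "\<dots> = ennreal (\<integral>t. exp (Z t) / ?I \<partial>M)"
    using I int by (intro nn_integral_eq_integral) auto
  also have "\<dots> = 1" using I by simp
  finally show "emeasure (gibbs M Z) (space (gibbs M Z)) = 1" .
qed

lemma (in prob_space) integral_gibbs:
  assumes Z: "Z \<in> bfun M" and f: "f \<in> bfun M"
  shows "(\<integral>t. f t \<partial>gibbs M Z) = gibbs_mean M Z f"
proof -
  let ?I = "\<integral>s. exp (Z s) \<partial>M"
  note [measurable] = bfun_measurable[OF Z] bfun_measurable[OF f]
  have I: "0 < ?I" by (rule partition_pos[OF Z])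
  have "(\<integral>t. f t \<partial>gibbs M Z) = (\<integral>t. (exp (Z t) / ?I) *\<^sub>R f t \<partial>M)"
    unfolding gibbs_def by (rule integral_density) (use I in \<open>auto intro!: AE_I2\<close>)
  then show ?thesis by (simp add: gibbs_mean_def mult.commute)
qed

lemma sets_gibbs: "sets (gibbs M Z) = sets M" and space_gibbs: "space (gibbs M Z) = space M"
  by (simp_all add: gibbs_def)

text \<open>
  The normalising integral is measurable in \<open>w\<close>, so the Gibbs measures form a kernel and the monadic
  bind integrates bounded functions by iterated integration.
\<close>

lemma (in prob_space) integral_mean_gibbs_pair:
  fixes f :: "'a \<times> 'a \<Rightarrow> real"
  assumes Q: "prob_space Q" and Z: "\<And>w. w \<in> space Q \<Longrightarrow> (\<lambda>t. Z t w) \<in> bfun M"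
    and Zm: "(\<lambda>(w, t). Z t w) \<in> borel_measurable (Q \<Otimes>\<^sub>M M)"
    and f: "f \<in> bfun (M \<Otimes>\<^sub>M M)"
  shows "(\<integral>st. f st \<partial>mean_gibbs_pair Q M Z)
    = (\<integral>w. gibbs_mean M (\<lambda>t. Z t w) (\<lambda>s. gibbs_mean M (\<lambda>t. Z t w) (\<lambda>t. f (s, t))) \<partial>Q)"
proof -
  interpret Q: prob_space Q by fact
  let ?G = "\<lambda>w. gibbs M (\<lambda>t. Z t w)"
  obtain B where B: "\<And>x. x \<in> space (M \<Otimes>\<^sub>M M) \<Longrightarrow> \<bar>f x\<bar> \<le> B" by (rule bfunE[OF f]) blast
  have prob: "prob_space (?G w)" if "w \<in> space Q" for w by (rule gibbs_prob_space[OF Z[OF that]])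
  note [measurable] = Zm
  have G: "?G \<in> measurable Q (subprob_algebra M)"
  proof (rule measurable_subprob_algebra)
    show "subprob_space (?G w)" if "w \<in> space Q" for w using prob[OF that] by (rule prob_space_imp_subprob_space)
    show "sets (?G w) = sets M" for w by (rule sets_gibbs)
    fix A assume A[measurable]: "A \<in> sets M"
    have "emeasure (?G w) A = (\<integral>\<^sup>+t. ennreal (exp (Z t w) / (\<integral>s. exp (Z s w) \<partial>M)) * indicator A t \<partial>M)"
      if "w \<in> space Q" for w
      unfolding gibbs_def using bfun_measurable[OF Z[OF that]] by (intro emeasure_density) auto
    moreover have "(\<lambda>w. \<integral>\<^sup>+t. ennreal (exp (Z t w) / (\<integral>s. exp (Z s w) \<partial>M)) * indicator A t \<partial>M) \<in> borel_measurable Q"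
      by measurable
    ultimately show "(\<lambda>w. emeasure (?G w) A) \<in> borel_measurable Q"
      by (subst measurable_cong)
  qed
  have N: "(\<lambda>w. ?G w \<Otimes>\<^sub>M ?G w) \<in> measurable Q (subprob_algebra (M \<Otimes>\<^sub>M M))"
    by (rule measurable_pair_measure[OF G G])
  have pair: "prob_space (?G w \<Otimes>\<^sub>M ?G w)" if "w \<in> space Q" for w
  proof -
    interpret G: prob_space "?G w" by (rule prob[OF that])
    interpret pair_prob_space "?G w" "?G w" ..
    show ?thesis by unfold_locales
  qed
  have "(\<integral>st. f st \<partial>mean_gibbs_pair Q M Z) = (\<integral>w. (\<integral>st. f st \<partial>(?G w \<Otimes>\<^sub>M ?G w)) \<partial>Q)"
    unfolding mean_gibbs_pair_def
    by (rule integral_bind[OF bfun_measurable[OF f] B N, where B' = 1])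
       (use Q.finite_measure_axioms pair in \<open>auto simp: prob_space.emeasure_space_1\<close>)
  also have "\<dots> = (\<integral>w. gibbs_mean M (\<lambda>t. Z t w) (\<lambda>s. gibbs_mean M (\<lambda>t. Z t w) (\<lambda>t. f (s, t))) \<partial>Q)"
  proof (rule Bochner_Integration.integral_cong[OF refl])
    fix w assume w: "w \<in> space Q"
    interpret G: prob_space "?G w" by (rule prob[OF w])
    interpret GG: pair_prob_space "?G w" "?G w" ..
    have sets: "sets (?G w \<Otimes>\<^sub>M ?G w) = sets (M \<Otimes>\<^sub>M M)" by (intro sets_pair_measure_cong sets_gibbs)
    have sp: "space (?G w \<Otimes>\<^sub>M ?G w) = space (M \<Otimes>\<^sub>M M)" by (rule sets_eq_imp_space_eq[OF sets])
    have "integrable (?G w \<Otimes>\<^sub>M ?G w) f"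
      by (rule GG.integrable_const_bound[of _ B])
         (use B bfun_measurable[OF f] in \<open>auto simp: sp measurable_cong_sets[OF sets refl]\<close>)
    then have "(\<integral>st. f st \<partial>(?G w \<Otimes>\<^sub>M ?G w)) = (\<integral>s. (\<integral>t. f (s, t) \<partial>?G w) \<partial>?G w)"
      by (rule GG.integral_fst'[symmetric])
    also have "\<dots> = (\<integral>s. gibbs_mean M (\<lambda>t. Z t w) (\<lambda>t. f (s, t)) \<partial>?G w)"
    proof (rule Bochner_Integration.integral_cong[OF refl])
      fix s assume s: "s \<in> space (?G w)"
      have "(\<lambda>t. f (s, t)) \<in> bfun M"
        by (rule bfunI[of _ _ B]) (use s B bfun_measurable[OF f] in \<open>auto simp: space_gibbs space_pair_measure\<close>)
      then show "(\<integral>t. f (s, t) \<partial>?G w) = gibbs_mean M (\<lambda>t. Z t w) (\<lambda>t. f (s, t))"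
        by (rule integral_gibbs[OF Z[OF w]])
    qed
    also have "\<dots> = gibbs_mean M (\<lambda>t. Z t w) (\<lambda>s. gibbs_mean M (\<lambda>t. Z t w) (\<lambda>t. f (s, t)))"
    proof (rule integral_gibbs[OF Z[OF w]], rule bfunI[of _ _ B])
      note [measurable] = bfun_measurable[OF f] bfun_measurable[OF Z[OF w]]
      show "(\<lambda>s. gibbs_mean M (\<lambda>t. Z t w) (\<lambda>t. f (s, t))) \<in> borel_measurable M"
        unfolding gibbs_mean_def by measurable
      fix s assume s: "s \<in> space M"
      have "(\<lambda>t. f (s, t)) \<in> bfun M"
        by (rule bfunI[of _ _ B]) (use s B in \<open>auto simp: space_pair_measure\<close>)
      then show "\<bar>gibbs_mean M (\<lambda>t. Z t w) (\<lambda>t. f (s, t))\<bar> \<le> B"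
        by (rule gibbs_mean_bound[OF Z[OF w]]) (use s B in \<open>auto simp: space_pair_measure\<close>)
    qed
    finally show "(\<integral>st. f st \<partial>(?G w \<Otimes>\<^sub>M ?G w)) = gibbs_mean M (\<lambda>t. Z t w) (\<lambda>s. gibbs_mean M (\<lambda>t. Z t w) (\<lambda>t. f (s, t)))" .
  qed
  finally show ?thesis .
qed

text \<open>
  Two independent replicas turn the bilinear term into a product of means, and the difference of the
  quadratic and the bilinear term is a covariance.
\<close>

lemma (in prob_space) gibbs_mean_pair_bilinear:
  fixes x :: "nat \<Rightarrow> 'a \<Rightarrow> real ^ 'd"
  assumes Z: "Z \<in> bfun M" and b: "b \<in> bfun M" and x: "\<And>m. m < k \<Longrightarrow> bounded_feature M \<rho> (x m)"
  shows "gibbs_mean M Z (\<lambda>s. gibbs_mean M Z (\<lambda>t. b t + (\<Sum>m<k. (H *v x m t) \<bullet> x m t) - (\<Sum>m<k. (H *v x m s) \<bullet> x m t)))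
    = gibbs_mean M Z b + (\<Sum>m<k. \<Sum>i\<in>UNIV. \<Sum>j\<in>UNIV. H $ i $ j * gibbs_cov M Z (\<lambda>t. x m t $ j) (\<lambda>t. x m t $ i))"
proof -
  note c = bounded_feature_comp(1)[OF x]
  have form: "(\<Sum>m<k. (H *v x m s) \<bullet> x m t) = (\<Sum>m<k. \<Sum>i\<in>UNIV. \<Sum>j\<in>UNIV. H $ i $ j * (x m s $ j * x m t $ i))" for s t
    by (simp add: inner_cart matrix_vector_mult_def sum_distrib_right mult.assoc)
  have sum3: "(\<lambda>t. \<Sum>m<k. \<Sum>i\<in>UNIV. \<Sum>j\<in>UNIV. H $ i $ j * f m i j t) \<in> bfun M"
    "gibbs_mean M Z (\<lambda>t. \<Sum>m<k. \<Sum>i\<in>UNIV. \<Sum>j\<in>UNIV. H $ i $ j * f m i j t)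
      = (\<Sum>m<k. \<Sum>i\<in>UNIV. \<Sum>j\<in>UNIV. H $ i $ j * gibbs_mean M Z (f m i j))"
    if f: "\<And>m i j. m < k \<Longrightarrow> f m i j \<in> bfun M" for f :: "nat \<Rightarrow> 'd \<Rightarrow> 'd \<Rightarrow> 'a \<Rightarrow> real"
  proof -
    have 1: "(\<lambda>t. \<Sum>j\<in>UNIV. H $ i $ j * f m i j t) \<in> bfun M" if "m < k" for m i using f[OF that] by auto
    show "(\<lambda>t. \<Sum>m<k. \<Sum>i\<in>UNIV. \<Sum>j\<in>UNIV. H $ i $ j * f m i j t) \<in> bfun M" using f by auto
    have "gibbs_mean M Z (\<lambda>t. \<Sum>m<k. \<Sum>i\<in>UNIV. \<Sum>j\<in>UNIV. H $ i $ j * f m i j t)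
        = (\<Sum>m<k. gibbs_mean M Z (\<lambda>t. \<Sum>i\<in>UNIV. \<Sum>j\<in>UNIV. H $ i $ j * f m i j t))"
      by (rule gibbs_mean_sum[OF Z]) (use f in auto)
    also have "\<dots> = (\<Sum>m<k. \<Sum>i\<in>UNIV. gibbs_mean M Z (\<lambda>t. \<Sum>j\<in>UNIV. H $ i $ j * f m i j t))"
      by (intro sum.cong refl gibbs_mean_sum[OF Z]) (use f in auto)
    also have "\<dots> = (\<Sum>m<k. \<Sum>i\<in>UNIV. \<Sum>j\<in>UNIV. gibbs_mean M Z (\<lambda>t. H $ i $ j * f m i j t))"
      by (intro sum.cong refl gibbs_mean_sum[OF Z]) (use f in auto)
    finally show "gibbs_mean M Z (\<lambda>t. \<Sum>m<k. \<Sum>i\<in>UNIV. \<Sum>j\<in>UNIV. H $ i $ j * f m i j t)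
      = (\<Sum>m<k. \<Sum>i\<in>UNIV. \<Sum>j\<in>UNIV. H $ i $ j * gibbs_mean M Z (f m i j))"
      by (simp only: gibbs_mean_cmult)
  qed
  define D where "D t = (\<Sum>m<k. \<Sum>i\<in>UNIV. \<Sum>j\<in>UNIV. H $ i $ j * (x m t $ j * x m t $ i))" for t
  define P where "P s = (\<Sum>m<k. \<Sum>i\<in>UNIV. \<Sum>j\<in>UNIV. H $ i $ j * (gibbs_mean M Z (\<lambda>t. x m t $ i) * x m s $ j))" for s
  have D: "D \<in> bfun M" "gibbs_mean M Z D = (\<Sum>m<k. \<Sum>i\<in>UNIV. \<Sum>j\<in>UNIV. H $ i $ j * gibbs_mean M Z (\<lambda>t. x m t $ j * x m t $ i))"
    unfolding D_def[abs_def] by (rule sum3, use c in auto)+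
  have P0: "P \<in> bfun M" "gibbs_mean M Z P = (\<Sum>m<k. \<Sum>i\<in>UNIV. \<Sum>j\<in>UNIV. H $ i $ j * gibbs_mean M Z (\<lambda>t. gibbs_mean M Z (\<lambda>t. x m t $ i) * x m t $ j))"
    unfolding P_def[abs_def] by (rule sum3, use c in auto)+
  note P = P0(1) P0(2)[unfolded gibbs_mean_cmult]
  have inner: "gibbs_mean M Z (\<lambda>t. b t + D t - (\<Sum>m<k. \<Sum>i\<in>UNIV. \<Sum>j\<in>UNIV. H $ i $ j * (x m s $ j * x m t $ i)))
      = gibbs_mean M Z b + gibbs_mean M Z D - P s" for s
  proof -
    have B: "(\<lambda>t. \<Sum>m<k. \<Sum>i\<in>UNIV. \<Sum>j\<in>UNIV. H $ i $ j * (x m s $ j * x m t $ i)) \<in> bfun M"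
      "gibbs_mean M Z (\<lambda>t. \<Sum>m<k. \<Sum>i\<in>UNIV. \<Sum>j\<in>UNIV. H $ i $ j * (x m s $ j * x m t $ i))
        = (\<Sum>m<k. \<Sum>i\<in>UNIV. \<Sum>j\<in>UNIV. H $ i $ j * gibbs_mean M Z (\<lambda>t. x m s $ j * x m t $ i))"
      by (rule sum3, use c in auto)+
    have "gibbs_mean M Z (\<lambda>t. b t + D t - (\<Sum>m<k. \<Sum>i\<in>UNIV. \<Sum>j\<in>UNIV. H $ i $ j * (x m s $ j * x m t $ i)))
      = gibbs_mean M Z b + gibbs_mean M Z D - gibbs_mean M Z (\<lambda>t. \<Sum>m<k. \<Sum>i\<in>UNIV. \<Sum>j\<in>UNIV. H $ i $ j * (x m s $ j * x m t $ i))"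
      by (simp only: gibbs_mean_diff[OF Z bfun_add[OF b D(1)] B(1)] gibbs_mean_add[OF Z b D(1)])
    then show ?thesis unfolding B(2) P_def gibbs_mean_cmult by (simp only: mult.commute)
  qed
  have "gibbs_mean M Z (\<lambda>s. gibbs_mean M Z (\<lambda>t. b t + D t - (\<Sum>m<k. \<Sum>i\<in>UNIV. \<Sum>j\<in>UNIV. H $ i $ j * (x m s $ j * x m t $ i))))
    = gibbs_mean M Z b + gibbs_mean M Z D - gibbs_mean M Z P"
    unfolding inner by (simp only: gibbs_mean_diff[OF Z bfun_const P(1)] gibbs_mean_const[OF Z])
  also have "gibbs_mean M Z D - gibbs_mean M Z P
    = (\<Sum>m<k. \<Sum>i\<in>UNIV. \<Sum>j\<in>UNIV. H $ i $ j * gibbs_cov M Z (\<lambda>t. x m t $ j) (\<lambda>t. x m t $ i))"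
    unfolding D(2) P(2) gibbs_cov_def by (simp add: sum_subtractf right_diff_distrib mult.commute)
  then have "gibbs_mean M Z b + gibbs_mean M Z D - gibbs_mean M Z P = gibbs_mean M Z b
    + (\<Sum>m<k. \<Sum>i\<in>UNIV. \<Sum>j\<in>UNIV. H $ i $ j * gibbs_cov M Z (\<lambda>t. x m t $ j) (\<lambda>t. x m t $ i))" by linarith
  finally show ?thesis unfolding form D_def .
qed

section \<open>The pseudoinverse of a block-diagonal operator\<close>

lemma selfadjoint_matrix_inner:
  fixes A :: "real ^ 'd ^ 'd"
  assumes "transpose A = A"
  shows "(A *v x) \<bullet> y = x \<bullet> (A *v y)"
  using dot_lmul_matrix[of x A y] by (simp only: transpose_matrix_vector[symmetric] assms)

text \<open>
  A symmetric \<open>S\<close> is injective on its range, since \<open>S v = 0\<close> and \<open>v = S c\<close> give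
  \<open>v \<bullet> v = c \<bullet> S v = 0\<close>.
\<close>

lemma left_inverse_on_range:
  fixes S :: "real ^ 'd ^ 'd"
  assumes S: "transpose S = S"
  shows "\<exists>G. G ** S ** S = S"
proof -
  have adj: "(S *v x) \<bullet> y = x \<bullet> (S *v y)" for x y
    by (rule selfadjoint_matrix_inner[OF S])
  have "inj_on ((*v) S) (range ((*v) S))"
  proof (rule inj_onI)
    fix a b assume ab: "a \<in> range ((*v) S)" "b \<in> range ((*v) S)" "S *v a = S *v b"
    then obtain c where c: "a - b = S *v c" by (auto simp flip: matrix_vector_mult_diff_distrib)
    have "(a - b) \<bullet> (a - b) = c \<bullet> (S *v (a - b))" unfolding c adj ..
    also have "\<dots> = 0" using ab(3) by (simp add: matrix_vector_mult_diff_distrib)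
    finally show "a = b" by simp
  qed
  then obtain g where g: "linear g" "\<And>v. v \<in> range ((*v) S) \<Longrightarrow> g (S *v v) = v"
    using linear_exists_left_inverse_on[OF matrix_vector_mul_linear[of S]
        linear_subspace_image[OF matrix_vector_mul_linear[of S] subspace_UNIV]] by metis
  have "(matrix g ** S ** S) *v v = S *v v" for v
    using g by (simp add: matrix_vector_mul_assoc[symmetric])
  then have "matrix g ** S ** S = S" by (simp add: matrix_eq)
  then show ?thesis by blast
qed

text \<open>
  With \<open>G ** S ** S = S\<close>, the matrix \<open>E = G ** S\<close> is the orthogonal projection onto the
  range of \<open>S\<close>, and \<open>G ** S ** transpose G\<close> is the pseudoinverse.
\<close>

lemma exists_matrix_pseudoinverse:
  fixes S :: "real ^ 'd ^ 'd"
  assumes S: "transpose S = S"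
  obtains P where "S ** P ** S = S" "P ** S ** P = P" "transpose (S ** P) = S ** P" "transpose (P ** S) = P ** S"
proof -
  obtain G where G: "G ** S ** S = S" using left_inverse_on_range[OF S] by blast
  define E where "E = G ** S"
  have ES: "E ** S = S" using G by (simp add: E_def)
  have "S ** transpose E = transpose (E ** S)" by (simp add: matrix_transpose_mul S)
  also have "\<dots> = S" by (simp add: ES S)
  finally have SE: "S ** transpose E = S" .
  \<comment> \<open>Idempotence against its own transpose already makes \<open>E\<close> symmetric.\<close>
  have "E ** transpose E = G ** (S ** transpose E)" by (simp only: E_def matrix_mul_assoc)
  also have "\<dots> = E" unfolding SE by (simp only: E_def)
  finally have EE: "E ** transpose E = E" .
  have "transpose E = transpose (E ** transpose E)" by (simp only: EE)
  also have "\<dots> = E ** transpose E" by (simp only: matrix_transpose_mul transpose_transpose)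
  also have "\<dots> = E" by (rule EE)
  finally have sym: "transpose E = E" .
  define P where "P = E ** transpose G"
  have "S ** transpose G = transpose E" by (simp only: E_def matrix_transpose_mul S)
  then have SG: "S ** transpose G = E" using sym by simp
  have "S ** P = (S ** E) ** transpose G" unfolding P_def by (rule matrix_mul_assoc)
  then have SP: "S ** P = E" using SE sym SG by simp
  have "P = G ** (S ** transpose G)" unfolding P_def E_def by (simp only: matrix_mul_assoc)
  then have "P ** S = G ** (E ** S)" unfolding SG by (simp only: matrix_mul_assoc)
  then have PS: "P ** S = E" unfolding ES by (simp only: E_def)
  have "E ** P = (E ** E) ** transpose G" unfolding P_def by (rule matrix_mul_assoc)
  then have EP: "E ** P = P" using EE sym by (simp add: P_def)
  show ?thesis
  proof (rule that[of P])
    show "S ** P ** S = S" using SP ES by simp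
    show "P ** S ** P = P" unfolding PS by (rule EP)
  qed (use SP PS sym in auto)
qed

lemma dsum_inner_eqD:
  assumes u: "u \<in> direct_sum k" and v: "v \<in> direct_sum k"
    and eq: "\<And>y. y \<in> direct_sum k \<Longrightarrow> dsum_inner k u y = dsum_inner k v y"
  shows "u = v"
proof
  fix m
  have "(\<lambda>m. u m - v m) \<in> direct_sum k" using u v by (simp add: direct_sum_def)
  from eq[OF this] have "(\<Sum>m<k. (u m - v m) \<bullet> (u m - v m)) = 0"
    unfolding dsum_inner_def by (simp add: inner_diff_left sum_subtractf)
  then have "m < k \<Longrightarrow> u m = v m"
    by (subst (asm) sum_nonneg_eq_0_iff) auto
  then show "u m = v m" using u v by (cases "m < k") (auto simp: direct_sum_def)
qed

lemma block_diag_mult: "block_diag k A (block_diag k B x) = block_diag k (A ** B) x"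
  unfolding block_diag_def by (auto simp: matrix_vector_mul_assoc)

lemma block_diag_in: "block_diag k A x \<in> direct_sum k"
  by (simp add: block_diag_def direct_sum_def)

lemma block_diag_selfadjoint:
  assumes "transpose A = A"
  shows "dsum_inner k (block_diag k A x) y = dsum_inner k x (block_diag k A y)"
  unfolding dsum_inner_def block_diag_def using assms
  by (intro sum.cong) (auto simp: selfadjoint_matrix_inner)

text \<open>
  The predicate inside the definite description that defines \<open>pseudoinverse\<close>.
\<close>

definition is_pseudoinverse ::
  "nat \<Rightarrow> ((nat \<Rightarrow> real ^ 'd) \<Rightarrow> (nat \<Rightarrow> real ^ 'd)) \<Rightarrow> ((nat \<Rightarrow> real ^ 'd) \<Rightarrow> (nat \<Rightarrow> real ^ 'd)) \<Rightarrow> bool" where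
  "is_pseudoinverse k S P \<longleftrightarrow> P \<in> direct_sum k \<rightarrow>\<^sub>E direct_sum k \<and>
     (\<forall>x\<in>direct_sum k. S (P (S x)) = S x) \<and>
     (\<forall>x\<in>direct_sum k. P (S (P x)) = P x) \<and>
     (\<forall>x\<in>direct_sum k. \<forall>y\<in>direct_sum k. dsum_inner k (S (P x)) y = dsum_inner k x (S (P y))) \<and>
     (\<forall>x\<in>direct_sum k. \<forall>y\<in>direct_sum k. dsum_inner k (P (S x)) y = dsum_inner k x (P (S y)))"

text \<open>
  The symmetry conditions and nondegeneracy of the inner product give \<open>S P = S P'\<close> and \<open>P S = P' S\<close>, whence \<open>P = P S P = P' S P' = P'\<close>.
\<close>

lemma pseudoinverse_unique:
  fixes P P' S :: "(nat \<Rightarrow> real ^ 'd) \<Rightarrow> (nat \<Rightarrow> real ^ 'd)"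
  assumes S: "\<And>x. S x \<in> direct_sum k" and P: "is_pseudoinverse k S P" and P': "is_pseudoinverse k S P'"
  shows "P = P'"
proof -
  let ?D = "direct_sum k :: (nat \<Rightarrow> real ^ 'd) set"
  have in_D: "P x \<in> ?D" "P' x \<in> ?D" if "x \<in> ?D" for x
    using P P' that unfolding is_pseudoinverse_def by (auto simp: PiE_iff)
  have SPS: "S (P (S x)) = S x" "S (P' (S x)) = S x" if "x \<in> ?D" for x
    using P P' that unfolding is_pseudoinverse_def by blast+
  have PSP: "P (S (P x)) = P x" "P' (S (P' x)) = P' x" if "x \<in> ?D" for x
    using P P' that unfolding is_pseudoinverse_def by blast+
  have SP: "dsum_inner k (S (P x)) y = dsum_inner k x (S (P y))"
    "dsum_inner k (S (P' x)) y = dsum_inner k x (S (P' y))" if "x \<in> ?D" "y \<in> ?D" for x y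
    using P P' that unfolding is_pseudoinverse_def by blast+
  have PS: "dsum_inner k (P (S x)) y = dsum_inner k x (P (S y))"
    "dsum_inner k (P' (S x)) y = dsum_inner k x (P' (S y))" if "x \<in> ?D" "y \<in> ?D" for x y
    using P P' that unfolding is_pseudoinverse_def by blast+
  have SP_eq: "S (P x) = S (P' x)" if x: "x \<in> ?D" for x
  proof (rule dsum_inner_eqD[OF S S])
    fix y assume y: "y \<in> ?D"
    have "dsum_inner k (S (P x)) y = dsum_inner k (S (P' (S (P x)))) y" by (simp only: SPS in_D x)
    also have "\<dots> = dsum_inner k (S (P x)) (S (P' y))" by (rule SP(2)[OF S y])
    also have "\<dots> = dsum_inner k x (S (P (S (P' y))))" by (rule SP(1)[OF x S])
    also have "\<dots> = dsum_inner k x (S (P' y))" by (simp only: SPS in_D y)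
    also have "\<dots> = dsum_inner k (S (P' x)) y" by (rule SP(2)[OF x y, symmetric])
    finally show "dsum_inner k (S (P x)) y = dsum_inner k (S (P' x)) y" .
  qed
  have PS_eq: "P (S x) = P' (S x)" if x: "x \<in> ?D" for x
  proof (rule dsum_inner_eqD[OF in_D(1)[OF S] in_D(2)[OF S]])
    fix y assume y: "y \<in> ?D"
    have "dsum_inner k (P (S x)) y = dsum_inner k (P (S (P' (S x)))) y" by (simp only: SPS x)
    also have "\<dots> = dsum_inner k (P' (S x)) (P (S y))" by (rule PS(1)[OF in_D(2)[OF S] y])
    also have "\<dots> = dsum_inner k x (P' (S (P (S y))))" by (rule PS(2)[OF x in_D(1)[OF S]])
    also have "\<dots> = dsum_inner k x (P' (S y))" by (simp only: SPS y)
    also have "\<dots> = dsum_inner k (P' (S x)) y" by (rule PS(2)[OF x y, symmetric])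
    finally show "dsum_inner k (P (S x)) y = dsum_inner k (P' (S x)) y" .
  qed
  have "P x = P' x" if x: "x \<in> ?D" for x
  proof -
    have "P x = P (S (P' x))" using PSP(1)[OF x] SP_eq[OF x] by simp
    also have "\<dots> = P' x" using PSP(2)[OF x] PS_eq[OF in_D(2)[OF x]] by simp
    finally show ?thesis .
  qed
  moreover have "P x = P' x" if "x \<notin> ?D" for x
    using P P' that unfolding is_pseudoinverse_def by (auto simp: PiE_iff extensional_def)
  ultimately show ?thesis by blast
qed

lemma pseudoinverse_block_diag:
  fixes S P :: "real ^ 'd ^ 'd"
  assumes "S ** P ** S = S" "P ** S ** P = P" "transpose (S ** P) = S ** P" "transpose (P ** S) = P ** S"
    and x: "x \<in> direct_sum k"
  shows "pseudoinverse k (block_diag k S) x = block_diag k P x"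
proof -
  let ?P = "\<lambda>x\<in>direct_sum k. block_diag k P x"
  have P: "is_pseudoinverse k (block_diag k S) ?P"
    unfolding is_pseudoinverse_def using assms(1-4)
    by (auto simp: block_diag_in block_diag_mult matrix_mul_assoc block_diag_selfadjoint)
  have "pseudoinverse k (block_diag k S) = ?P"
    unfolding pseudoinverse_def is_pseudoinverse_def[symmetric]
    by (rule the_equality, rule P) (rule pseudoinverse_unique[OF block_diag_in _ P])
  then show ?thesis using x by simp
qed

lemma exists_factor_of_column_span:
  fixes S H :: "real ^ 'd ^ 'd"
  assumes "span (columns H) \<subseteq> span (columns S)"
  obtains C where "H = S ** C"
proof -
  have "\<exists>c. S *v c = column j H" for j
  proof -
    have "column j H \<in> span (columns S)"
      using assms span_base[of "column j H" "columns H"] by (auto simp: columns_def)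
    also have "span (columns S) \<subseteq> range ((*v) S)"
    proof (rule span_minimal)
      show "columns S \<subseteq> range ((*v) S)"
        by (auto simp: columns_def matrix_vector_mult_basis[symmetric])
      show "subspace (range ((*v) S))" by (rule linear_subspace_image[OF matrix_vector_mul_linear subspace_UNIV])
    qed
    finally show ?thesis by auto
  qed
  then obtain c where c: "\<And>j. S *v c j = column j H" by metis
  have "H = S ** (\<chi> i j. c j $ i)"
  proof -
    have "H $ i $ j = (S ** (\<chi> i j. c j $ i)) $ i $ j" for i j
      using arg_cong[OF c[of j], of "\<lambda>v. v $ i"]
      by (simp add: column_def matrix_matrix_mult_def matrix_vector_mult_def)
    then show ?thesis by (simp add: vec_eq_iff)
  qed
  then show ?thesis by (rule that)
qed

text \<open>
  The direction \<open>\<Sigma>\<^sup>+ H\<close> of the perturbation acts by one and the same matrix \<open>B\<close> in all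
  blocks and for all numbers of blocks. Inclusion of the column spans means that \<open>H\<close> factors through \<open>S\<close>, which
  gives \<open>S ** B = H\<close>.
\<close>

lemma perturbation_direction:
  fixes S H :: "real ^ 'd ^ 'd"
  assumes S: "transpose S = S" and H: "span (columns H) \<subseteq> span (columns S)"
  obtains B where "S ** B = H"
    "\<And>k x. pseudoinverse k (block_diag k S) (block_diag k H x) = block_diag k B x"
proof -
  obtain P where P: "S ** P ** S = S" "P ** S ** P = P" "transpose (S ** P) = S ** P" "transpose (P ** S) = P ** S"
    using exists_matrix_pseudoinverse[OF S] .
  obtain C where C: "H = S ** C" using exists_factor_of_column_span[OF H] .
  show ?thesis
  proof (rule that[of "P ** H"])
    show "S ** (P ** H) = H" unfolding C using P(1) by (simp add: matrix_mul_assoc)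
    show "pseudoinverse k (block_diag k S) (block_diag k H x) = block_diag k (P ** H) x" for k x
      using pseudoinverse_block_diag[OF P block_diag_in] by (simp add: block_diag_mult)
  qed
qed

section \<open>Laws determined by characteristic functions of linear functionals\<close>

text \<open>
  Levy's uniqueness theorem after normalising the total mass.
\<close>

lemma finite_measure_char_unique:
  fixes M1 M2 :: "real measure"
  assumes M1: "finite_measure M1" "sets M1 = sets borel" and M2: "finite_measure M2" "sets M2 = sets borel"
    and c: "\<And>t. (\<integral>x. cos (t * x) \<partial>M1) = (\<integral>x. cos (t * x) \<partial>M2)"
    and s: "\<And>t. (\<integral>x. sin (t * x) \<partial>M1) = (\<integral>x. sin (t * x) \<partial>M2)"
  shows "M1 = M2"
proof -
  interpret M1: finite_measure M1 by fact
  interpret M2: finite_measure M2 by fact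
  have sp: "space M1 = UNIV" "space M2 = UNIV"
    using M1(2) M2(2) by (auto dest: sets_eq_imp_space_eq)
  define m where "m = measure M1 UNIV"
  have m2: "measure M2 UNIV = m" using c[of 0] by (simp add: m_def sp)
  show ?thesis
  proof (cases "m = 0")
    case True
    have "emeasure M1 A = 0" "emeasure M2 A = 0" for A
      using True m2 M1.finite_measure_mono[of A UNIV] M2.finite_measure_mono[of A UNIV] M1(2) M2(2)
      by (auto simp: m_def M1.emeasure_eq_measure M2.emeasure_eq_measure measure_le_0_iff sp)
    then show ?thesis using M1(2) M2(2) by (intro measure_eqI) auto
  next
    case False
    then have m: "m > 0" by (simp add: m_def less_le)
    define N1 where "N1 = scale_measure (ennreal (1 / m)) M1"
    define N2 where "N2 = scale_measure (ennreal (1 / m)) M2"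
    have N: "real_distribution N1" "real_distribution N2"
      using m m2 by (auto intro!: real_distribution.intro prob_spaceI
          simp: space_scale_measure N1_def N2_def real_distribution_axioms_def M1 M2 sp m_def
            M1.emeasure_eq_measure M2.emeasure_eq_measure ennreal_mult[symmetric])
    have char: "char (scale_measure (ennreal (1 / m)) M) t = complex_of_real (1 / m) * (CLINT x|M. iexp (t * x))"
      if "sets M = sets borel" for M :: "real measure" and t
    proof -
      have "scale_measure (ennreal (1 / m)) M = density M (\<lambda>_. ennreal (1 / m))"
        by (rule measure_eqI) (auto simp: emeasure_density nn_integral_cmult_indicator)
      moreover have "(\<lambda>x. iexp (t * x)) \<in> borel_measurable M"
        by (subst measurable_cong_sets[OF that refl]) measurable
      ultimately show ?thesis
        using m by (simp add: char_def integral_density scaleR_conv_of_real)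
    qed
    have iexp: "(CLINT x|M. iexp (t * x)) = Complex (\<integral>x. cos (t * x) \<partial>M) (\<integral>x. sin (t * x) \<partial>M)"
      if "sets M = sets borel" "finite_measure M" for M :: "real measure" and t
    proof -
      interpret finite_measure M by fact
      have "integrable M (\<lambda>x. iexp (t * x))"
        by (rule integrable_const_bound[of _ 1]) (auto simp: measurable_cong_sets[OF that(1) refl])
      then show ?thesis
        by (intro complex_eqI) (simp_all flip: integral_Re integral_Im add: Re_exp Im_exp)
    qed
    have "char N1 = char N2"
      unfolding N1_def N2_def using char[OF M1(2)] char[OF M2(2)] iexp[OF M1(2,1)] iexp[OF M2(2,1)] c s
      by (auto intro!: ext)
    then have "N1 = N2" by (rule Levy_uniqueness[OF N])
    then have "emeasure N1 A = emeasure N2 A" for A by simp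
    then have "ennreal (1 / m) * emeasure M1 A = ennreal (1 / m) * emeasure M2 A" for A
      by (simp add: N1_def N2_def)
    then have "emeasure M1 A = emeasure M2 A" for A
      using m by (simp add: ennreal_mult_cancel_left)
    then show ?thesis using M1(2) M2(2) by (intro measure_eqI) auto
  qed
qed

text \<open>
  Applies one-dimensional uniqueness to the law of \<open>X\<close> under the measure with density \<open>g\<close>.
\<close>

lemma weighted_char_unique:
  fixes X g :: "'a \<Rightarrow> real"
  assumes P: "finite_measure P" and Q: "finite_measure Q" and sets: "sets P = sets Q"
    and X[measurable]: "X \<in> borel_measurable P" and g[measurable]: "g \<in> borel_measurable P"
    and g0: "\<And>x. 0 \<le> g x" and g2: "\<And>x. g x \<le> 2"
    and c: "\<And>t. (\<integral>x. cos (t * X x) * g x \<partial>P) = (\<integral>x. cos (t * X x) * g x \<partial>Q)"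
    and s: "\<And>t. (\<integral>x. sin (t * X x) * g x \<partial>P) = (\<integral>x. sin (t * X x) * g x \<partial>Q)"
    and A[measurable]: "A \<in> sets borel"
  shows "(\<integral>x. indicator A (X x) * g x \<partial>P) = (\<integral>x. indicator A (X x) * g x \<partial>Q)"
proof -
  interpret P: finite_measure P by fact
  interpret Q: finite_measure Q by fact
  have [measurable]: "X \<in> borel_measurable Q" "g \<in> borel_measurable Q"
    using X g by (simp_all add: measurable_cong_sets[OF sets refl])
  let ?D = "\<lambda>R. distr (density R g) borel X"
  have fin: "finite_measure (density R g)" if "finite_measure R" "g \<in> borel_measurable R" for R
  proof -
    interpret finite_measure R by fact
    have "(\<integral>\<^sup>+x. ennreal (g x) \<partial>R) \<le> (\<integral>\<^sup>+x. ennreal 2 \<partial>R)" by (intro nn_integral_mono ennreal_leI g2)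
    also have "\<dots> < \<infinity>" by (simp add: emeasure_eq_measure ennreal_mult_less_top)
    finally show ?thesis using that(2) by (intro finite_measureI) (auto simp: emeasure_density cong: nn_integral_cong_simp)
  qed
  have int: "(\<integral>x. f x \<partial>?D P) = (\<integral>x. f (X x) * g x \<partial>P)" "(\<integral>x. f x \<partial>?D Q) = (\<integral>x. f (X x) * g x \<partial>Q)"
    if [measurable]: "f \<in> borel_measurable borel" for f :: "real \<Rightarrow> real"
    using g0 by (simp_all add: integral_distr integral_density mult.commute)
  have "?D P = ?D Q"
  proof (rule finite_measure_char_unique)
    show "finite_measure (?D P)" by (rule finite_measure.finite_measure_distr[OF fin[OF P]]) auto
    show "finite_measure (?D Q)" by (rule finite_measure.finite_measure_distr[OF fin[OF Q]]) auto
  qed (use c s in \<open>auto simp: int\<close>)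
  then show ?thesis using int[of "indicator A"] by simp
qed

definition same_trig :: "'a measure \<Rightarrow> 'a measure \<Rightarrow> ('a \<Rightarrow> real) \<Rightarrow> bool" where
  "same_trig P Q L \<longleftrightarrow> (\<integral>x. cos (L x) \<partial>P) = (\<integral>x. cos (L x) \<partial>Q) \<and> (\<integral>x. sin (L x) \<partial>P) = (\<integral>x. sin (L x) \<partial>Q)"

text \<open>
  The Cramer-Wold device, by induction on the number of coordinates. For fixed frequencies of the other
  coordinates, the nonnegative weights \<open>1 + cos L\<close> and \<open>1 + sin L\<close> have trigonometric integrals
  determined by those of linear functionals, through the product-to-sum formulas. One-dimensional uniqueness determines the law of \<open>X i\<close> under
  these weights. Hence restricting both measures to \<open>X i \<in> A i\<close> preserves the hypothesis for the remaining
  coordinates.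
\<close>

lemma rectangle_prob_unique:
  fixes X :: "'i \<Rightarrow> 'a \<Rightarrow> real"
  assumes "finite J" "finite_measure P" "finite_measure Q" "sets P = sets Q"
    and "\<And>j. j \<in> J \<Longrightarrow> X j \<in> borel_measurable P"
    and "\<And>h. same_trig P Q (\<lambda>x. \<Sum>j\<in>J. h j * X j x)"
    and "\<And>j. j \<in> J \<Longrightarrow> A j \<in> sets borel"
  shows "measure P {x\<in>space P. \<forall>j\<in>J. X j x \<in> A j} = measure Q {x\<in>space Q. \<forall>j\<in>J. X j x \<in> A j}"
  using assms
proof (induction J arbitrary: P Q rule: finite_induct)
  case empty
  then show ?case using empty.prems(5)[of "\<lambda>_. 0"]
    by (simp add: same_trig_def)
next
  case (insert i J)
  interpret P: finite_measure P by fact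
  interpret Q: finite_measure Q by fact
  note sets = insert.prems(3) and A = insert.prems(6)
  have sp: "space P = space Q" using sets by (rule sets_eq_imp_space_eq)
  have XQ: "j \<in> insert i J \<Longrightarrow> X j \<in> borel_measurable Q" for j
    using insert.prems(4) by (simp add: measurable_cong_sets[OF sets refl])
  have [measurable]: "X i \<in> borel_measurable P" "X i \<in> borel_measurable Q" "A i \<in> sets borel"
    using insert.prems(4) XQ A by auto
  let ?L = "\<lambda>h x. \<Sum>j\<in>J. h j * X j x"
  have [measurable]: "?L h \<in> borel_measurable P" "?L h \<in> borel_measurable Q" for h
    using insert.prems(4) XQ by (auto intro!: borel_measurable_sum)
  \<comment> \<open>The hypothesis with the frequency of \<open>X i\<close> singled out.\<close>
  have trig: "same_trig P Q (\<lambda>x. t * X i x + ?L h x)" for t h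
  proof -
    have "(\<Sum>j\<in>insert i J. (h(i := t)) j * X j x) = t * X i x + ?L h x" for x
      using insert.hyps by (auto intro!: sum.cong)
    then show ?thesis using insert.prems(5)[of "h(i := t)"] by simp
  qed
  have int: "integrable R f" if "finite_measure R" "f \<in> borel_measurable R" "\<And>x. \<bar>f x\<bar> \<le> 1" for f :: "'a \<Rightarrow> real" and R
    by (rule finite_measure.integrable_const_bound[of _ _ 1]) (use that in auto)
  have lin: "(\<integral>x. u x + f x \<partial>P) = (\<integral>x. u x + f x \<partial>Q)" "(\<integral>x. u x - f x \<partial>P) = (\<integral>x. u x - f x \<partial>Q)"
    if "(\<integral>x. u x \<partial>P) = (\<integral>x. u x \<partial>Q)" "(\<integral>x. f x \<partial>P) = (\<integral>x. f x \<partial>Q)"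
      "u \<in> borel_measurable P" "f \<in> borel_measurable P" "\<And>x. \<bar>u x\<bar> \<le> 1" "\<And>x. \<bar>f x\<bar> \<le> 1" for u f :: "'a \<Rightarrow> real"
  proof -
    have Q': "u \<in> borel_measurable Q" "f \<in> borel_measurable Q"
      using that(3,4) by (simp_all only: measurable_cong_sets[OF sets refl])
    have i: "integrable P u" "integrable P f" "integrable Q u" "integrable Q f"
      by (rule int[OF P.finite_measure_axioms], rule that, rule that)+
         (rule int[OF Q.finite_measure_axioms], rule Q', rule that)+
    show "(\<integral>x. u x + f x \<partial>P) = (\<integral>x. u x + f x \<partial>Q)" "(\<integral>x. u x - f x \<partial>P) = (\<integral>x. u x - f x \<partial>Q)"
      using that(1,2) by (simp_all add: i)
  qed
  have prod: "(\<integral>x. a (t * X i x) * b (?L h x) \<partial>P) = (\<integral>x. a (t * X i x) * b (?L h x) \<partial>Q)"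
    if "(a = cos \<or> a = sin)" "(b = cos \<or> b = sin)" for a b :: "real \<Rightarrow> real" and t h
  proof -
    have neg: "?L (\<lambda>j. - h j) x = - ?L h x" for x by (simp add: sum_negf)
    have 1: "same_trig P Q (\<lambda>x. t * X i x + ?L h x)" by (rule trig)
    have 2: "same_trig P Q (\<lambda>x. t * X i x - ?L h x)" using trig[of t "\<lambda>j. - h j"] unfolding neg by simp
    have [measurable]: "(\<lambda>x. t * X i x + ?L h x) \<in> borel_measurable P" "(\<lambda>x. t * X i x - ?L h x) \<in> borel_measurable P"
      "(\<lambda>x. t * X i x + ?L h x) \<in> borel_measurable Q" "(\<lambda>x. t * X i x - ?L h x) \<in> borel_measurable Q" by measurable
    have half: "(\<integral>x. (p x + q x) / 2 \<partial>P) = (\<integral>x. (p x + q x) / 2 \<partial>Q)"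
      "(\<integral>x. (p x - q x) / 2 \<partial>P) = (\<integral>x. (p x - q x) / 2 \<partial>Q)"
      if "(\<integral>x. p x \<partial>P) = (\<integral>x. p x \<partial>Q)" "(\<integral>x. q x \<partial>P) = (\<integral>x. q x \<partial>Q)"
        "p \<in> borel_measurable P" "q \<in> borel_measurable P" "\<And>x. \<bar>p x\<bar> \<le> 1" "\<And>x. \<bar>q x\<bar> \<le> 1" for p q :: "'a \<Rightarrow> real"
      by (simp_all add: lin[OF that])
    note p = 1[unfolded same_trig_def] and q = 2[unfolded same_trig_def]
    have "(\<integral>x. cos (t * X i x) * cos (?L h x) \<partial>P) = (\<integral>x. cos (t * X i x) * cos (?L h x) \<partial>Q)"
      unfolding cos_times_cos by (rule half(1)[OF q[THEN conjunct1] p[THEN conjunct1]]) simp_all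
    moreover have "(\<integral>x. sin (t * X i x) * sin (?L h x) \<partial>P) = (\<integral>x. sin (t * X i x) * sin (?L h x) \<partial>Q)"
      unfolding sin_times_sin by (rule half(2)[OF q[THEN conjunct1] p[THEN conjunct1]]) simp_all
    moreover have "(\<integral>x. cos (t * X i x) * sin (?L h x) \<partial>P) = (\<integral>x. cos (t * X i x) * sin (?L h x) \<partial>Q)"
      unfolding cos_times_sin by (rule half(2)[OF p[THEN conjunct2] q[THEN conjunct2]]) simp_all
    moreover have "(\<integral>x. sin (t * X i x) * cos (?L h x) \<partial>P) = (\<integral>x. sin (t * X i x) * cos (?L h x) \<partial>Q)"
      unfolding sin_times_cos by (rule half(1)[OF p[THEN conjunct2] q[THEN conjunct2]]) simp_all
    ultimately show ?thesis using that by auto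
  qed
  \<comment> \<open>The constant 1 makes the weight nonnegative; it is subtracted again below, since \<open>h = 0\<close> gives the weight 2.\<close>
  have weighted: "(\<integral>x. indicator (A i) (X i x) * (1 + b (?L h x)) \<partial>P) = (\<integral>x. indicator (A i) (X i x) * (1 + b (?L h x)) \<partial>Q)"
    if b: "b = cos \<or> b = sin" for b :: "real \<Rightarrow> real" and h
  proof -
    have bm[measurable]: "b \<in> borel_measurable borel" using b by auto
    have bb: "\<bar>b x\<bar> \<le> 1" for x using b by auto
    have b0: "0 \<le> 1 + b x" "1 + b x \<le> 2" for x using bb[of x] by linarith+
    have "(\<integral>x. a (t * X i x) * (1 + b (?L h x)) \<partial>P) = (\<integral>x. a (t * X i x) * (1 + b (?L h x)) \<partial>Q)"
      if a: "a = cos \<or> a = sin" for a :: "real \<Rightarrow> real" and t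
    proof -
      have am[measurable]: "a \<in> borel_measurable borel" using a by auto
      have ab: "\<bar>a x\<bar> \<le> 1" for x using a by auto
      have "(\<integral>x. a (t * X i x) \<partial>P) = (\<integral>x. a (t * X i x) \<partial>Q)"
        using prod[OF a, of cos t "\<lambda>_. 0"] by simp
      then show ?thesis unfolding distrib_left mult_1_right
        by (rule lin(1)[OF _ prod[OF a b]]) (use ab bb in \<open>auto simp: abs_mult intro!: mult_le_one\<close>)
    qed
    then show ?thesis
      using b0 by (intro weighted_char_unique[OF P.finite_measure_axioms Q.finite_measure_axioms sets])
        auto
  qed
  have ind: "(\<integral>x. indicator (A i) (X i x) \<partial>P) = (\<integral>x. indicator (A i) (X i x) \<partial>Q :: real)"
    using weighted[of cos "\<lambda>_. 0"] by simp
  let ?R = "\<lambda>R. density R (\<lambda>x. indicator (A i) (X i x))"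
  have trig_R: "same_trig (?R P) (?R Q) (?L h)" for h
  proof -
    have *: "(\<integral>x. b (?L h x) \<partial>?R P) = (\<integral>x. b (?L h x) \<partial>?R Q)" if b: "b = cos \<or> b = sin" for b :: "real \<Rightarrow> real"
    proof -
      have bm[measurable]: "b \<in> borel_measurable borel" using b by auto
      have bb: "\<bar>b x\<bar> \<le> 1" for x using b by auto
      have i1: "integrable R (\<lambda>x. indicator (A i) (X i x) :: real)" "integrable R (\<lambda>x. indicator (A i) (X i x) * b (?L h x))"
        if "finite_measure R" "sets R = sets P" for R
      proof -
        have [measurable]: "X i \<in> borel_measurable R" "?L h \<in> borel_measurable R"
          by (simp_all add: measurable_cong_sets[OF that(2) refl])
        show "integrable R (\<lambda>x. indicator (A i) (X i x) :: real)" "integrable R (\<lambda>x. indicator (A i) (X i x) * b (?L h x))"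
          using bb by (auto intro!: int[OF that(1)] simp: abs_mult indicator_def)
      qed
      have "(\<integral>x. indicator (A i) (X i x) * b (?L h x) \<partial>P) = (\<integral>x. indicator (A i) (X i x) * b (?L h x) \<partial>Q)"
        using weighted[OF b, of h] ind i1[OF P.finite_measure_axioms] i1[OF Q.finite_measure_axioms] sets
        by (simp add: distrib_left)
      then show ?thesis
        using integral_density[of "\<lambda>x. b (?L h x)" P "\<lambda>x. indicator (A i) (X i x)"]
          integral_density[of "\<lambda>x. b (?L h x)" Q "\<lambda>x. indicator (A i) (X i x)"]
        by (simp add: ennreal_indicator)
    qed
    show ?thesis unfolding same_trig_def using *[of cos] *[of sin] by auto
  qed
  have fin: "finite_measure (?R R)" if "finite_measure R" "sets R = sets P" for R
  proof -
    interpret finite_measure R by fact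
    have [measurable]: "X i \<in> borel_measurable R" by (simp add: measurable_cong_sets[OF that(2) refl])
    have "(\<integral>\<^sup>+x. indicator (A i) (X i x) \<partial>R) \<le> (\<integral>\<^sup>+x. 1 \<partial>R)" by (intro nn_integral_mono) (auto simp: indicator_def)
    also have "\<dots> < \<infinity>" by (simp add: emeasure_eq_measure)
    finally show ?thesis by (intro finite_measureI) (auto simp: emeasure_density cong: nn_integral_cong_simp)
  qed
  have m: "measure (?R R) {x\<in>space (?R R). \<forall>j\<in>J. X j x \<in> A j} = measure R {x\<in>space R. \<forall>j\<in>insert i J. X j x \<in> A j}"
    if "sets R = sets P" for R
  proof -
    have Xj: "\<And>j. j \<in> insert i J \<Longrightarrow> X j \<in> borel_measurable R"
      using insert.prems(4) by (simp add: measurable_cong_sets[OF that refl])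
    have [measurable]: "X i \<in> borel_measurable R" using Xj by simp
    have S: "{x\<in>space R. X j x \<in> A j} \<in> sets R" if "j \<in> insert i J" for j
      using measurable_sets[OF Xj[OF that] A[OF that]] by (simp add: vimage_def Int_def conj_commute)
    have B: "{x\<in>space R. \<forall>j\<in>J. X j x \<in> A j} \<in> sets R"
      by (rule sets.sets_Collect_finite_All) (use S insert.hyps in auto)
    have C: "{x\<in>space R. \<forall>j\<in>insert i J. X j x \<in> A j} \<in> sets R"
      by (rule sets.sets_Collect_finite_All) (use S insert.hyps in auto)
    have "emeasure (?R R) {x\<in>space R. \<forall>j\<in>J. X j x \<in> A j}
        = (\<integral>\<^sup>+x. indicator (A i) (X i x) * indicator {x\<in>space R. \<forall>j\<in>J. X j x \<in> A j} x \<partial>R)"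
      by (rule emeasure_density[OF _ B]) measurable
    also have "\<dots> = (\<integral>\<^sup>+x. indicator {x\<in>space R. \<forall>j\<in>insert i J. X j x \<in> A j} x \<partial>R)"
      by (rule nn_integral_cong) (auto simp: indicator_def)
    also have "\<dots> = emeasure R {x\<in>space R. \<forall>j\<in>insert i J. X j x \<in> A j}"
      by (rule nn_integral_indicator[OF C])
    finally have "emeasure (?R R) {x\<in>space R. \<forall>j\<in>J. X j x \<in> A j}
        = emeasure R {x\<in>space R. \<forall>j\<in>insert i J. X j x \<in> A j}" .
    then show ?thesis by (simp add: measure_def)
  qed
  have "measure (?R P) {x\<in>space (?R P). \<forall>j\<in>J. X j x \<in> A j} = measure (?R Q) {x\<in>space (?R Q). \<forall>j\<in>J. X j x \<in> A j}"
    by (rule insert.IH) (use fin trig_R P.finite_measure_axioms Q.finite_measure_axioms sets A insert.prems(4) in auto)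
  then show ?case using m sets by simp
qed

section \<open>Independence of the Gaussian blocks\<close>

lemma measurable_vec_lambda:
  fixes f :: "'d::finite \<Rightarrow> 'a \<Rightarrow> real"
  assumes "\<And>i. f i \<in> borel_measurable M"
  shows "(\<lambda>x. \<chi> i. f i x) \<in> borel_measurable M"
proof -
  have "(\<chi> i. f i x) = (\<Sum>i\<in>UNIV. f i x *\<^sub>R axis i 1)" for x
    by (simp add: vec_eq_iff axis_def if_distrib cong: if_cong)
  then show ?thesis using assms by simp
qed

lemma std_normal_moments:
  "(\<integral>z. z \<partial>std_normal_distribution) = 0" "(\<integral>z. z\<^sup>2 \<partial>std_normal_distribution) = 1"
  "integrable std_normal_distribution (\<lambda>z. \<bar>z\<bar> ^ k)"
  using integral_std_normal_moment_odd[of 0] integral_std_normal_moment_even[of 1] integrable_std_normal_moment_abs[of k]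
  by (simp_all add: integral_density integrable_density)

lemma char_centered_normal:
  assumes "0 \<le> v"
  shows "(CLINT y|centered_normal v. iexp y) = complex_of_real (exp (- v / 2))"
proof -
  have "(CLINT y|centered_normal v. iexp y) = (CLINT z|std_normal_distribution. iexp (sqrt v * z))"
    unfolding centered_normal_def by (subst integral_distr) auto
  also have "\<dots> = char std_normal_distribution (sqrt v)" by (simp add: char_def)
  also have "\<dots> = complex_of_real (exp (- v / 2))" using assms by (simp add: char_std_normal_distribution)
  finally show ?thesis .
qed

lemma same_trig_iexp:
  assumes "prob_space P" "prob_space Q" "L \<in> borel_measurable P" "L \<in> borel_measurable Q"
    and "(CLINT x|P. iexp (L x)) = (CLINT x|Q. iexp (L x))"
  shows "same_trig P Q L"
proof -
  have *: "(\<integral>x. cos (L x) \<partial>R) = Re (CLINT x|R. iexp (L x))" "(\<integral>x. sin (L x) \<partial>R) = Im (CLINT x|R. iexp (L x))"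
    if "prob_space R" "L \<in> borel_measurable R" for R
  proof -
    interpret prob_space R by fact
    have "integrable R (\<lambda>x. iexp (L x))"
      by (rule integrable_const_bound[of _ 1]) (use that in auto)
    then show "(\<integral>x. cos (L x) \<partial>R) = Re (CLINT x|R. iexp (L x))" "(\<integral>x. sin (L x) \<partial>R) = Im (CLINT x|R. iexp (L x))"
      by (simp_all flip: integral_Re integral_Im add: Re_exp Im_exp)
  qed
  show ?thesis unfolding same_trig_def *[OF assms(1,3)] *[OF assms(2,4)] assms(5) by simp
qed

locale gaussian_blocks =
  fixes k :: nat and S :: "real ^ 'd ^ 'd" and N :: "(nat \<Rightarrow> real ^ 'd) measure"
  assumes gaussian: "centered_gaussian k (block_diag k S) N"
    and symmetric: "transpose S = S"
    and nonneg: "\<And>u. 0 \<le> (S *v u) \<bullet> u"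
begin

text \<open>
  A point mass beyond the last block, so that all marginals are probability measures.
\<close>

definition marginal :: "nat \<Rightarrow> (real ^ 'd) measure" where
  "marginal m = (if m < k then distr N borel (\<lambda>x. x m) else return borel 0)"

lemma prob_N: "prob_space N" and sets_N: "sets N = sets (\<Pi>\<^sub>M m\<in>{..<k}. borel)"
  using gaussian by (auto simp: centered_gaussian_def)

lemma measurable_component_N: "m < k \<Longrightarrow> (\<lambda>x. x m) \<in> borel_measurable N"
  by (simp add: measurable_cong_sets[OF sets_N refl])

lemma prob_marginal: "prob_space (marginal m)"
  unfolding marginal_def using prob_space.prob_space_distr[OF prob_N measurable_component_N]
  by (auto intro!: prob_space_return)

lemma sets_marginal: "sets (marginal m) = sets borel"
  by (simp add: marginal_def)

lemma distr_functional:
  assumes "h \<in> direct_sum k"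
  shows "distr N borel (\<lambda>x. dsum_inner k x h) = centered_normal (dsum_inner k (block_diag k S h) h)"
  using gaussian assms by (simp add: centered_gaussian_def)

lemma dsum_inner_measurable: "(\<lambda>x. dsum_inner k x h) \<in> borel_measurable N"
  unfolding dsum_inner_def using measurable_component_N by (auto intro!: borel_measurable_sum borel_measurable_inner)

lemma char_functional:
  assumes h: "h \<in> direct_sum k"
  shows "(CLINT x|N. iexp (dsum_inner k x h)) = complex_of_real (exp (- (\<Sum>m<k. (S *v h m) \<bullet> h m) / 2))"
proof -
  have v: "dsum_inner k (block_diag k S h) h = (\<Sum>m<k. (S *v h m) \<bullet> h m)"
    by (simp add: dsum_inner_def block_diag_def)
  have "(CLINT x|N. iexp (dsum_inner k x h)) = (CLINT y|distr N borel (\<lambda>x. dsum_inner k x h). iexp y)"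
    by (rule integral_distr[symmetric]) (auto intro: dsum_inner_measurable)
  also have "\<dots> = complex_of_real (exp (- (\<Sum>m<k. (S *v h m) \<bullet> h m) / 2))"
    unfolding distr_functional[OF h] v by (rule char_centered_normal) (intro sum_nonneg nonneg)
  finally show ?thesis .
qed

lemma distr_marginal_inner:
  assumes m: "m < k"
  shows "distr (marginal m) borel (\<lambda>y. y \<bullet> u) = centered_normal ((S *v u) \<bullet> u)"
proof -
  let ?h = "\<lambda>l. if l = m then u else 0"
  have h: "?h \<in> direct_sum k" using m by (simp add: direct_sum_def)
  have single: "(\<Sum>l<k. f l (if l = m then u else 0)) = f m u" if "\<And>l. f l 0 = 0" for f :: "nat \<Rightarrow> real ^ 'd \<Rightarrow> real"
  proof -
    have "(\<Sum>l<k. f l (if l = m then u else 0)) = (\<Sum>l<k. if l = m then f l u else 0)"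
      by (rule sum.cong) (auto simp: that)
    then show ?thesis using m by simp
  qed
  have 1: "dsum_inner k x ?h = x m \<bullet> u" for x
    unfolding dsum_inner_def using single[of "\<lambda>l y. x l \<bullet> y"] by simp
  have 2: "dsum_inner k (block_diag k S ?h) ?h = (S *v u) \<bullet> u"
  proof -
    have "dsum_inner k (block_diag k S ?h) ?h = (\<Sum>l<k. (S *v ?h l) \<bullet> ?h l)"
      unfolding dsum_inner_def block_diag_def by simp
    then show ?thesis using single[of "\<lambda>l y. (S *v y) \<bullet> y"] by simp
  qed
  have "distr (marginal m) borel (\<lambda>y. y \<bullet> u) = distr N borel (\<lambda>x. x m \<bullet> u)"
    unfolding marginal_def using m measurable_component_N by (simp add: distr_distr comp_def)
  then show ?thesis using distr_functional[OF h] unfolding 2 unfolding 1 by simp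
qed

lemma char_marginal:
  assumes m: "m < k"
  shows "(CLINT y|marginal m. iexp (y \<bullet> u)) = complex_of_real (exp (- ((S *v u) \<bullet> u) / 2))"
proof -
  have "(CLINT y|marginal m. iexp (y \<bullet> u)) = (CLINT t|distr (marginal m) borel (\<lambda>y. y \<bullet> u). iexp t)"
    by (rule integral_distr[symmetric]) (auto simp: measurable_cong_sets[OF sets_marginal refl])
  then show ?thesis unfolding distr_marginal_inner[OF m] by (simp add: char_centered_normal nonneg)
qed

text \<open>
  A linear functional has the same Gaussian characteristic function under \<open>N\<close> and under the product
  of the marginals, because the covariance operator is block diagonal. Coordinates \<open>(m, i)\<close> identify the direct sum with
  a finite power of the reals, where rectangles determine the law.
\<close>

lemma eq_prod_marginals: "N = (\<Pi>\<^sub>M m\<in>{..<k}. marginal m)"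
proof -
  let ?PN = "\<Pi>\<^sub>M m\<in>{..<k}. (borel :: (real ^ 'd) measure)"
  let ?Q = "\<Pi>\<^sub>M m\<in>{..<k}. marginal m"
  let ?J = "{..<k} \<times> (UNIV :: 'd set)"
  let ?PJ = "\<Pi>\<^sub>M j\<in>?J. (borel :: real measure)"
  let ?X = "\<lambda>(m, i) x. (x :: nat \<Rightarrow> real ^ 'd) m $ i"
  interpret Q: prob_space ?Q by (rule prob_space_PiM) (rule prob_marginal)
  interpret N: prob_space N by (rule prob_N)
  interpret prod: product_sigma_finite marginal
    by (simp add: product_sigma_finite_def prob_space_imp_sigma_finite prob_marginal)
  have sets_Q: "sets ?Q = sets ?PN" by (rule sets_PiM_cong) (auto simp: sets_marginal)
  have sp: "space N = space ?PN" "space ?Q = space ?PN"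
    using sets_N sets_Q by (auto dest: sets_eq_imp_space_eq)
  have X: "?X j \<in> borel_measurable ?PN" if "j \<in> ?J" for j
  proof (cases j)
    case (Pair m i)
    then have "(\<lambda>x. x m) \<in> borel_measurable ?PN" using that by auto
    from borel_measurable_inner[OF this borel_measurable_const[of "axis i 1"]] show ?thesis
      unfolding Pair by (simp add: inner_axis)
  qed
  have trig: "same_trig N ?Q (\<lambda>x. \<Sum>j\<in>?J. h j * ?X j x)" for h :: "nat \<times> 'd \<Rightarrow> real"
  proof (rule same_trig_iexp[OF prob_N Q.prob_space_axioms])
    define u where "u m = (if m < k then (\<chi> i. h (m, i)) else 0)" for m
    have u: "u \<in> direct_sum k" by (simp add: u_def direct_sum_def)
    have L: "(\<Sum>j\<in>?J. h j * ?X j x) = dsum_inner k x u" for x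
    proof -
      have "(\<Sum>j\<in>?J. h j * ?X j x) = (\<Sum>m<k. \<Sum>i\<in>UNIV. h (m, i) * x m $ i)"
        by (simp add: sum.cartesian_product case_prod_beta)
      also have "\<dots> = dsum_inner k x u"
        unfolding dsum_inner_def by (intro sum.cong) (auto simp: u_def inner_vec_def mult.commute)
      finally show ?thesis .
    qed
    have M: "(\<lambda>x. \<Sum>j\<in>?J. h j * ?X j x) \<in> borel_measurable ?PN"
      using X by (intro borel_measurable_sum borel_measurable_times) auto
    show "(\<lambda>x. \<Sum>j\<in>?J. h j * ?X j x) \<in> borel_measurable N" "(\<lambda>x. \<Sum>j\<in>?J. h j * ?X j x) \<in> borel_measurable ?Q"
      using M by (simp_all only: measurable_cong_sets[OF sets_N refl] measurable_cong_sets[OF sets_Q refl])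
    have "(CLINT x|?Q. iexp (dsum_inner k x u)) = (CLINT x|?Q. (\<Prod>m<k. iexp (x m \<bullet> u m)))"
      by (simp add: dsum_inner_def exp_sum sum_distrib_left)
    also have "\<dots> = (\<Prod>m<k. (CLINT y|marginal m. iexp (y \<bullet> u m)))"
    proof (rule prod.product_integral_prod)
      fix m
      interpret m: prob_space "marginal m" by (rule prob_marginal)
      show "integrable (marginal m) (\<lambda>y. iexp (y \<bullet> u m))"
        by (rule m.integrable_const_bound[of _ 1]) (auto simp: measurable_cong_sets[OF sets_marginal refl])
    qed simp
    also have "\<dots> = (\<Prod>m<k. complex_of_real (exp (- ((S *v u m) \<bullet> u m) / 2)))"
      by (intro prod.cong) (auto simp: char_marginal)
    also have "\<dots> = complex_of_real (exp (- (\<Sum>m<k. (S *v u m) \<bullet> u m) / 2))"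
      by (simp add: exp_sum[symmetric] sum_negf sum_divide_distrib flip: of_real_prod)
    finally show "(CLINT x|N. iexp (\<Sum>j\<in>?J. h j * ?X j x)) = (CLINT x|?Q. iexp (\<Sum>j\<in>?J. h j * ?X j x))"
      unfolding L char_functional[OF u] by simp
  qed
  \<comment> \<open>The coordinate map and its inverse on the space of \<open>N\<close>.\<close>
  define \<psi> where "\<psi> x = (\<lambda>j\<in>?J. ?X j x)" for x :: "nat \<Rightarrow> real ^ 'd"
  define \<phi> where "\<phi> y = (\<lambda>m\<in>{..<k}. \<chi> i. y (m, i))" for y :: "nat \<times> 'd \<Rightarrow> real"
  have \<psi>: "\<psi> \<in> measurable ?PN ?PJ" unfolding \<psi>_def using X by (rule measurable_restrict)
  have \<phi>: "\<phi> \<in> measurable ?PJ ?PN"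
    unfolding \<phi>_def by (rule measurable_restrict, rule measurable_vec_lambda) auto
  have inv: "\<phi> (\<psi> x) = x" if "x \<in> space ?PN" for x
  proof
    fix m show "\<phi> (\<psi> x) m = x m"
      using that by (cases "m < k") (auto simp: \<phi>_def \<psi>_def space_PiM PiE_iff extensional_def vec_eq_iff)
  qed
  have \<psi>': "\<psi> \<in> measurable N ?PJ" "\<psi> \<in> measurable ?Q ?PJ"
    using \<psi> by (simp_all only: measurable_cong_sets[OF sets_N refl] measurable_cong_sets[OF sets_Q refl])
  have eq: "distr N ?PJ \<psi> = distr ?Q ?PJ \<psi>"
  proof (rule measure_eqI_PiM_finite)
    fix A assume A: "\<And>j. j \<in> ?J \<Longrightarrow> A j \<in> sets (borel :: real measure)"
    have box: "Pi\<^sub>E ?J A \<in> sets ?PJ" using A by (intro sets_PiM_I_finite) auto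
    have vim: "\<psi> -` Pi\<^sub>E ?J A \<inter> space R = {x \<in> space R. \<forall>j\<in>?J. ?X j x \<in> A j}" for R
      by (auto simp: \<psi>_def PiE_iff)
    have "measure N {x \<in> space N. \<forall>j\<in>?J. ?X j x \<in> A j} = measure ?Q {x \<in> space ?Q. \<forall>j\<in>?J. ?X j x \<in> A j}"
    proof (rule rectangle_prob_unique[OF _ N.finite_measure_axioms Q.finite_measure_axioms _ _ trig A])
      show "finite ?J" by simp
      show "sets N = sets ?Q" by (simp only: sets_N sets_Q)
      show "?X j \<in> borel_measurable N" if "j \<in> ?J" for j
        using X[OF that] by (simp only: measurable_cong_sets[OF sets_N refl])
    qed
    then show "emeasure (distr N ?PJ \<psi>) (Pi\<^sub>E ?J A) = emeasure (distr ?Q ?PJ \<psi>) (Pi\<^sub>E ?J A)"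
      using box by (simp add: emeasure_distr \<psi>' vim N.emeasure_eq_measure Q.emeasure_eq_measure)
  next
    show "range (\<lambda>_::nat. space ?PJ) \<subseteq> prod_algebra ?J (\<lambda>_. borel)"
      by (auto simp: space_PiM intro!: prod_algebraI_finite)
    show "emeasure (distr N ?PJ \<psi>) (space ?PJ) \<noteq> \<infinity>"
      using prob_space.emeasure_space_1[OF N.prob_space_distr[OF \<psi>'(1)]] by simp
  qed auto
  have recover: "distr (distr R ?PJ \<psi>) ?PN \<phi> = R" if "sets R = sets ?PN" "\<psi> \<in> measurable R ?PJ" for R
  proof -
    have "distr (distr R ?PJ \<psi>) ?PN \<phi> = distr R ?PN (\<phi> \<circ> \<psi>)" by (rule distr_distr[OF \<phi> that(2)])
    also have "\<dots> = distr R ?PN (\<lambda>x. x)"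
      using inv sets_eq_imp_space_eq[OF that(1)] by (intro distr_cong) auto
    also have "\<dots> = R" using that(1) by (intro distr_id2) simp
    finally show ?thesis .
  qed
  have "N = distr (distr N ?PJ \<psi>) ?PN \<phi>" by (rule recover[OF sets_N \<psi>'(1), symmetric])
  also have "\<dots> = distr (distr ?Q ?PJ \<psi>) ?PN \<phi>" by (simp only: eq)
  also have "\<dots> = ?Q" by (rule recover[OF sets_Q \<psi>'(2)])
  finally show ?thesis .
qed

end

text \<open>
  Mixed moments by polarisation of \<open>E (\<zeta> \<bullet> u)\<^sup>2\<close>; the third moment from those of the
  coordinates. The constant depends on \<open>S\<close> only.
\<close>

lemma centered_law_of_normal_functionals:
  fixes S :: "real ^ 'd ^ 'd"
  assumes Q: "prob_space Q" "sets Q = sets borel" and S: "transpose S = S" "\<And>u. 0 \<le> (S *v u) \<bullet> u"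
    and law: "\<And>u. distr Q borel (\<lambda>y. y \<bullet> u) = centered_normal ((S *v u) \<bullet> u)" and \<delta>: "0 \<le> \<delta>"
  shows "centered_law S \<delta>
    (real CARD('d) ^ 3 * (\<Sum>i\<in>UNIV. sqrt (S $ i $ i) ^ 3 * (\<integral>z. \<bar>z\<bar> ^ 3 \<partial>std_normal_distribution))) Q"
proof -
  interpret prob_space Q by fact
  note [measurable_cong] = Q(2)
  have integral: "(\<integral>y. f (y \<bullet> u) \<partial>Q) = (\<integral>z. f (sqrt ((S *v u) \<bullet> u) * z) \<partial>std_normal_distribution)"
    and integrable: "integrable std_normal_distribution (\<lambda>z. f (sqrt ((S *v u) \<bullet> u) * z)) \<Longrightarrow> integrable Q (\<lambda>y. f (y \<bullet> u))"
    if [measurable]: "f \<in> borel_measurable borel" for f :: "real \<Rightarrow> real" and u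
  proof -
    have "(\<integral>y. f (y \<bullet> u) \<partial>Q) = (\<integral>t. f t \<partial>distr Q borel (\<lambda>y. y \<bullet> u))" by (subst integral_distr) auto
    then show "(\<integral>y. f (y \<bullet> u) \<partial>Q) = (\<integral>z. f (sqrt ((S *v u) \<bullet> u) * z) \<partial>std_normal_distribution)"
      unfolding law centered_normal_def by (subst (asm) integral_distr) auto
    assume "integrable std_normal_distribution (\<lambda>z. f (sqrt ((S *v u) \<bullet> u) * z))"
    then have "integrable (distr Q borel (\<lambda>y. y \<bullet> u)) f"
      unfolding law centered_normal_def by (subst integrable_distr_eq) auto
    then show "integrable Q (\<lambda>y. f (y \<bullet> u))" by (subst (asm) integrable_distr_eq) auto
  qed
  have mean: "(\<integral>y. y $ i \<partial>Q) = 0" for i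
    using integral[of "\<lambda>t. t" "axis i 1"] by (simp add: inner_axis std_normal_moments(1))
  have sq: "(\<integral>y. (y \<bullet> u)\<^sup>2 \<partial>Q) = (S *v u) \<bullet> u" for u
    using integral[of "\<lambda>t. t\<^sup>2" u] S(2)[of u] std_normal_moments(2) by (simp add: power_mult_distrib)
  have sq_int: "integrable Q (\<lambda>y. (y \<bullet> u)\<^sup>2)" for u
    by (rule integrable[of "\<lambda>t. t\<^sup>2"]) (use std_normal_moments(3)[of 2] in \<open>auto simp: power_mult_distrib\<close>)
  have S_axis: "(S *v axis i 1) \<bullet> axis j 1 = S $ j $ i" for i j
    by (simp add: matrix_vector_mult_basis column_def inner_axis)
  then have S_comp: "(S *v axis i 1) $ j = S $ j $ i" for i j by (simp add: inner_axis)
  have S_sym: "S $ i $ j = S $ j $ i" for i j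
    using arg_cong[OF S(1), of "\<lambda>A. A $ j $ i"] by (simp add: transpose_def)
  have cov: "(\<integral>y. y $ i * y $ j \<partial>Q) = S $ i $ j" for i j
  proof -
    have "y $ i * y $ j = ((y \<bullet> (axis i 1 + axis j 1))\<^sup>2 - (y \<bullet> axis i 1)\<^sup>2 - (y \<bullet> axis j 1)\<^sup>2) / 2" for y :: "real ^ 'd"
      by (simp add: inner_add_right inner_axis power2_eq_square algebra_simps)
    then have "(\<lambda>y. y $ i * y $ j) = (\<lambda>y :: real ^ 'd. ((y \<bullet> (axis i 1 + axis j 1))\<^sup>2 - (y \<bullet> axis i 1)\<^sup>2 - (y \<bullet> axis j 1)\<^sup>2) / 2)"
      by (rule ext)
    then have "(\<integral>y. y $ i * y $ j \<partial>Q) = (\<integral>y. ((y \<bullet> (axis i 1 + axis j 1))\<^sup>2 - (y \<bullet> axis i 1)\<^sup>2 - (y \<bullet> axis j 1)\<^sup>2) / 2 \<partial>Q)"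
      by (rule arg_cong)
    also have "\<dots> = ((S *v (axis i 1 + axis j 1)) \<bullet> (axis i 1 + axis j 1) - S $ i $ i - S $ j $ j) / 2"
      using sq_int by (simp add: sq S_axis)
    also have "\<dots> = S $ i $ j"
      using S_sym[of i j] by (simp add: matrix_vector_right_distrib inner_add_left inner_add_right S_axis)
    finally show ?thesis .
  qed
  let ?m3 = "\<integral>z. \<bar>z\<bar> ^ 3 \<partial>std_normal_distribution"
  have c3: "integrable Q (\<lambda>y. \<bar>y $ i\<bar> ^ 3)" "(\<integral>y. \<bar>y $ i\<bar> ^ 3 \<partial>Q) = sqrt (S $ i $ i) ^ 3 * ?m3" for i
    using integrable[of "\<lambda>t. \<bar>t\<bar> ^ 3" "axis i 1"] integral[of "\<lambda>t. \<bar>t\<bar> ^ 3" "axis i 1"] std_normal_moments(3)[of 3] S(2)[of "axis i 1"]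
    by (simp_all add: inner_axis S_comp abs_mult power_mult_distrib)
  have cube: "norm y ^ 3 \<le> real CARD('d) ^ 3 * (\<Sum>i\<in>UNIV. \<bar>y $ i\<bar> ^ 3)" for y :: "real ^ 'd"
  proof -
    define M where "M = Max (range (\<lambda>i. \<bar>y $ i\<bar>))"
    have M_ge: "\<bar>y $ i\<bar> \<le> M" for i unfolding M_def by (rule Max_ge) auto
    have "M \<in> range (\<lambda>i. \<bar>y $ i\<bar>)" unfolding M_def by (rule Max_in) auto
    then obtain i where i: "M = \<bar>y $ i\<bar>" by auto
    have "norm y \<le> (\<Sum>i\<in>UNIV. \<bar>y $ i\<bar>)" by (rule norm_le_l1_cart)
    also have "\<dots> \<le> (\<Sum>i\<in>(UNIV::'d set). M)" by (intro sum_mono M_ge)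
    finally have "norm y ^ 3 \<le> (real CARD('d) * M) ^ 3" by (intro power_mono) auto
    also have "\<dots> = real CARD('d) ^ 3 * \<bar>y $ i\<bar> ^ 3" by (simp add: i power_mult_distrib)
    also have "\<dots> \<le> real CARD('d) ^ 3 * (\<Sum>i\<in>UNIV. \<bar>y $ i\<bar> ^ 3)"
      by (intro mult_left_mono member_le_sum) auto
    finally show ?thesis .
  qed
  have dom: "integrable Q (\<lambda>y. real CARD('d) ^ 3 * (\<Sum>i\<in>UNIV. \<bar>y $ i\<bar> ^ 3))"
    by (intro integrable_mult_right Bochner_Integration.integrable_sum c3)
  have n3: "integrable Q (\<lambda>y. norm y ^ 3)"
    by (rule Bochner_Integration.integrable_bound[OF dom]) (use cube in \<open>auto simp: sum_nonneg intro: order.trans[OF cube]\<close>)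
  have "(\<integral>y. norm y ^ 3 \<partial>Q) \<le> (\<integral>y. real CARD('d) ^ 3 * (\<Sum>i\<in>UNIV. \<bar>y $ i\<bar> ^ 3) \<partial>Q)"
    by (rule integral_mono[OF n3 dom cube])
  also have "\<dots> = real CARD('d) ^ 3 * (\<Sum>i\<in>UNIV. sqrt (S $ i $ i) ^ 3 * ?m3)"
    using c3 by (simp add: Bochner_Integration.integral_sum)
  finally show ?thesis unfolding centered_law_def using Q mean cov n3 \<delta> by simp
qed

lemma (in gaussian_blocks) centered_law_marginal:
  assumes "m < k" "0 \<le> \<delta>"
  shows "centered_law S \<delta>
    (real CARD('d) ^ 3 * (\<Sum>i\<in>UNIV. sqrt (S $ i $ i) ^ 3 * (\<integral>z. \<bar>z\<bar> ^ 3 \<partial>std_normal_distribution))) (marginal m)"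
  by (rule centered_law_of_normal_functionals[OF prob_marginal sets_marginal symmetric nonneg distr_marginal_inner assms(2)])
     (rule assms)

section \<open>Exponential families near the origin\<close>

lemma borel_measurable_vec_component:
  fixes f :: "'w \<Rightarrow> real ^ 'd"
  assumes "f \<in> borel_measurable M"
  shows "(\<lambda>x. f x $ i) \<in> borel_measurable M"
  using borel_measurable_inner[OF assms borel_measurable_const[of "axis i 1"]] by (simp add: inner_axis)

lemma power_le_fact_exp: "x ^ n \<le> fact n * exp x" if "0 \<le> x" for x :: real
proof -
  obtain t where t: "exp x = (\<Sum>m<Suc n. x ^ m / fact m) + exp t / fact (Suc n) * x ^ Suc n"
    using Maclaurin_exp_le[of x "Suc n"] by auto
  have "0 \<le> (\<Sum>m<n. x ^ m / fact m)" using that by (intro sum_nonneg) auto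
  moreover have "0 \<le> exp t / fact (Suc n) * x ^ Suc n" using that by (intro mult_nonneg_nonneg) auto
  ultimately have "x ^ n / fact n \<le> exp x" unfolding t by simp
  then show ?thesis by (simp add: field_simps)
qed

lemma power_one_plus_le_exp:
  fixes \<delta> :: real assumes "0 < \<delta>"
  obtains C where "0 \<le> C" "\<And>x. 0 \<le> x \<Longrightarrow> (1 + x) ^ n \<le> C * exp (\<delta> * x)"
proof (rule that[of "fact n * exp \<delta> / \<delta> ^ n"])
  fix x :: real assume "0 \<le> x"
  then have "(\<delta> * (1 + x)) ^ n \<le> fact n * exp (\<delta> * (1 + x))" using assms by (intro power_le_fact_exp) auto
  moreover have "exp (\<delta> * (1 + x)) = exp \<delta> * exp (\<delta> * x)" by (simp add: distrib_left exp_add)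
  ultimately have "\<delta> ^ n * (1 + x) ^ n \<le> fact n * exp \<delta> * exp (\<delta> * x)"
    by (simp only: power_mult_distrib mult.assoc)
  then show "(1 + x) ^ n \<le> fact n * exp \<delta> / \<delta> ^ n * exp (\<delta> * x)"
    using assms by (simp add: pos_le_divide_eq mult.commute)
qed (use assms in auto)

text \<open>
  The largest coordinate dominates \<open>norm w / CARD('d)\<close>, and its exponential is one of the
  summands. So finiteness of the moment generating function near 0 gives exponential moments of the norm.
\<close>

lemma exp_norm_le_sum:
  fixes w :: "real ^ 'd"
  assumes "0 \<le> c"
  shows "exp (c * norm w) \<le> (\<Sum>i\<in>UNIV. \<Sum>s\<in>{-1, 1}. exp (w \<bullet> ((s * c * real CARD('d)) *\<^sub>R axis i 1)))"
proof -
  define M where "M = Max (range (\<lambda>i. \<bar>w $ i\<bar>))"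
  have M_ge: "\<bar>w $ i\<bar> \<le> M" for i unfolding M_def by (rule Max_ge) auto
  have "M \<in> range (\<lambda>i. \<bar>w $ i\<bar>)" unfolding M_def by (rule Max_in) auto
  then obtain i where i: "M = \<bar>w $ i\<bar>" by auto
  have "norm w \<le> (\<Sum>i\<in>UNIV. \<bar>w $ i\<bar>)" by (rule norm_le_l1_cart)
  also have "\<dots> \<le> (\<Sum>i\<in>(UNIV::'d set). M)" by (intro sum_mono M_ge)
  finally have "c * norm w \<le> c * (real CARD('d) * \<bar>w $ i\<bar>)" using assms by (intro mult_left_mono) (auto simp: i)
  then have "exp (c * norm w) \<le> exp (c * real CARD('d) * \<bar>w $ i\<bar>)" by (simp add: mult.assoc)
  also have "\<dots> \<le> (\<Sum>s\<in>{-1, 1}. exp (w \<bullet> ((s * c * real CARD('d)) *\<^sub>R axis i 1)))"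
    by (cases "w $ i \<ge> 0") (simp_all add: inner_axis mult_ac)
  also have "\<dots> \<le> (\<Sum>i\<in>UNIV. \<Sum>s\<in>{-1, 1}. exp (w \<bullet> ((s * c * real CARD('d)) *\<^sub>R axis i 1)))"
    by (rule member_le_sum[of i UNIV "\<lambda>i. \<Sum>s\<in>{-1, 1}. exp (w \<bullet> ((s * c * real CARD('d)) *\<^sub>R axis i 1))"]) auto
  finally show ?thesis .
qed

lemma exp_norm_integrable:
  fixes W :: "'w \<Rightarrow> real ^ 'd"
  assumes \<rho>: "0 < \<rho>" and [measurable]: "W \<in> borel_measurable M"
    and int: "\<And>u. norm u < \<rho> \<Longrightarrow> integrable M (\<lambda>x. exp (W x \<bullet> u))"
    and \<delta>: "0 \<le> \<delta>" "\<delta> * real CARD('d) < \<rho>"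
  shows "integrable M (\<lambda>x. exp (\<delta> * norm (W x)))"
proof -
  have "norm ((s * \<delta> * real CARD('d)) *\<^sub>R (axis i 1 :: real ^ 'd)) < \<rho>" if "s \<in> {-1, 1}" for s i
    using that \<delta> by (auto simp: abs_mult)
  then have "integrable M (\<lambda>x. \<Sum>i\<in>UNIV. \<Sum>s\<in>{-1, 1}. exp (W x \<bullet> ((s * \<delta> * real CARD('d)) *\<^sub>R axis i 1)))"
    by (intro Bochner_Integration.integrable_sum int) blast
  then show ?thesis
    by (rule Bochner_Integration.integrable_bound) (use exp_norm_le_sum[OF \<delta>(1)] in \<open>auto intro: order.trans[OF _ abs_ge_self]\<close>)
qed

lemma exp_norm_prod_integrable:
  fixes W Ws :: "'w \<Rightarrow> real ^ 'd"
  assumes \<rho>: "0 < \<rho>" and [measurable]: "W \<in> borel_measurable M" "Ws \<in> borel_measurable M"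
    and int: "\<And>v u. norm v < \<rho> \<Longrightarrow> norm u < \<rho> \<Longrightarrow> integrable M (\<lambda>x. exp (W x \<bullet> v + Ws x \<bullet> u))"
    and \<delta>: "0 \<le> \<delta>" "\<delta> * real CARD('d) < \<rho>"
  shows "integrable M (\<lambda>x. exp (\<delta> * norm (W x)) * exp (\<delta> * norm (Ws x)))"
proof -
  let ?v = "\<lambda>s i. (s * \<delta> * real CARD('d)) *\<^sub>R (axis i 1 :: real ^ 'd)"
  have v: "norm (?v s i) < \<rho>" if "s \<in> {-1, 1}" for s i
    using that \<delta> by (auto simp: abs_mult)
  have "integrable M (\<lambda>x. \<Sum>i\<in>UNIV. \<Sum>s\<in>{-1, 1}. \<Sum>j\<in>UNIV. \<Sum>t\<in>{-1, 1}. exp (W x \<bullet> ?v s i + Ws x \<bullet> ?v t j))"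
    using v by (intro Bochner_Integration.integrable_sum int) blast+
  moreover have "(\<Sum>i\<in>UNIV. \<Sum>s\<in>{-1, 1}. exp (W x \<bullet> ?v s i)) * (\<Sum>j\<in>UNIV. \<Sum>t\<in>{-1, 1}. exp (Ws x \<bullet> ?v t j))
      = (\<Sum>i\<in>UNIV. \<Sum>s\<in>{-1, 1}. \<Sum>j\<in>UNIV. \<Sum>t\<in>{-1, 1}. exp (W x \<bullet> ?v s i + Ws x \<bullet> ?v t j))" for x
    by (simp only: sum_distrib_right) (simp only: sum_distrib_left exp_add)
  ultimately have dom: "integrable M (\<lambda>x. (\<Sum>i\<in>UNIV. \<Sum>s\<in>{-1, 1}. exp (W x \<bullet> ?v s i)) * (\<Sum>j\<in>UNIV. \<Sum>t\<in>{-1, 1}. exp (Ws x \<bullet> ?v t j)))"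
    by simp
  have le: "exp (\<delta> * norm (W x)) * exp (\<delta> * norm (Ws x)) \<le> (\<Sum>i\<in>UNIV. \<Sum>s\<in>{-1, 1}. exp (W x \<bullet> ?v s i)) * (\<Sum>j\<in>UNIV. \<Sum>t\<in>{-1, 1}. exp (Ws x \<bullet> ?v t j))" for x
    by (intro mult_mono exp_norm_le_sum \<delta> order.trans[OF _ exp_norm_le_sum[OF \<delta>(1)]]) auto
  show ?thesis
  proof (rule Bochner_Integration.integrable_bound[OF dom _ AE_I2])
    fix x
    have "norm (exp (\<delta> * norm (W x)) * exp (\<delta> * norm (Ws x))) = exp (\<delta> * norm (W x)) * exp (\<delta> * norm (Ws x))" by simp
    also note le
    also note abs_ge_self
    finally show "norm (exp (\<delta> * norm (W x)) * exp (\<delta> * norm (Ws x)))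
       \<le> norm ((\<Sum>i\<in>UNIV. \<Sum>s\<in>{-1, 1}. exp (W x \<bullet> ?v s i)) * (\<Sum>j\<in>UNIV. \<Sum>t\<in>{-1, 1}. exp (Ws x \<bullet> ?v t j)))"
      unfolding real_norm_def .
  qed measurable
qed

text \<open>
  All Hessians in the comparison are nested one-dimensional derivatives of this form, and hence are
  covariances.
\<close>

lemma second_cumulant_derivative:
  fixes U V :: "'w \<Rightarrow> real"
  assumes M: "prob_space M" and \<delta>: "0 < \<delta>" and U[measurable]: "U \<in> borel_measurable M" and V[measurable]: "V \<in> borel_measurable M"
    and int: "integrable M (\<lambda>x. exp (\<delta> * \<bar>U x\<bar>) * exp (\<delta> * \<bar>V x\<bar>))"
  shows "deriv (\<lambda>h. deriv (\<lambda>h'. ln (\<integral>x. exp (h * U x + h' * V x) \<partial>M)) 0) 0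
    = (\<integral>x. U x * V x \<partial>M) - (\<integral>x. U x \<partial>M) * (\<integral>x. V x \<partial>M)"
proof -
  interpret prob_space M by fact
  obtain C where C: "0 \<le> C" "\<And>x. 0 \<le> x \<Longrightarrow> (1 + x) ^ 2 \<le> C * exp (\<delta> / 2 * x)"
    using power_one_plus_le_exp[of "\<delta> / 2" 2] \<delta> by auto
  have dom: "integrable M f" if [measurable]: "f \<in> borel_measurable M"
    and le: "\<And>x. \<bar>f x\<bar> \<le> (1 + \<bar>U x\<bar>)\<^sup>2 * exp (\<delta> / 2 * \<bar>U x\<bar>) * ((1 + \<bar>V x\<bar>)\<^sup>2 * exp (\<delta> / 2 * \<bar>V x\<bar>))" for f
  proof (rule Bochner_Integration.integrable_bound[OF integrable_mult_right[OF int, of "C * C"]])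
    have e: "(1 + y)\<^sup>2 * exp (\<delta> / 2 * y) \<le> C * exp (\<delta> * y)" if "0 \<le> y" for y
    proof -
      have "(1 + y)\<^sup>2 * exp (\<delta> / 2 * y) \<le> C * exp (\<delta> / 2 * y) * exp (\<delta> / 2 * y)"
        using C(2)[OF that] by (intro mult_right_mono) auto
      also have "\<dots> = C * exp (\<delta> * y)" by (simp flip: exp_add add: mult.assoc)
      finally show ?thesis .
    qed
    have "\<bar>f x\<bar> \<le> C * exp (\<delta> * \<bar>U x\<bar>) * (C * exp (\<delta> * \<bar>V x\<bar>))" for x
      using C(1) by (intro order.trans[OF le] mult_mono e) auto
    then show "AE x in M. norm (f x) \<le> norm (C * C * (exp (\<delta> * \<bar>U x\<bar>) * exp (\<delta> * \<bar>V x\<bar>)))"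
      using C(1) by (simp add: mult_ac)
  qed measurable
  have one: "1 \<le> (1 + \<bar>y\<bar>)\<^sup>2" "\<bar>y\<bar> \<le> (1 + \<bar>y\<bar>)\<^sup>2" "\<bar>y\<bar>\<^sup>2 \<le> (1 + \<bar>y\<bar>)\<^sup>2" for y :: real
    by (auto simp: power2_eq_square algebra_simps)
  have eU: "exp (h * U x) \<le> exp (\<delta> / 2 * \<bar>U x\<bar>)" if "\<bar>h\<bar> \<le> \<delta> / 2" for h x
    using mult_mono[OF that order.refl, of "\<bar>U x\<bar>"] abs_ge_self[of "h * U x"] \<delta> by (simp add: abs_mult)
  have e1: "1 \<le> exp (\<delta> / 2 * \<bar>y\<bar>)" for y using \<delta> by simp
  have prod_le: "a * b * (c * d) \<le> A * B * (C * D)"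
    if "0 \<le> a" "0 \<le> b" "0 \<le> c" "0 \<le> d" "a \<le> A" "b \<le> B" "c \<le> C" "d \<le> D" for a b c d A B C D :: real
    using that by (intro mult_mono mult_nonneg_nonneg) auto
  let ?Z = "\<lambda>h. \<integral>x. exp (h * U x) \<partial>M" and ?N = "\<lambda>h. \<integral>x. V x * exp (h * U x) \<partial>M"
  have inner: "deriv (\<lambda>h'. ln (\<integral>x. exp (h * U x + h' * V x) \<partial>M)) 0 = ?N h / ?Z h"
    if h: "\<bar>h\<bar> \<le> \<delta> / 2" for h
  proof -
    have i1: "integrable M (\<lambda>x. exp (h * U x))"
      by (rule dom) (use prod_le[of 1 "exp (h * U x)" 1 1 for x] eU[OF h] one e1 in \<open>auto\<close>)
    have i2: "integrable M (\<lambda>x. exp (h * U x) * V x)"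
      by (rule dom) (use prod_le[of 1 "exp (h * U x)" "\<bar>V x\<bar>" 1 for x] eU[OF h] one e1 in \<open>auto simp: abs_mult\<close>)
    have i3: "integrable M (\<lambda>x. exp (h * U x) * ((V x)\<^sup>2 * exp (\<delta> / 2 * \<bar>V x\<bar>)))"
      by (rule dom) (use prod_le[of 1 "exp (h * U x)" "\<bar>V x\<bar>\<^sup>2" "exp (\<delta> / 2 * \<bar>V x\<bar>)" for x] eU[OF h] one e1 in \<open>auto simp: abs_mult\<close>)
    have "((\<lambda>h'. \<integral>x. exp (h * U x) * exp (h' * V x) \<partial>M) has_real_derivative (\<integral>x. exp (h * U x) * V x \<partial>M)) (at 0)"
      by (rule DERIV_integral_exp[of "\<delta> / 2"]) (use \<delta> i1 i2 i3 in auto)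
    then have D: "((\<lambda>h'. \<integral>x. exp (h * U x + h' * V x) \<partial>M) has_real_derivative ?N h) (at 0)"
      by (simp add: exp_add mult.commute)
    have pos: "0 < ?Z h"
      using integral_less_AE_space[of "\<lambda>_. 0" "\<lambda>x. exp (h * U x)"] i1 by (simp add: emeasure_space_1)
    have "((\<lambda>h'. ln (\<integral>x. exp (h * U x + h' * V x) \<partial>M)) has_real_derivative ?N h / ?Z h) (at 0)"
      using DERIV_chain2[OF DERIV_ln D] pos by (simp add: field_simps)
    then show ?thesis by (rule DERIV_imp_deriv)
  qed
  have ev: "\<forall>\<^sub>F h in nhds 0. deriv (\<lambda>h'. ln (\<integral>x. exp (h * U x + h' * V x) \<partial>M)) 0 = ?N h / ?Z h"
    unfolding eventually_nhds_metric using inner \<delta> by (intro exI[of _ "\<delta> / 2"]) (auto simp: dist_real_def)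
  have j1: "integrable M U"
    by (rule dom) (use prod_le[of "\<bar>U x\<bar>" 1 1 1 for x] one e1 in \<open>auto simp: abs_mult\<close>)
  have j2: "integrable M V"
    by (rule dom) (use prod_le[of 1 1 "\<bar>V x\<bar>" 1 for x] one e1 in \<open>auto simp: abs_mult\<close>)
  have j3: "integrable M (\<lambda>x. V x * U x)"
    by (rule dom) (use prod_le[of "\<bar>U x\<bar>" 1 "\<bar>V x\<bar>" 1 for x] one e1 in \<open>auto simp: abs_mult mult.commute\<close>)
  have j4: "integrable M (\<lambda>x. V x * ((U x)\<^sup>2 * exp (\<delta> / 2 * \<bar>U x\<bar>)))"
  proof (rule dom)
    fix x
    have "\<bar>V x * ((U x)\<^sup>2 * exp (\<delta> / 2 * \<bar>U x\<bar>))\<bar> = \<bar>U x\<bar>\<^sup>2 * exp (\<delta> / 2 * \<bar>U x\<bar>) * (\<bar>V x\<bar> * 1)"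
      by (simp add: abs_mult)
    also have "\<dots> \<le> (1 + \<bar>U x\<bar>)\<^sup>2 * exp (\<delta> / 2 * \<bar>U x\<bar>) * ((1 + \<bar>V x\<bar>)\<^sup>2 * exp (\<delta> / 2 * \<bar>V x\<bar>))"
      by (rule prod_le) (use one e1 in auto)
    finally show "\<bar>V x * ((U x)\<^sup>2 * exp (\<delta> / 2 * \<bar>U x\<bar>))\<bar>
      \<le> (1 + \<bar>U x\<bar>)\<^sup>2 * exp (\<delta> / 2 * \<bar>U x\<bar>) * ((1 + \<bar>V x\<bar>)\<^sup>2 * exp (\<delta> / 2 * \<bar>V x\<bar>))" .
  qed measurable
  have j5: "integrable M (\<lambda>x. 1 * ((U x)\<^sup>2 * exp (\<delta> / 2 * \<bar>U x\<bar>)))"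
  proof (rule dom)
    fix x
    have "\<bar>1 * ((U x)\<^sup>2 * exp (\<delta> / 2 * \<bar>U x\<bar>))\<bar> = \<bar>U x\<bar>\<^sup>2 * exp (\<delta> / 2 * \<bar>U x\<bar>) * (1 * 1)"
      by (simp add: abs_mult)
    also have "\<dots> \<le> (1 + \<bar>U x\<bar>)\<^sup>2 * exp (\<delta> / 2 * \<bar>U x\<bar>) * ((1 + \<bar>V x\<bar>)\<^sup>2 * exp (\<delta> / 2 * \<bar>V x\<bar>))"
      by (rule prod_le) (use one e1 in auto)
    finally show "\<bar>1 * ((U x)\<^sup>2 * exp (\<delta> / 2 * \<bar>U x\<bar>))\<bar>
      \<le> (1 + \<bar>U x\<bar>)\<^sup>2 * exp (\<delta> / 2 * \<bar>U x\<bar>) * ((1 + \<bar>V x\<bar>)\<^sup>2 * exp (\<delta> / 2 * \<bar>V x\<bar>))" .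
  qed measurable
  have "(?N has_real_derivative (\<integral>x. V x * U x \<partial>M)) (at 0)"
    by (rule DERIV_integral_exp[of "\<delta> / 2"]) (use \<delta> j2 j3 j4 in auto)
  moreover have "((\<lambda>h. \<integral>x. 1 * exp (h * U x) \<partial>M) has_real_derivative (\<integral>x. 1 * U x \<partial>M)) (at 0)"
    by (rule DERIV_integral_exp[of "\<delta> / 2"]) (use \<delta> j1 j5 in auto)
  then have "(?Z has_real_derivative (\<integral>x. U x \<partial>M)) (at 0)" by simp
  ultimately have "((\<lambda>h. ?N h / ?Z h) has_real_derivative ((\<integral>x. V x * U x \<partial>M) * ?Z 0 - ?N 0 * (\<integral>x. U x \<partial>M)) / (?Z 0 * ?Z 0)) (at 0)"
    by (rule DERIV_divide) (simp add: prob_space)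
  then have "deriv (\<lambda>h. ?N h / ?Z h) 0 = (\<integral>x. U x * V x \<partial>M) - (\<integral>x. U x \<partial>M) * (\<integral>x. V x \<partial>M)"
    by (intro DERIV_imp_deriv) (simp add: prob_space mult.commute)
  then show ?thesis using deriv_cong_ev[OF ev refl] by simp
qed


lemma model_hessian_eq_cov:
  fixes W :: "'w \<Rightarrow> real ^ 'd"
  assumes M: "prob_space M" and \<delta>: "0 < \<delta>" and W: "W \<in> borel_measurable M"
    and int: "integrable M (\<lambda>x. exp (\<delta> * norm (W x)))"
  shows "model_hessian M W $ i $ j = (\<integral>x. W x $ i * W x $ j \<partial>M) - (\<integral>x. W x $ i \<partial>M) * (\<integral>x. W x $ j \<partial>M)"
proof -
  note [measurable] = borel_measurable_vec_component[OF W]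
  have "integrable M (\<lambda>x. exp (\<delta> / 2 * \<bar>W x $ i\<bar>) * exp (\<delta> / 2 * \<bar>W x $ j\<bar>))"
  proof (rule Bochner_Integration.integrable_bound[OF int])
    have "exp (\<delta> / 2 * \<bar>w $ i\<bar>) * exp (\<delta> / 2 * \<bar>w $ j\<bar>) \<le> exp (\<delta> * norm w)" for w :: "real ^ 'd"
    proof -
      have "\<delta> / 2 * (\<bar>w $ i\<bar> + \<bar>w $ j\<bar>) \<le> \<delta> / 2 * (norm w + norm w)"
        using \<delta> by (intro mult_left_mono add_mono component_le_norm_cart) auto
      then have "\<delta> / 2 * \<bar>w $ i\<bar> + \<delta> / 2 * \<bar>w $ j\<bar> \<le> \<delta> * norm w" by (simp add: field_simps)
      then show ?thesis by (simp only: exp_add[symmetric] exp_le_cancel_iff)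
    qed
    then show "AE x in M. norm (exp (\<delta> / 2 * \<bar>W x $ i\<bar>) * exp (\<delta> / 2 * \<bar>W x $ j\<bar>)) \<le> norm (exp (\<delta> * norm (W x)))"
      by simp
  qed measurable
  from second_cumulant_derivative[OF M _ _ _ this] \<delta>
  have "deriv (\<lambda>h. deriv (\<lambda>h'. ln (\<integral>x. exp (h * W x $ i + h' * W x $ j) \<partial>M)) 0) 0
    = (\<integral>x. W x $ i * W x $ j \<partial>M) - (\<integral>x. W x $ i \<partial>M) * (\<integral>x. W x $ j \<partial>M)" by simp
  then show ?thesis
    by (simp add: model_hessian_def partial_deriv_def log_mgf_def inner_add_right inner_axis)
qed

lemma noise_hessian_eq_model_hessian: "noise_hessian M W Ws = model_hessian M W"
  by (simp add: noise_hessian_def model_hessian_def joint_log_mgf_def log_mgf_def[abs_def])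

lemma cross_hessian_eq_cov:
  fixes W Ws :: "'w \<Rightarrow> real ^ 'd"
  assumes M: "prob_space M" and \<delta>: "0 < \<delta>" and W: "W \<in> borel_measurable M" "Ws \<in> borel_measurable M"
    and int: "integrable M (\<lambda>x. exp (\<delta> * norm (W x)) * exp (\<delta> * norm (Ws x)))"
  shows "cross_hessian M W Ws $ i $ j = (\<integral>x. W x $ i * Ws x $ j \<partial>M) - (\<integral>x. W x $ i \<partial>M) * (\<integral>x. Ws x $ j \<partial>M)"
proof -
  note [measurable] = borel_measurable_vec_component[OF W(1)] borel_measurable_vec_component[OF W(2)]
  have "integrable M (\<lambda>x. exp (\<delta> * \<bar>W x $ i\<bar>) * exp (\<delta> * \<bar>Ws x $ j\<bar>))"
  proof (rule Bochner_Integration.integrable_bound[OF int])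
    have "exp (\<delta> * \<bar>w $ i\<bar>) * exp (\<delta> * \<bar>w' $ j\<bar>) \<le> exp (\<delta> * norm w) * exp (\<delta> * norm w')" for w w' :: "real ^ 'd"
      using component_le_norm_cart[of w i] component_le_norm_cart[of w' j] \<delta> by (intro mult_mono) auto
    then show "AE x in M. norm (exp (\<delta> * \<bar>W x $ i\<bar>) * exp (\<delta> * \<bar>Ws x $ j\<bar>)) \<le> norm (exp (\<delta> * norm (W x)) * exp (\<delta> * norm (Ws x)))"
      by simp
  qed measurable
  from second_cumulant_derivative[OF M _ _ _ this] \<delta>
  have "deriv (\<lambda>h. deriv (\<lambda>h'. ln (\<integral>x. exp (h * W x $ i + h' * Ws x $ j) \<partial>M)) 0) 0
    = (\<integral>x. W x $ i * Ws x $ j \<partial>M) - (\<integral>x. W x $ i \<partial>M) * (\<integral>x. Ws x $ j \<partial>M)" by simp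
  then show ?thesis
    by (simp add: cross_hessian_def partial_deriv_def joint_log_mgf_def inner_axis)
qed

text \<open>
  Zeroth-, first- and second-order expansions in the tilt \<open>u\<close>, all with the same constant: every
  remainder is dominated by \<open>g (1 + norm Ws)\<^sup>2 exp (\<kappa> norm Ws)\<close>.
\<close>

lemma tilt_expansion:
  fixes f g :: "'w \<Rightarrow> real" and Ws :: "'w \<Rightarrow> real ^ 'd"
  assumes [measurable]: "f \<in> borel_measurable M" "Ws \<in> borel_measurable M"
    and le: "\<And>x. \<bar>f x\<bar> \<le> g x" and u: "norm u \<le> \<kappa>"
    and G: "integrable M (\<lambda>x. g x * ((1 + norm (Ws x))\<^sup>2 * exp (\<kappa> * norm (Ws x))))"
  defines "K \<equiv> \<integral>x. g x * ((1 + norm (Ws x))\<^sup>2 * exp (\<kappa> * norm (Ws x))) \<partial>M"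
  shows "integrable M (\<lambda>x. f x * exp (Ws x \<bullet> u))" "integrable M f" "integrable M (\<lambda>x. f x * (Ws x \<bullet> u))"
    "\<bar>\<integral>x. f x * exp (Ws x \<bullet> u) \<partial>M\<bar> \<le> K" "\<bar>\<integral>x. f x \<partial>M\<bar> \<le> K" "\<bar>\<integral>x. f x * (Ws x \<bullet> u) \<partial>M\<bar> \<le> K * norm u"
    "\<bar>(\<integral>x. f x * exp (Ws x \<bullet> u) \<partial>M) - (\<integral>x. f x \<partial>M)\<bar> \<le> K * norm u"
    "\<bar>(\<integral>x. f x * exp (Ws x \<bullet> u) \<partial>M) - (\<integral>x. f x \<partial>M) - (\<integral>x. f x * (Ws x \<bullet> u) \<partial>M)\<bar> \<le> K * (norm u)\<^sup>2"
proof -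
  let ?G = "\<lambda>x. g x * ((1 + norm (Ws x))\<^sup>2 * exp (\<kappa> * norm (Ws x)))"
  have dom: "integrable M F \<and> \<bar>\<integral>x. F x \<partial>M\<bar> \<le> K * b"
    if [measurable]: "F \<in> borel_measurable M" and F: "\<And>x. \<bar>F x\<bar> \<le> ?G x * b" for F b
  proof
    show i: "integrable M F"
      by (rule Bochner_Integration.integrable_bound[OF integrable_mult_left[OF G, of b]]) (use F in \<open>auto intro: order.trans[OF F abs_ge_self]\<close>)
    have "\<bar>\<integral>x. F x \<partial>M\<bar> \<le> (\<integral>x. \<bar>F x\<bar> \<partial>M)" by simp
    also have "\<dots> \<le> (\<integral>x. ?G x * b \<partial>M)" by (rule integral_mono) (use i G F in auto)
    finally show "\<bar>\<integral>x. F x \<partial>M\<bar> \<le> K * b" by (simp add: K_def)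
  qed
  have g: "0 \<le> g x" for x using order.trans[OF abs_ge_zero le] .
  have y: "\<bar>Ws x \<bullet> u\<bar> \<le> norm (Ws x) * norm u" "\<bar>Ws x \<bullet> u\<bar> \<le> \<kappa> * norm (Ws x)" for x
    using Cauchy_Schwarz_ineq2[of "Ws x" u] mult_left_mono[OF u, of "norm (Ws x)"] by (auto simp: mult.commute)
  have E: "exp \<bar>Ws x \<bullet> u\<bar> \<le> exp (\<kappa> * norm (Ws x))" for x using y(2) by simp
  have \<kappa>: "0 \<le> \<kappa>" using u norm_ge_zero[of u] by linarith
  have E1: "1 \<le> exp (\<kappa> * norm (Ws x))" for x using \<kappa> by simp
  have W: "1 \<le> (1 + norm (Ws x))\<^sup>2" "norm (Ws x) \<le> (1 + norm (Ws x))\<^sup>2" "(norm (Ws x))\<^sup>2 \<le> (1 + norm (Ws x))\<^sup>2" for x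
    by (auto simp: power2_eq_square algebra_simps)
  have core: "\<bar>f x * z\<bar> \<le> ?G x * b" if "\<bar>z\<bar> \<le> (p * b) * q" "0 \<le> p" "0 \<le> b" "p \<le> (1 + norm (Ws x))\<^sup>2" "0 \<le> q" "q \<le> exp (\<kappa> * norm (Ws x))" for x and z p q b :: real
  proof -
    have "\<bar>z\<bar> \<le> ((1 + norm (Ws x))\<^sup>2 * exp (\<kappa> * norm (Ws x))) * b"
    proof -
      have "p * q \<le> (1 + norm (Ws x))\<^sup>2 * exp (\<kappa> * norm (Ws x))" using that by (intro mult_mono) auto
      from mult_right_mono[OF this \<open>0 \<le> b\<close>] show ?thesis using that(1) by (simp add: mult_ac)
    qed
    from mult_mono[OF le[of x] this g abs_ge_zero] show ?thesis by (simp add: abs_mult mult_ac)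
  qed
  have a: "\<bar>f x * exp (Ws x \<bullet> u)\<bar> \<le> ?G x * 1" for x
    by (rule core[where p = 1 and q = "exp \<bar>Ws x \<bullet> u\<bar>"]) (use E W in auto)
  have b: "\<bar>f x\<bar> \<le> ?G x * 1" for x
    using core[where z = 1 and p = 1 and q = 1 and b = 1 and x = x] W E1 by auto
  have c: "\<bar>f x * (Ws x \<bullet> u)\<bar> \<le> ?G x * norm u" for x
    by (rule core[where p = "norm (Ws x)" and q = 1]) (use y W E1 in auto)
  have d: "\<bar>f x * exp (Ws x \<bullet> u) - f x\<bar> \<le> ?G x * norm u" for x
  proof -
    have "\<bar>exp (Ws x \<bullet> u) - 1\<bar> \<le> norm (Ws x) * norm u * exp \<bar>Ws x \<bullet> u\<bar>"
      by (rule order.trans[OF exp_minus_1_bound]) (use y in \<open>simp add: mult_right_mono\<close>)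
    from core[OF this] show ?thesis using E W by (simp add: right_diff_distrib)
  qed
  have e: "\<bar>f x * exp (Ws x \<bullet> u) - f x - f x * (Ws x \<bullet> u)\<bar> \<le> ?G x * (norm u)\<^sup>2" for x
  proof -
    have "(Ws x \<bullet> u)\<^sup>2 \<le> (norm (Ws x) * norm u)\<^sup>2" using power_mono[OF y(1)[of x], of 2] by simp
    then have "\<bar>exp (Ws x \<bullet> u) - 1 - Ws x \<bullet> u\<bar> \<le> (norm (Ws x))\<^sup>2 * (norm u)\<^sup>2 * exp \<bar>Ws x \<bullet> u\<bar>"
      by (intro order.trans[OF exp_taylor_bound1]) (simp add: mult_right_mono power_mult_distrib)
    from core[OF this] show ?thesis using E W by (simp add: right_diff_distrib)
  qed
  show ia: "integrable M (\<lambda>x. f x * exp (Ws x \<bullet> u))" and "\<bar>\<integral>x. f x * exp (Ws x \<bullet> u) \<partial>M\<bar> \<le> K"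
    using dom[OF _ a] by auto
  show ib: "integrable M f" and "\<bar>\<integral>x. f x \<partial>M\<bar> \<le> K" using dom[OF _ b] by auto
  show ic: "integrable M (\<lambda>x. f x * (Ws x \<bullet> u))" and "\<bar>\<integral>x. f x * (Ws x \<bullet> u) \<partial>M\<bar> \<le> K * norm u"
    using dom[OF _ c] by auto
  show "\<bar>(\<integral>x. f x * exp (Ws x \<bullet> u) \<partial>M) - (\<integral>x. f x \<partial>M)\<bar> \<le> K * norm u"
    using dom[OF _ d] ia ib by simp
  show "\<bar>(\<integral>x. f x * exp (Ws x \<bullet> u) \<partial>M) - (\<integral>x. f x \<partial>M) - (\<integral>x. f x * (Ws x \<bullet> u) \<partial>M)\<bar> \<le> K * (norm u)\<^sup>2"
    using dom[OF _ e] ia ib ic by simp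
qed

lemma integral_vec_component:
  fixes W :: "'w \<Rightarrow> real ^ 'd"
  assumes "integrable M W"
  shows "(\<integral>x. W x \<partial>M) $ i = (\<integral>x. W x $ i \<partial>M)"
  using integral_bounded_linear[OF bounded_linear_vec_nth assms] by simp

lemma integrable_of_exp_norm:
  fixes W :: "'w \<Rightarrow> real ^ 'd"
  assumes "0 < \<delta>" "W \<in> borel_measurable M" "integrable M (\<lambda>x. exp (\<delta> * norm (W x)))"
  shows "integrable M W"
proof (rule Bochner_Integration.integrable_bound)
  show "integrable M (\<lambda>x. 1 / \<delta> * exp (\<delta> * norm (W x)))" using assms(3) by (rule integrable_mult_right)
  have "norm (W x) \<le> 1 / \<delta> * exp (\<delta> * norm (W x))" for x
  proof -
    have "\<delta> * norm (W x) \<le> exp (\<delta> * norm (W x))" using exp_ge_add_one_self[of "\<delta> * norm (W x)"] by linarith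
    then show ?thesis using assms(1) by (simp add: field_simps)
  qed
  then show "AE x in M. norm (W x) \<le> norm (1 / \<delta> * exp (\<delta> * norm (W x)))"
    using assms(1) by (intro AE_I2) simp
qed (fact assms)

lemma centered_norm_exp_bound:
  fixes w c :: "real ^ 'd"
  assumes "0 < \<delta>"
  shows "exp (\<delta> * norm (w - c)) \<le> exp (\<delta> * norm c) * exp (\<delta> * norm w)"
  using mult_left_mono[OF norm_triangle_ineq4[of w c], of \<delta>] assms by (simp add: exp_add[symmetric] algebra_simps)

lemma (in prob_space) covariance_eq_centered:
  fixes U V :: "'a \<Rightarrow> real"
  assumes "integrable M U" "integrable M V"
    and "integrable M (\<lambda>x. (U x - expectation U) * (V x - expectation V))"
  shows "expectation (\<lambda>x. U x * V x) - expectation U * expectation V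
    = expectation (\<lambda>x. (U x - expectation U) * (V x - expectation V))"
proof -
  have "U x * V x = (U x - expectation U) * (V x - expectation V) + expectation V * U x + expectation U * V x
      - expectation U * expectation V" for x
    by (simp add: algebra_simps)
  then have "expectation (\<lambda>x. U x * V x) = expectation (\<lambda>x. (U x - expectation U) * (V x - expectation V)
      + expectation V * U x + expectation U * V x - expectation U * expectation V)"
    by presburger
  then show ?thesis using assms by (simp add: prob_space)
qed

text \<open>
  Expands the moment generating function of the centred variable to third order and then the logarithm to
  second order.
\<close>

lemma log_mgf_expansion:
  fixes W :: "'w \<Rightarrow> real ^ 'd"
  assumes M: "prob_space M" and \<delta>: "0 < \<delta>" and W: "W \<in> borel_measurable M"
    and int: "integrable M (\<lambda>x. exp (\<delta> * norm (W x)))"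
  obtains c r where "0 \<le> c" "0 < r"
    "\<And>b. norm b \<le> r \<Longrightarrow> \<bar>log_mgf M W b - (\<integral>x. W x \<partial>M) \<bullet> b - b \<bullet> (model_hessian M W *v b) / 2\<bar> \<le> c * norm b ^ 3"
proof -
  interpret prob_space M by fact
  define w where "w = (\<integral>x. W x \<partial>M)"
  define Wc where "Wc x = W x - w" for x
  define \<kappa> where "\<kappa> = \<delta> / 2"
  have \<kappa>: "0 < \<kappa>" using \<delta> by (simp add: \<kappa>_def)
  note [measurable] = W
  have Wc_meas[measurable]: "Wc \<in> borel_measurable M" unfolding Wc_def by measurable
  note comp[measurable] = borel_measurable_vec_component[OF W] borel_measurable_vec_component[OF Wc_meas]
  have iW: "integrable M W" by (rule integrable_of_exp_norm[OF \<delta> W int])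
  obtain C where C: "0 \<le> C" "\<And>x. 0 \<le> x \<Longrightarrow> (1 + x) ^ 3 \<le> C * exp (\<kappa> * x)"
    using power_one_plus_le_exp[OF \<kappa>, of 3] by auto
  let ?G = "\<lambda>x. (1 + norm (Wc x)) ^ 3 * exp (\<kappa> * norm (Wc x))"
  have G: "integrable M ?G"
  proof (rule Bochner_Integration.integrable_bound[OF integrable_mult_right[OF int, of "C * exp (\<delta> * norm w)"] _ AE_I2])
    fix x
    have "?G x \<le> C * exp (\<kappa> * norm (Wc x)) * exp (\<kappa> * norm (Wc x))" by (intro mult_right_mono C) auto
    also have "\<dots> = C * exp (\<delta> * norm (Wc x))" by (simp add: \<kappa>_def mult.assoc flip: exp_add)
    also have "\<dots> \<le> C * (exp (\<delta> * norm w) * exp (\<delta> * norm (W x)))"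
      unfolding Wc_def by (intro mult_left_mono centered_norm_exp_bound \<delta> C)
    finally show "norm (?G x) \<le> norm (C * exp (\<delta> * norm w) * exp (\<delta> * norm (W x)))"
      using C(1) by (simp add: mult_ac)
  qed measurable
  \<comment> \<open>\<open>?G\<close> dominates all powers of \<open>Wc\<close> up to the third, times the exponential; \<open>dom\<close> turns pointwise bounds into bounds of integrals.\<close>
  define K where "K = (\<integral>x. ?G x \<partial>M)"
  have dom: "integrable M f \<and> \<bar>\<integral>x. f x \<partial>M\<bar> \<le> K * b"
    if [measurable]: "f \<in> borel_measurable M" and f: "\<And>x. \<bar>f x\<bar> \<le> ?G x * b" for f b
  proof
    show i: "integrable M f"
      by (rule Bochner_Integration.integrable_bound[OF integrable_mult_left[OF G, of b] _ AE_I2])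
         (use f in \<open>auto intro: order.trans[OF f abs_ge_self]\<close>)
    have "\<bar>\<integral>x. f x \<partial>M\<bar> \<le> (\<integral>x. \<bar>f x\<bar> \<partial>M)" by simp
    also have "\<dots> \<le> (\<integral>x. ?G x * b \<partial>M)" by (rule integral_mono) (use i G f in auto)
    finally show "\<bar>\<integral>x. f x \<partial>M\<bar> \<le> K * b" by (simp add: K_def)
  qed
  have W3: "1 \<le> (1 + norm z) ^ 3" "norm z \<le> (1 + norm z) ^ 3" "(norm z)\<^sup>2 \<le> (1 + norm z) ^ 3" "norm z ^ 3 \<le> (1 + norm z) ^ 3" for z :: "real ^ 'd"
    by (auto simp: power3_eq_cube power2_eq_square algebra_simps)
  have e1: "1 \<le> exp (\<kappa> * norm z)" for z :: "real ^ 'd" using \<kappa> by simp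
  have G_ge: "a * b' \<le> ?G x" if "0 \<le> a" "a \<le> (1 + norm (Wc x)) ^ 3" "0 \<le> b'" "b' \<le> exp (\<kappa> * norm (Wc x))" for a b' x
    using that by (intro mult_mono) auto
  have K1: "1 \<le> K"
  proof -
    have "(\<integral>x. 1 \<partial>M) \<le> K" unfolding K_def
      by (rule integral_mono[OF _ G]) (use G_ge[of 1 _ 1] W3 e1 in auto)
    then show ?thesis by (simp add: prob_space)
  qed
  have prod_le: "\<bar>Wc x $ i * Wc x $ j\<bar> \<le> ?G x * 1" for x i j
  proof -
    have "\<bar>Wc x $ i * Wc x $ j\<bar> \<le> norm (Wc x) * norm (Wc x)"
      unfolding abs_mult by (intro mult_mono component_le_norm_cart) auto
    also have "\<dots> \<le> ?G x * 1" using G_ge[of "(norm (Wc x))\<^sup>2" x 1] W3 e1 by (auto simp: power2_eq_square)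
    finally show ?thesis .
  qed
  have iprod: "integrable M (\<lambda>x. Wc x $ i * Wc x $ j)" for i j using dom[OF _ prod_le] by auto
  have iWi: "integrable M (\<lambda>x. W x $ i)" for i
    by (rule Bochner_Integration.integrable_bound[OF iW]) (auto simp: component_le_norm_cart)
  have wi: "w $ i = (\<integral>x. W x $ i \<partial>M)" for i unfolding w_def by (rule integral_vec_component[OF iW])
  have hess: "model_hessian M W $ i $ j = (\<integral>x. Wc x $ i * Wc x $ j \<partial>M)" for i j
    using covariance_eq_centered[OF iWi iWi, of i j] iprod[of i j] model_hessian_eq_cov[OF M \<delta> W int, of i j]
    by (simp add: Wc_def wi)
  \<comment> \<open>This radius makes \<open>\<bar>y\<bar> \<le> 1 / 2\<close> below, as the bound for \<open>ln (1 + y)\<close> requires.\<close>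
  define r where "r = min \<kappa> (min 1 (1 / (4 * K)))"
  have r: "0 < r" "r \<le> \<kappa>" "r \<le> 1" "r \<le> 1 / (4 * K)" using \<kappa> K1 by (auto simp: r_def min_le_iff_disj)
  show ?thesis
  proof (rule that[of "K + 8 * K\<^sup>2" r])
    fix b :: "real ^ 'd" assume b: "norm b \<le> r"
    let ?V = "\<lambda>x. Wc x \<bullet> b"
    define y where "y = (\<integral>x. exp (?V x) \<partial>M) - 1"
    define q where "q = (\<integral>x. (?V x)\<^sup>2 \<partial>M)"
    have V: "\<bar>?V x\<bar> \<le> norm (Wc x) * norm b" "\<bar>?V x\<bar> \<le> \<kappa> * norm (Wc x)" for x
      using Cauchy_Schwarz_ineq2[of "Wc x" b] mult_left_mono[OF order.trans[OF b r(2)], of "norm (Wc x)"] by (auto simp: mult.commute)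
    have E: "exp \<bar>?V x\<bar> \<le> exp (\<kappa> * norm (Wc x))" for x using V(2) by simp
    have V1: "\<bar>?V x\<bar> \<le> ?G x * norm b" for x
      using mult_right_mono[OF G_ge[of "norm (Wc x)" x 1, OF _ W3(2) _ e1], of "norm b"] V(1)[of x] by simp
    have V2: "\<bar>(?V x)\<^sup>2\<bar> \<le> ?G x * (norm b)\<^sup>2" for x
    proof -
      have "\<bar>(?V x)\<^sup>2\<bar> \<le> (norm (Wc x) * norm b)\<^sup>2" using power_mono[OF V(1)[of x], of 2] by simp
      also have "\<dots> \<le> ?G x * (norm b)\<^sup>2"
        using mult_right_mono[OF G_ge[of "(norm (Wc x))\<^sup>2" x 1, OF _ W3(3) _ e1], of "(norm b)\<^sup>2"] by (simp add: power_mult_distrib)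
      finally show ?thesis .
    qed
    have V3: "\<bar>exp (?V x) - 1 - ?V x - (?V x)\<^sup>2 / 2\<bar> \<le> ?G x * norm b ^ 3" for x
    proof -
      have "\<bar>exp (?V x) - 1 - ?V x - (?V x)\<^sup>2 / 2\<bar> \<le> \<bar>?V x\<bar> ^ 3 * exp \<bar>?V x\<bar>" by (rule exp_taylor_bound2)
      also have "\<dots> \<le> (norm (Wc x) * norm b) ^ 3 * exp (\<kappa> * norm (Wc x))"
        by (intro mult_mono power_mono V E) auto
      also have "\<dots> \<le> ?G x * norm b ^ 3"
        using mult_right_mono[OF G_ge[of "norm (Wc x) ^ 3" x "exp (\<kappa> * norm (Wc x))", OF _ W3(4)], of "norm b ^ 3"]
        by (simp add: power_mult_distrib mult_ac)
      finally show ?thesis .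
    qed
    note d1 = dom[OF _ V1] and d2 = dom[OF _ V2] and d3 = dom[OF _ V3]
    have i1: "integrable M ?V" and i2: "integrable M (\<lambda>x. (?V x)\<^sup>2)"
      and i3: "integrable M (\<lambda>x. exp (?V x) - 1 - ?V x - (?V x)\<^sup>2 / 2)"
      using d1 d2 d3 by auto
    have V0: "(\<integral>x. ?V x \<partial>M) = 0"
    proof -
      have "(\<integral>x. ?V x \<partial>M) = (\<integral>x. Wc x \<partial>M) \<bullet> b" unfolding Wc_def using iW by (intro integral_inner_left) auto
      also have "(\<integral>x. Wc x \<partial>M) = 0" unfolding Wc_def using iW by (simp add: w_def prob_space)
      finally show ?thesis by simp
    qed
    have iexp: "integrable M (\<lambda>x. exp (?V x))"
      using Bochner_Integration.integrable_add[OF i3 Bochner_Integration.integrable_add[OF i1 Bochner_Integration.integrable_add[OF integrable_divide[OF i2, of 2] integrable_const[of 1]]]]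
      by simp
    have "(\<integral>x. exp (?V x) - 1 - ?V x - (?V x)\<^sup>2 / 2 \<partial>M) = y - q / 2"
      using iexp i1 i2 V0 by (simp add: y_def q_def prob_space)
    then have y_q: "\<bar>y - q / 2\<bar> \<le> K * norm b ^ 3" using d3 by simp
    have q: "\<bar>q\<bar> \<le> K * (norm b)\<^sup>2" using d2 by (simp add: q_def)
    have q_form: "q = b \<bullet> (model_hessian M W *v b)"
    proof -
      have "q = (\<integral>x. (\<Sum>i\<in>UNIV. \<Sum>j\<in>UNIV. b $ i * b $ j * (Wc x $ i * Wc x $ j)) \<partial>M)"
        unfolding q_def inner_cart power2_eq_square sum_product by (simp add: mult_ac)
      also have "\<dots> = (\<Sum>i\<in>UNIV. \<Sum>j\<in>UNIV. b $ i * b $ j * (\<integral>x. Wc x $ i * Wc x $ j \<partial>M))"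
        by (simp add: Bochner_Integration.integral_sum Bochner_Integration.integrable_sum iprod)
      also have "\<dots> = b \<bullet> (model_hessian M W *v b)"
        by (simp add: inner_cart matrix_vector_mult_def hess sum_distrib_left mult_ac)
      finally show ?thesis .
    qed
    have b1: "norm b \<le> 1" using b r by linarith
    have b32: "norm b ^ 3 \<le> (norm b)\<^sup>2" using power_decreasing[of 2 3 "norm b"] b1 by simp
    have y2: "\<bar>y\<bar> \<le> 2 * K * (norm b)\<^sup>2"
    proof -
      have "K * norm b ^ 3 \<le> K * (norm b)\<^sup>2" using b32 K1 by (intro mult_left_mono) auto
      then show ?thesis using y_q q by linarith
    qed
    have "(norm b)\<^sup>2 \<le> norm b" using b1 by (simp add: power2_eq_square mult_left_le)
    then have "2 * K * (norm b)\<^sup>2 \<le> 2 * K * (1 / (4 * K))" using b r K1 by (intro mult_left_mono) auto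
    then have y_half: "\<bar>y\<bar> \<le> 1 / 2" using y2 K1 by simp
    have "\<bar>ln (1 + y) - y\<bar> \<le> 2 * y\<^sup>2" by (rule abs_ln_one_plus_x_minus_x_bound[OF y_half])
    also have "\<dots> \<le> 8 * K\<^sup>2 * norm b ^ 3"
    proof -
      have "y\<^sup>2 \<le> (2 * K * (norm b)\<^sup>2)\<^sup>2" using power_mono[OF y2, of 2] by simp
      also have "\<dots> = 4 * K\<^sup>2 * norm b ^ 4" by (simp add: power_mult_distrib power2_eq_square power4_eq_xxxx)
      also have "\<dots> \<le> 4 * K\<^sup>2 * norm b ^ 3" using power_decreasing[of 3 4 "norm b"] b1 by (intro mult_left_mono) auto
      finally show ?thesis by simp
    qed
    finally have ln: "\<bar>ln (1 + y) - y\<bar> \<le> 8 * K\<^sup>2 * norm b ^ 3" .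
    have "log_mgf M W b = w \<bullet> b + ln (1 + y)"
    proof -
      have "(\<lambda>x. exp (W x \<bullet> b)) = (\<lambda>x. exp (w \<bullet> b) * exp (?V x))"
        by (simp add: Wc_def inner_diff_left flip: exp_add)
      then have "(\<integral>x. exp (W x \<bullet> b) \<partial>M) = exp (w \<bullet> b) * (1 + y)" by (simp add: y_def)
      then show ?thesis unfolding log_mgf_def using y_half by (simp add: ln_mult)
    qed
    then have "\<bar>log_mgf M W b - w \<bullet> b - q / 2\<bar> \<le> (K + 8 * K\<^sup>2) * norm b ^ 3"
      using ln y_q by (simp add: distrib_right)
    then show "\<bar>log_mgf M W b - (\<integral>x. W x \<partial>M) \<bullet> b - b \<bullet> (model_hessian M W *v b) / 2\<bar> \<le> (K + 8 * K\<^sup>2) * norm b ^ 3"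
      unfolding q_form w_def .
  qed (use r K1 in auto)
qed

text \<open>
  A factor of the data-generating law.
\<close>

definition tilted :: "'w measure \<Rightarrow> ('w \<Rightarrow> real ^ 'd) \<Rightarrow> real ^ 'd \<Rightarrow> 'w measure" where
  "tilted M Ws u = density M (\<lambda>x. ennreal (exp (Ws x \<bullet> u - log_mgf M Ws u)))"

text \<open>
  Under a tilt by a small \<open>u\<close> the mean of \<open>W\<close> moves by the cross covariance times
  \<open>u\<close>, up to second order, and its covariance changes by \<open>O (norm u)\<close>. Multiplied by features of size
  \<open>r\<close> both errors become \<open>O (r\<^sup>3)\<close>, the precision of a Lindeberg step.
\<close>

lemma tilted_law:
  fixes W Ws :: "'w \<Rightarrow> real ^ 'd"
  assumes M: "prob_space M" and \<delta>: "0 < \<delta>" and W: "W \<in> borel_measurable M" and Ws: "Ws \<in> borel_measurable M"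
    and int: "integrable M (\<lambda>x. exp (\<delta> * norm (W x)) * exp (\<delta> * norm (Ws x)))"
  obtains c r where "0 \<le> c" "0 < r"
    "\<And>u. norm u \<le> r \<Longrightarrow> prob_space (tilted M Ws u)"
    "\<And>u. norm u \<le> r \<Longrightarrow> centered_law (noise_hessian M W Ws) (c * norm u) c
        (distr (tilted M Ws u) borel (\<lambda>x. W x - (\<integral>x. W x \<partial>tilted M Ws u)))"
    "\<And>u. norm u \<le> r \<Longrightarrow> norm ((\<integral>x. W x \<partial>tilted M Ws u) - (\<integral>x. W x \<partial>M) - cross_hessian M W Ws *v u) \<le> c * (norm u)\<^sup>2"
proof -
  interpret prob_space M by fact
  define w where "w = (\<integral>x. W x \<partial>M)"
  define Wc where "Wc x = W x - w" for x
  define \<kappa> where "\<kappa> = \<delta> / 2"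
  have \<kappa>: "0 < \<kappa>" using \<delta> by (simp add: \<kappa>_def)
  note [measurable] = W Ws
  have Wc_meas[measurable]: "Wc \<in> borel_measurable M" unfolding Wc_def by measurable
  note comp[measurable] = borel_measurable_vec_component[OF W] borel_measurable_vec_component[OF Wc_meas]
    borel_measurable_vec_component[OF Ws]
  have intW: "integrable M (\<lambda>x. exp (\<delta> * norm (W x)))"
    by (rule Bochner_Integration.integrable_bound[OF int _ AE_I2]) (use \<delta> in auto)
  have intWs: "integrable M (\<lambda>x. exp (\<delta> * norm (Ws x)))"
    by (rule Bochner_Integration.integrable_bound[OF int _ AE_I2]) (use \<delta> in auto)
  have iW: "integrable M W" by (rule integrable_of_exp_norm[OF \<delta> W intW])
  have iWs: "integrable M Ws" by (rule integrable_of_exp_norm[OF \<delta> Ws intWs])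
  obtain C3 where C3: "0 \<le> C3" "\<And>x. 0 \<le> x \<Longrightarrow> (1 + x) ^ 3 \<le> C3 * exp (\<delta> * x)"
    using power_one_plus_le_exp[OF \<delta>, of 3] by auto
  obtain C2 where C2: "0 \<le> C2" "\<And>x. 0 \<le> x \<Longrightarrow> (1 + x) ^ 2 \<le> C2 * exp (\<kappa> * x)"
    using power_one_plus_le_exp[OF \<kappa>, of 2] by auto
  let ?g = "\<lambda>x. (1 + norm (Wc x)) ^ 3"
  let ?G = "\<lambda>x. ?g x * ((1 + norm (Ws x))\<^sup>2 * exp (\<kappa> * norm (Ws x)))"
  have G: "integrable M ?G"
  proof (rule Bochner_Integration.integrable_bound[OF integrable_mult_right[OF int, of "C3 * C2 * exp (\<delta> * norm w)"] _ AE_I2])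
    fix x
    have "?g x \<le> C3 * exp (\<delta> * norm (Wc x))" by (rule C3) simp
    also have "\<dots> \<le> C3 * (exp (\<delta> * norm w) * exp (\<delta> * norm (W x)))"
      unfolding Wc_def by (intro mult_left_mono centered_norm_exp_bound \<delta> C3)
    finally have 1: "?g x \<le> C3 * (exp (\<delta> * norm w) * exp (\<delta> * norm (W x)))" .
    have "(1 + norm (Ws x))\<^sup>2 * exp (\<kappa> * norm (Ws x)) \<le> C2 * exp (\<kappa> * norm (Ws x)) * exp (\<kappa> * norm (Ws x))"
      by (intro mult_right_mono C2) auto
    also have "\<dots> = C2 * exp (\<delta> * norm (Ws x))" by (simp add: \<kappa>_def mult.assoc flip: exp_add)
    finally have 2: "(1 + norm (Ws x))\<^sup>2 * exp (\<kappa> * norm (Ws x)) \<le> C2 * exp (\<delta> * norm (Ws x))" .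
    have "?G x \<le> C3 * (exp (\<delta> * norm w) * exp (\<delta> * norm (W x))) * (C2 * exp (\<delta> * norm (Ws x)))"
      by (rule mult_mono[OF 1 2]) (use C3(1) in auto)
    then show "norm (?G x) \<le> norm (C3 * C2 * exp (\<delta> * norm w) * (exp (\<delta> * norm (W x)) * exp (\<delta> * norm (Ws x))))"
      using C3(1) C2(1) by (simp add: mult_ac)
  qed measurable
  define K where "K = (\<integral>x. ?G x \<partial>M)"
  have W3: "1 \<le> (1 + norm z) ^ 3" "norm z \<le> (1 + norm z) ^ 3" "(norm z)\<^sup>2 \<le> (1 + norm z) ^ 3" "norm z ^ 3 \<le> (1 + norm z) ^ 3" for z :: "real ^ 'd"
    by (auto simp: power3_eq_cube power2_eq_square algebra_simps)
  have K1: "1 \<le> K"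
  proof -
    have "1 * (1 * 1) \<le> ?G x" for x
      using \<kappa> W3(1)[of "Wc x"] by (intro mult_mono) (auto simp: one_le_power)
    then have "(\<integral>x. 1 \<partial>M) \<le> K" unfolding K_def by (intro integral_mono[OF _ G]) auto
    then show ?thesis by (simp add: prob_space)
  qed
  note T = tilt_expansion[OF _ Ws _ _ G, folded K_def]
  define Z where "Z u = (\<integral>x. exp (Ws x \<bullet> u) \<partial>M)" for u
  \<comment> \<open>This radius keeps the normalising constant \<open>Z u\<close> above \<open>1 / 2\<close>.\<close>
  define r where "r = min \<kappa> (min 1 (1 / (2 * K)))"
  have r: "0 < r" "r \<le> \<kappa>" "r \<le> 1" "r \<le> 1 / (2 * K)" using \<kappa> K1 by (auto simp: r_def min_le_iff_disj)
  have Z: "integrable M (\<lambda>x. exp (Ws x \<bullet> u))" "\<bar>Z u - 1\<bar> \<le> K * norm u" "1 / 2 \<le> Z u" if u: "norm u \<le> r" for u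
  proof -
    have u\<kappa>: "norm u \<le> \<kappa>" using u r by linarith
    show "integrable M (\<lambda>x. exp (Ws x \<bullet> u))" using T(1)[of "\<lambda>_. 1", OF _ _ u\<kappa>] W3(1) by simp
    show 1: "\<bar>Z u - 1\<bar> \<le> K * norm u"
      using T(7)[of "\<lambda>_. 1", OF _ _ u\<kappa>] W3(1) by (simp add: Z_def prob_space)
    have "K * norm u \<le> K * (1 / (2 * K))" using u r K1 by (intro mult_left_mono) auto
    then show "1 / 2 \<le> Z u" using 1 K1 by simp
  qed
  let ?E = "\<lambda>u f. \<integral>x. f x \<partial>tilted M Ws u"
  have E_eq: "?E u f = (\<integral>x. f x * exp (Ws x \<bullet> u) \<partial>M) / Z u"
    and E_int: "integrable M (\<lambda>x. f x * exp (Ws x \<bullet> u)) \<Longrightarrow> integrable (tilted M Ws u) f"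
    if [measurable]: "f \<in> borel_measurable M" and u: "norm u \<le> r" for f :: "'w \<Rightarrow> real" and u
  proof -
    have "exp (Ws x \<bullet> u - log_mgf M Ws u) = exp (Ws x \<bullet> u) / Z u" for x
      using Z(3)[OF u] by (simp add: exp_diff log_mgf_def Z_def)
    then have t: "tilted M Ws u = density M (\<lambda>x. ennreal (exp (Ws x \<bullet> u) / Z u))" by (simp add: tilted_def)
    have nn: "AE x in M. 0 \<le> exp (Ws x \<bullet> u) / Z u" using Z(3)[OF u] by simp
    show "?E u f = (\<integral>x. f x * exp (Ws x \<bullet> u) \<partial>M) / Z u"
      unfolding t by (subst integral_density[OF _ _ nn]) (auto simp: mult.commute)
    assume "integrable M (\<lambda>x. f x * exp (Ws x \<bullet> u))"
    then show "integrable (tilted M Ws u) f"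
      unfolding t by (subst integrable_density[OF _ _ nn]) (auto simp: mult.commute)
  qed
  have prob: "prob_space (tilted M Ws u)" if u: "norm u \<le> r" for u
  proof (rule prob_spaceI)
    have "emeasure (tilted M Ws u) (space (tilted M Ws u)) = (\<integral>\<^sup>+x. ennreal (exp (Ws x \<bullet> u - log_mgf M Ws u)) \<partial>M)"
      unfolding tilted_def by (simp add: emeasure_density cong: nn_integral_cong_simp)
    also have "\<dots> = (\<integral>\<^sup>+x. ennreal (exp (Ws x \<bullet> u) / Z u) \<partial>M)"
      using Z(3)[OF u] by (simp add: exp_diff log_mgf_def Z_def)
    also have "\<dots> = ennreal (\<integral>x. exp (Ws x \<bullet> u) / Z u \<partial>M)"
      using Z[OF u] by (intro nn_integral_eq_integral) auto
    also have "\<dots> = 1" using Z(3)[OF u] by (simp flip: Z_def)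
    finally show "emeasure (tilted M Ws u) (space (tilted M Ws u)) = 1" .
  qed
  \<comment> \<open>Division by \<open>Z u = 1 + O (norm u)\<close>.\<close>
  have small: "\<bar>p / Z u - m\<bar> \<le> 2 * (a + \<bar>m\<bar> * (K * norm u))" if u: "norm u \<le> r" and p: "\<bar>p - m\<bar> \<le> a" for p m a u
  proof -
    have "p / Z u - m = ((p - m) + m * (1 - Z u)) / Z u" using Z(3)[OF u] by (simp add: field_simps)
    then have "\<bar>p / Z u - m\<bar> = \<bar>(p - m) + m * (1 - Z u)\<bar> / Z u" using Z(3)[OF u] by (simp add: abs_divide)
    also have "\<dots> \<le> \<bar>(p - m) + m * (1 - Z u)\<bar> / (1 / 2)"
      using Z(3)[OF u] by (intro divide_left_mono) auto
    also have "\<dots> \<le> 2 * (a + \<bar>m\<bar> * (K * norm u))"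
    proof -
      have "\<bar>m * (1 - Z u)\<bar> \<le> \<bar>m\<bar> * (K * norm u)"
        unfolding abs_mult using Z(2)[OF u] by (intro mult_left_mono) (auto simp: abs_minus_commute)
      from order.trans[OF abs_triangle_ineq add_mono[OF p this]] show ?thesis by simp
    qed
    finally show ?thesis .
  qed
  have E1: "integrable (tilted M Ws u) f" "\<bar>?E u f\<bar> \<le> 2 * K"
    and E2: "\<bar>?E u f - (\<integral>x. f x \<partial>M)\<bar> \<le> 4 * K\<^sup>2 * norm u"
    and E3: "(\<integral>x. f x \<partial>M) = 0 \<Longrightarrow> \<bar>?E u f - (\<integral>x. f x * (Ws x \<bullet> u) \<partial>M)\<bar> \<le> 4 * K\<^sup>2 * (norm u)\<^sup>2"
    if f[measurable]: "f \<in> borel_measurable M" and le: "\<And>x. \<bar>f x\<bar> \<le> ?g x" and u: "norm u \<le> r" for f u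
  proof -
    have u\<kappa>: "norm u \<le> \<kappa>" using u r by linarith
    note t = T[OF f le u\<kappa>]
    show "integrable (tilted M Ws u) f" by (rule E_int[OF f u t(1)])
    have "\<bar>?E u f\<bar> = \<bar>\<integral>x. f x * exp (Ws x \<bullet> u) \<partial>M\<bar> / Z u" using Z(3)[OF u] by (simp add: E_eq[OF f u] abs_divide)
    also have "\<dots> \<le> K / (1 / 2)" using Z(3)[OF u] t(4) K1 by (intro frac_le) auto
    finally show "\<bar>?E u f\<bar> \<le> 2 * K" by simp
    have K2: "K \<le> K\<^sup>2" using K1 by (simp add: power2_eq_square mult_left_le)
    have "\<bar>?E u f - (\<integral>x. f x \<partial>M)\<bar> \<le> 2 * (K * norm u + \<bar>\<integral>x. f x \<partial>M\<bar> * (K * norm u))"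
      unfolding E_eq[OF f u] by (rule small[OF u t(7)])
    also have "\<dots> \<le> 2 * (K\<^sup>2 * norm u + K * (K * norm u))"
      using t(5) K1 K2 by (intro mult_left_mono add_mono mult_right_mono) auto
    also have "\<dots> = 4 * K\<^sup>2 * norm u" by (simp add: power2_eq_square)
    finally show "\<bar>?E u f - (\<integral>x. f x \<partial>M)\<bar> \<le> 4 * K\<^sup>2 * norm u" .
    assume "(\<integral>x. f x \<partial>M) = 0"
    then have "\<bar>(\<integral>x. f x * exp (Ws x \<bullet> u) \<partial>M) - (\<integral>x. f x * (Ws x \<bullet> u) \<partial>M)\<bar> \<le> K * (norm u)\<^sup>2" using t(8) by simp
    from small[OF u this]
    have "\<bar>?E u f - (\<integral>x. f x * (Ws x \<bullet> u) \<partial>M)\<bar> \<le> 2 * (K * (norm u)\<^sup>2 + \<bar>\<integral>x. f x * (Ws x \<bullet> u) \<partial>M\<bar> * (K * norm u))"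
      unfolding E_eq[OF f u] .
    also have "\<dots> \<le> 2 * (K\<^sup>2 * (norm u)\<^sup>2 + (K * norm u) * (K * norm u))"
      using t(6) K1 K2 by (intro mult_left_mono add_mono mult_right_mono) auto
    also have "\<dots> = 4 * K\<^sup>2 * (norm u)\<^sup>2" by (simp add: power2_eq_square)
    finally show "\<bar>?E u f - (\<integral>x. f x * (Ws x \<bullet> u) \<partial>M)\<bar> \<le> 4 * K\<^sup>2 * (norm u)\<^sup>2" .
  qed
  have g_comp: "\<bar>Wc x $ i\<bar> \<le> ?g x" for x i
    using order.trans[OF component_le_norm_cart W3(2)] .
  have g_prod: "\<bar>Wc x $ i * Wc x $ j\<bar> \<le> ?g x" for x i j
  proof -
    have "\<bar>Wc x $ i * Wc x $ j\<bar> \<le> norm (Wc x) * norm (Wc x)"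
      unfolding abs_mult by (intro mult_mono component_le_norm_cart) auto
    then show ?thesis using W3(3)[of "Wc x"] by (simp add: power2_eq_square)
  qed
  have g_one: "\<bar>1\<bar> \<le> ?g x" "\<bar>norm (Wc x)\<bar> \<le> ?g x" "\<bar>?g x\<bar> \<le> ?g x" for x using W3 by auto
  have iWi: "integrable M (\<lambda>x. W x $ i)" "integrable M (\<lambda>x. Ws x $ i)" for i
    by (rule Bochner_Integration.integrable_bound[OF iW], auto simp: component_le_norm_cart)
       (rule Bochner_Integration.integrable_bound[OF iWs], auto simp: component_le_norm_cart)
  have wi: "w $ i = (\<integral>x. W x $ i \<partial>M)" for i unfolding w_def by (rule integral_vec_component[OF iW])
  have \<kappa>0: "norm (0 :: real ^ 'd) \<le> \<kappa>" using \<kappa> by simp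
  have m1: "(\<lambda>x. Wc x $ i) \<in> borel_measurable M" for i by measurable
  have m2: "(\<lambda>x. Wc x $ i * Wc x $ j) \<in> borel_measurable M" for i j by measurable
  have m3: "(\<lambda>x. norm (Wc x)) \<in> borel_measurable M" "?g \<in> borel_measurable M" by measurable
  have iWc: "integrable M (\<lambda>x. Wc x $ i)" "integrable M (\<lambda>x. Wc x $ i * Wc x $ j)" for i j
    by (rule T(2)[OF m1 g_comp \<kappa>0], rule T(2)[OF m2 g_prod \<kappa>0])
  have Wc0: "(\<integral>x. Wc x $ i \<partial>M) = 0" for i
    using iWi by (simp add: Wc_def wi prob_space)
  have sigma: "noise_hessian M W Ws $ i $ j = (\<integral>x. Wc x $ i * Wc x $ j \<partial>M)" for i j
    using covariance_eq_centered[OF iWi(1) iWi(1), of i j] iWc(2)[of i j] model_hessian_eq_cov[OF M \<delta> W intW, of i j]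
    by (simp add: Wc_def wi noise_hessian_eq_model_hessian)
  have cross: "(\<integral>x. Wc x $ i * (Ws x \<bullet> u) \<partial>M) = (cross_hessian M W Ws *v u) $ i" if u: "norm u \<le> \<kappa>" for i u
  proof -
    have iWWs: "integrable M (\<lambda>x. Wc x $ i * Ws x $ j)" for j
    proof -
      have "norm ((\<kappa> *\<^sub>R axis j 1) :: real ^ 'd) \<le> \<kappa>" using \<kappa> by simp
      from T(3)[OF m1 g_comp this] have "integrable M (\<lambda>x. \<kappa> * (Wc x $ i * Ws x $ j))"
        by (simp add: inner_axis mult_ac)
      then show ?thesis using \<kappa> by simp
    qed
    have iWWs': "integrable M (\<lambda>x. W x $ i * Ws x $ j)" for j
    proof -
      have "(\<lambda>x. W x $ i * Ws x $ j) = (\<lambda>x. Wc x $ i * Ws x $ j + w $ i * Ws x $ j)"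
        by (simp add: Wc_def algebra_simps)
      then show ?thesis using iWWs iWi by simp
    qed
    have c: "(\<integral>x. Wc x $ i * Ws x $ j \<partial>M) = cross_hessian M W Ws $ i $ j" for j
    proof -
      have "(\<integral>x. Wc x $ i * Ws x $ j \<partial>M) = (\<integral>x. W x $ i * Ws x $ j - w $ i * Ws x $ j \<partial>M)"
        by (simp add: Wc_def algebra_simps)
      also have "\<dots> = (\<integral>x. W x $ i * Ws x $ j \<partial>M) - w $ i * (\<integral>x. Ws x $ j \<partial>M)"
        using iWWs' iWi by simp
      finally show ?thesis using cross_hessian_eq_cov[OF M \<delta> W Ws int] by (simp add: wi)
    qed
    have "(\<integral>x. Wc x $ i * (Ws x \<bullet> u) \<partial>M) = (\<integral>x. (\<Sum>j\<in>UNIV. u $ j * (Wc x $ i * Ws x $ j)) \<partial>M)"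
      by (simp add: inner_cart sum_distrib_left mult_ac)
    also have "\<dots> = (\<Sum>j\<in>UNIV. u $ j * cross_hessian M W Ws $ i $ j)"
      using iWWs by (simp add: Bochner_Integration.integral_sum Bochner_Integration.integrable_sum c)
    finally show ?thesis by (simp add: matrix_vector_mult_def mult.commute)
  qed
  define e where "e u = (\<integral>x. W x \<partial>tilted M Ws u)" for u
  have cong: "sets (tilted M Ws u) = sets M" for u by (simp add: tilted_def)
  have iW': "integrable (tilted M Ws u) W" and ei: "e u $ i - w $ i = ?E u (\<lambda>x. Wc x $ i)"
    and e_norm: "norm (e u - w) \<le> 2 * K" if u: "norm u \<le> r" for u i
  proof -
    interpret t: prob_space "tilted M Ws u" by (rule prob[OF u])
    have mW: "Wc \<in> borel_measurable (tilted M Ws u)" by (simp add: measurable_cong_sets[OF cong refl])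
    have n: "integrable (tilted M Ws u) (\<lambda>x. norm (Wc x))" "\<bar>?E u (\<lambda>x. norm (Wc x))\<bar> \<le> 2 * K"
      by (rule E1[OF m3(1) g_one(2) u])+
    have i: "integrable (tilted M Ws u) Wc" using n(1) mW by (simp add: integrable_norm_iff)
    have Weq: "W = (\<lambda>x. Wc x + w)" by (simp add: Wc_def)
    show iW': "integrable (tilted M Ws u) W" unfolding Weq using i by simp
    have ew: "e u - w = (\<integral>x. Wc x \<partial>tilted M Ws u)"
      unfolding e_def Wc_def using iW' by (simp add: t.prob_space)
    show "e u $ i - w $ i = ?E u (\<lambda>x. Wc x $ i)"
      using integral_vec_component[OF i, of i] ew by (metis vector_minus_component)
    show "norm (e u - w) \<le> 2 * K" unfolding ew using n(2) integral_norm_bound[of "tilted M Ws u" Wc] by linarith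
  qed
  have e_small: "\<bar>e u $ i - w $ i\<bar> \<le> 4 * K\<^sup>2 * norm u" if u: "norm u \<le> r" for u i
    using E2[OF m1[of i] g_comp u] unfolding ei[OF u] Wc0 by (simp only: diff_0_right)
  have e_first: "\<bar>e u $ i - w $ i - (cross_hessian M W Ws *v u) $ i\<bar> \<le> 4 * K\<^sup>2 * (norm u)\<^sup>2" if u: "norm u \<le> r" for u i
    using E3[OF m1[of i] g_comp u Wc0] unfolding ei[OF u] cross[OF order.trans[OF u r(2)]] .
  define d where "d = real CARD('d)"
  have d1: "1 \<le> d" by (simp add: d_def Suc_leI)
  \<comment> \<open>\<open>20 = 4 + 16\<close>: the covariance changes by \<open>4 K\<^sup>2 norm u\<close> from the tilt and \<open>(4 K\<^sup>2 norm u)\<^sup>2\<close> from the shift of the mean.\<close>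
  define c where "c = 20 * K ^ 4 * d"
  have K24: "K\<^sup>2 \<le> K ^ 4" using K1 by (intro power_increasing) auto
  have c_ge: "20 * K ^ 4 \<le> c" "4 * K\<^sup>2 * d \<le> c"
  proof -
    have K4: "0 \<le> K ^ 4" using K1 by simp
    then show "20 * K ^ 4 \<le> c" using mult_left_mono[OF d1, of "20 * K ^ 4"] by (simp add: c_def)
    have "4 * K\<^sup>2 \<le> 20 * K ^ 4" using K24 K4 by linarith
    then show "4 * K\<^sup>2 * d \<le> c" unfolding c_def using d1 by (intro mult_right_mono) auto
  qed
  show ?thesis
  proof (rule that[of c r])
    show "0 \<le> c" using c_ge(1) K1 by (simp add: c_def d_def)
    fix u :: "real ^ 'd" assume u: "norm u \<le> r"
    show "prob_space (tilted M Ws u)" by (rule prob[OF u])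
    interpret t: prob_space "tilted M Ws u" by (rule prob[OF u])
    show "norm (?E u W - (\<integral>x. W x \<partial>M) - cross_hessian M W Ws *v u) \<le> c * (norm u)\<^sup>2"
    proof -
      have "norm (e u - w - cross_hessian M W Ws *v u) \<le> (\<Sum>i\<in>UNIV. \<bar>(e u - w - cross_hessian M W Ws *v u) $ i\<bar>)"
        by (rule norm_le_l1_cart)
      also have "\<dots> \<le> (\<Sum>i\<in>(UNIV::'d set). 4 * K\<^sup>2 * (norm u)\<^sup>2)" using e_first[OF u] by (intro sum_mono) simp
      also have "\<dots> = 4 * K\<^sup>2 * d * (norm u)\<^sup>2" by (simp add: d_def)
      also have "\<dots> \<le> c * (norm u)\<^sup>2" by (intro mult_right_mono c_ge) auto
      finally show ?thesis by (simp add: e_def w_def)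
    qed
    have mt: "f \<in> borel_measurable (tilted M Ws u)" if "f \<in> borel_measurable M" for f :: "'w \<Rightarrow> 'x :: topological_space"
      using that by (simp add: measurable_cong_sets[OF cong refl])
    have [measurable]: "(\<lambda>x. W x - e u) \<in> borel_measurable (tilted M Ws u)" by (rule mt) measurable
    let ?Q = "distr (tilted M Ws u) borel (\<lambda>x. W x - e u)"
    have q: "(\<integral>z. h z \<partial>?Q) = (\<integral>x. h (W x - e u) \<partial>tilted M Ws u)"
      if "h \<in> borel_measurable borel" for h :: "real ^ 'd \<Rightarrow> real"
      using that by (subst integral_distr) auto
    have qi: "integrable ?Q h \<longleftrightarrow> integrable (tilted M Ws u) (\<lambda>x. h (W x - e u))"
      if "h \<in> borel_measurable borel" for h :: "real ^ 'd \<Rightarrow> real"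
      using that by (subst integrable_distr_eq) auto
    have iWct: "integrable (tilted M Ws u) (\<lambda>x. Wc x $ i)" "integrable (tilted M Ws u) (\<lambda>x. Wc x $ i * Wc x $ j)" for i j
      by (rule E1(1)[OF m1 g_comp u], rule E1(1)[OF m2 g_prod u])
    have shift: "(W x - e u) $ i = Wc x $ i - (e u $ i - w $ i)" for x i by (simp add: Wc_def)
    have mean: "(\<integral>z. z $ i \<partial>?Q) = 0" for i
      by (subst q) (use iWct in \<open>simp_all add: shift ei[OF u] t.prob_space del: vector_minus_component\<close>)
    have cov: "\<bar>(\<integral>z. z $ i * z $ j \<partial>?Q) - noise_hessian M W Ws $ i $ j\<bar> \<le> c * norm u" for i j
    proof -
      let ?a = "\<lambda>i. e u $ i - w $ i"
      have "(\<integral>z. z $ i * z $ j \<partial>?Q) = (\<integral>x. (W x - e u) $ i * (W x - e u) $ j \<partial>tilted M Ws u)"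
        by (subst q) auto
      also have "\<dots> = (\<integral>x. Wc x $ i * Wc x $ j - ?a j * Wc x $ i - ?a i * Wc x $ j + ?a i * ?a j \<partial>tilted M Ws u)"
        unfolding shift by (simp add: algebra_simps)
      also have "\<dots> = ?E u (\<lambda>x. Wc x $ i * Wc x $ j) - ?a j * ?a i - ?a i * ?a j + ?a i * ?a j"
        using iWct by (simp add: t.prob_space flip: ei[OF u])
      finally have eq: "(\<integral>z. z $ i * z $ j \<partial>?Q) = ?E u (\<lambda>x. Wc x $ i * Wc x $ j) - ?a i * ?a j" by simp
      have 1: "\<bar>?E u (\<lambda>x. Wc x $ i * Wc x $ j) - noise_hessian M W Ws $ i $ j\<bar> \<le> 4 * K\<^sup>2 * norm u"
        using E2[OF m2[of i j] g_prod u] unfolding sigma .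
      have "\<bar>?a i * ?a j\<bar> \<le> (4 * K\<^sup>2 * norm u) * (4 * K\<^sup>2 * norm u)"
        unfolding abs_mult by (intro mult_mono e_small u) auto
      also have "\<dots> = 16 * K ^ 4 * norm u * norm u" by (simp add: power2_eq_square power4_eq_xxxx)
      also have "\<dots> \<le> 16 * K ^ 4 * norm u * 1" using u r by (intro mult_left_mono) auto
      finally have 2: "\<bar>?a i * ?a j\<bar> \<le> 16 * K ^ 4 * norm u" by simp
      have 3: "4 * K\<^sup>2 * norm u \<le> 4 * K ^ 4 * norm u" using K24 by (intro mult_right_mono) auto
      have "\<bar>(\<integral>z. z $ i * z $ j \<partial>?Q) - noise_hessian M W Ws $ i $ j\<bar> \<le> 4 * K ^ 4 * norm u + 16 * K ^ 4 * norm u"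
        unfolding eq using 1 2 3 by linarith
      also have "\<dots> \<le> c * norm u" using mult_right_mono[OF c_ge(1) norm_ge_zero, of u] by linarith
      finally show ?thesis .
    qed
    have third: "integrable (tilted M Ws u) (\<lambda>x. norm (W x - e u) ^ 3)" "(\<integral>x. norm (W x - e u) ^ 3 \<partial>tilted M Ws u) \<le> c"
    proof -
      have le: "norm (W x - e u) ^ 3 \<le> 8 * K ^ 3 * ?g x" for x
      proof -
        have "norm (W x - e u) \<le> norm (Wc x) + norm (e u - w)"
          using norm_triangle_ineq4[of "Wc x" "e u - w"] by (simp add: Wc_def)
        also have "\<dots> \<le> norm (Wc x) + 2 * K" using e_norm[OF u] by simp
        also have "\<dots> \<le> 2 * K * (1 + norm (Wc x))"
          using mult_right_mono[of 1 "2 * K" "norm (Wc x)"] K1 by (simp add: algebra_simps)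
        finally have "norm (W x - e u) ^ 3 \<le> (2 * K * (1 + norm (Wc x))) ^ 3" by (intro power_mono) auto
        then show ?thesis by (simp add: power_mult_distrib)
      qed
      have g: "integrable (tilted M Ws u) (\<lambda>x. 8 * K ^ 3 * ?g x)" "?E u ?g \<le> 2 * K"
        using E1[OF m3(2) g_one(3) u] by auto
      show i: "integrable (tilted M Ws u) (\<lambda>x. norm (W x - e u) ^ 3)"
        by (rule Bochner_Integration.integrable_bound[OF g(1)])
           (use le K1 in \<open>auto intro: order.trans[OF le] simp: abs_mult\<close>)
      have "(\<integral>x. norm (W x - e u) ^ 3 \<partial>tilted M Ws u) \<le> (\<integral>x. 8 * K ^ 3 * ?g x \<partial>tilted M Ws u)"
        by (rule integral_mono[OF i g(1) le])
      also have "\<dots> \<le> 8 * K ^ 3 * (2 * K)" using g(2) K1 by simp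
      also have "\<dots> = 16 * K ^ 4" by (simp add: power3_eq_cube power4_eq_xxxx)
      also have "\<dots> \<le> c" using c_ge(1) K1 zero_le_power[of K 4] by linarith
      finally show "(\<integral>x. norm (W x - e u) ^ 3 \<partial>tilted M Ws u) \<le> c" .
    qed
    show "centered_law (noise_hessian M W Ws) (c * norm u) c (distr (tilted M Ws u) borel (\<lambda>x. W x - (\<integral>x. W x \<partial>tilted M Ws u)))"
      unfolding centered_law_def e_def[symmetric]
      using t.prob_space_distr[of "\<lambda>x. W x - e u" borel] mean cov third by (simp add: qi q)
  qed (use r in auto)
qed

section \<open>The two processes as linear fields\<close>

text \<open>
  The maps depend on the coordinate, since every block is recentred by its own mean.
\<close>

lemma distr_PiM_componentwise:
  assumes I: "finite I" and P: "\<And>i. prob_space (P i)" and f: "\<And>i. f i \<in> measurable (P i) (N i)"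
  shows "distr (\<Pi>\<^sub>M i\<in>I. P i) (\<Pi>\<^sub>M i\<in>I. N i) (\<lambda>w. \<lambda>i\<in>I. f i (w i)) = (\<Pi>\<^sub>M i\<in>I. distr (P i) (N i) (f i))"
proof -
  interpret P: product_sigma_finite P by (simp add: product_sigma_finite_def prob_space_imp_sigma_finite P)
  interpret D: product_sigma_finite "\<lambda>i. distr (P i) (N i) (f i)"
    using prob_space.prob_space_distr[OF P f] by (simp add: product_sigma_finite_def prob_space_imp_sigma_finite)
  have meas: "(\<lambda>w. \<lambda>i\<in>I. f i (w i)) \<in> measurable (\<Pi>\<^sub>M i\<in>I. P i) (\<Pi>\<^sub>M i\<in>I. N i)"
  proof (rule measurable_restrict)
    fix i assume "i \<in> I"
    from measurable_compose[OF measurable_component_singleton[OF this, of P] f[of i]]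
    show "(\<lambda>w. f i (w i)) \<in> measurable (\<Pi>\<^sub>M i\<in>I. P i) (N i)" .
  qed
  show ?thesis
  proof (rule D.PiM_eqI[OF I])
    show "sets (distr (\<Pi>\<^sub>M i\<in>I. P i) (\<Pi>\<^sub>M i\<in>I. N i) (\<lambda>w. \<lambda>i\<in>I. f i (w i))) = sets (\<Pi>\<^sub>M i\<in>I. distr (P i) (N i) (f i))"
      by (simp cong: sets_PiM_cong)
    fix A assume "\<And>i. i \<in> I \<Longrightarrow> A i \<in> sets (distr (P i) (N i) (f i))"
    then have A: "\<And>i. i \<in> I \<Longrightarrow> A i \<in> sets (N i)" by simp
    have box: "Pi\<^sub>E I A \<in> sets (\<Pi>\<^sub>M i\<in>I. N i)" using I A by (intro sets_PiM_I_finite) auto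
    have vim: "(\<lambda>w. \<lambda>i\<in>I. f i (w i)) -` Pi\<^sub>E I A \<inter> space (\<Pi>\<^sub>M i\<in>I. P i) = Pi\<^sub>E I (\<lambda>i. f i -` A i \<inter> space (P i))"
      by (auto simp: space_PiM PiE_iff)
    show "emeasure (distr (\<Pi>\<^sub>M i\<in>I. P i) (\<Pi>\<^sub>M i\<in>I. N i) (\<lambda>w. \<lambda>i\<in>I. f i (w i))) (Pi\<^sub>E I A)
      = (\<Prod>i\<in>I. emeasure (distr (P i) (N i) (f i)) (A i))"
      using I A by (simp add: emeasure_distr[OF meas box] vim P.emeasure_PiM measurable_sets[OF f] emeasure_distr[OF f])
  qed
qed

lemma centered_law_mono:
  assumes "centered_law S \<delta> c Q" "\<delta> \<le> \<delta>'" "c \<le> c'"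
  shows "centered_law S \<delta>' c' Q"
  using assms unfolding centered_law_def by (meson order.trans)

lemma borel_measurable_log_mgf:
  assumes M: "prob_space M" and W: "W \<in> borel_measurable M"
  shows "log_mgf M W \<in> borel_measurable borel"
proof -
  interpret prob_space M by fact
  note [measurable] = W
  show ?thesis unfolding log_mgf_def[abs_def] by measurable
qed

definition gauss_drift ::
  "nat \<Rightarrow> real ^ 'd ^ 'd \<Rightarrow> real ^ 'd ^ 'd \<Rightarrow> (nat \<Rightarrow> 'p \<Rightarrow> real ^ 'd) \<Rightarrow> 'p \<Rightarrow> 'p \<Rightarrow> real" where
  "gauss_drift k A K \<eta> \<theta> t = (\<Sum>m<k. (A *v \<eta> m \<theta>) \<bullet> \<eta> m t - 1 / 2 * ((K *v \<eta> m t) \<bullet> \<eta> m t))"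

definition lik_drift ::
  "nat \<Rightarrow> 'w measure \<Rightarrow> ('w \<Rightarrow> real ^ 'd) \<Rightarrow> (nat \<Rightarrow> real ^ 'd) \<Rightarrow> (nat \<Rightarrow> 'p \<Rightarrow> real ^ 'd) \<Rightarrow> 'p \<Rightarrow> real" where
  "lik_drift k \<mu> W e \<eta> t = (\<Sum>m<k. e m \<bullet> \<eta> m t - log_mgf \<mu> W (\<eta> m t))"

lemma test_fun_eq:
  "test_fun k \<eta> a H \<theta> s t = bias_term k \<eta> a H \<theta> t + (\<Sum>m<k. (H *v \<eta> m t) \<bullet> \<eta> m t) - (\<Sum>m<k. (H *v \<eta> m s) \<bullet> \<eta> m t)"
  by (simp add: test_fun_def dsum_inner_def block_diag_def global_feature_def)

lemma bias_term_eq: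
  "bias_term k \<eta> a H \<theta> t = a * (\<Sum>m<k. (H *v (\<eta> m \<theta> - \<eta> m t)) \<bullet> (\<eta> m \<theta> - \<eta> m t))"
  by (simp add: bias_term_def dsum_inner_def block_diag_def global_feature_def)

context prob_space begin

lemma bfun_quadratic:
  fixes x y :: "'a \<Rightarrow> real ^ 'd"
  assumes "bounded_feature M \<rho> x" "bounded_feature M \<rho>' y"
  shows "(\<lambda>t. (H *v x t) \<bullet> y t) \<in> bfun M"
  using bounded_feature_comp(1)[OF assms(1)] bounded_feature_comp(1)[OF assms(2)]
  by (auto simp: inner_cart matrix_vector_mult_def)

lemma bfun_bias_term:
  fixes \<eta> :: "nat \<Rightarrow> 'a \<Rightarrow> real ^ 'd"
  assumes "\<And>m. m < k \<Longrightarrow> bounded_feature M r (\<eta> m)"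
  shows "bias_term k \<eta> a H \<theta> \<in> bfun M"
proof -
  have "(\<lambda>t. (H *v (\<eta> m \<theta> - \<eta> m t)) \<bullet> (\<eta> m \<theta> - \<eta> m t)) \<in> bfun M" if "m < k" for m
  proof -
    have "bounded_feature M (norm (\<eta> m \<theta>) + r) (\<lambda>t. \<eta> m \<theta> - \<eta> m t)"
      using assms[OF that] unfolding bounded_feature_def
      by (auto intro!: order.trans[OF norm_triangle_ineq4])
    then show ?thesis by (intro bfun_quadratic)
  qed
  then show ?thesis unfolding bias_term_eq[abs_def] by auto
qed

lemma bfun_test_fun:
  fixes \<eta> :: "nat \<Rightarrow> 'a \<Rightarrow> real ^ 'd"
  assumes x: "\<And>m. m < k \<Longrightarrow> bounded_feature M r (\<eta> m)"
  shows "(\<lambda>st. test_fun k \<eta> a H \<theta> (fst st) (snd st)) \<in> bfun (M \<Otimes>\<^sub>M M)"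
proof -
  have lift: "(\<lambda>st. f (fst st)) \<in> bfun (M \<Otimes>\<^sub>M M)" "(\<lambda>st. f (snd st)) \<in> bfun (M \<Otimes>\<^sub>M M)" if f: "f \<in> bfun M" for f :: "'a \<Rightarrow> real"
  proof -
    note [measurable] = bfun_measurable[OF f]
    obtain c where "\<And>x. x \<in> space M \<Longrightarrow> \<bar>f x\<bar> \<le> c" by (rule bfunE[OF f]) blast
    then show "(\<lambda>st. f (fst st)) \<in> bfun (M \<Otimes>\<^sub>M M)" "(\<lambda>st. f (snd st)) \<in> bfun (M \<Otimes>\<^sub>M M)"
      by (auto intro!: bfunI[of _ _ c] simp: space_pair_measure)
  qed
  note c = bounded_feature_comp(1)[OF x]
  have "(\<lambda>st. \<Sum>m<k. (H *v \<eta> m (snd st)) \<bullet> \<eta> m (snd st)) \<in> bfun (M \<Otimes>\<^sub>M M)"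
    by (rule lift(2)[of "\<lambda>t. \<Sum>m<k. (H *v \<eta> m t) \<bullet> \<eta> m t"]) (rule bfun_sum, rule bfun_quadratic, (rule x, simp)+)
  moreover have "(\<lambda>st. \<Sum>m<k. (H *v \<eta> m (fst st)) \<bullet> \<eta> m (snd st)) \<in> bfun (M \<Otimes>\<^sub>M M)"
    unfolding inner_cart matrix_vector_mult_def using lift(1)[OF c] lift(2)[OF c]
    by (auto intro!: bfun_sum bfun_mult)
  moreover have "(\<lambda>st. bias_term k \<eta> a H \<theta> (snd st)) \<in> bfun (M \<Otimes>\<^sub>M M)"
    by (rule lift(2)[OF bfun_bias_term[OF x]])
  ultimately show ?thesis unfolding test_fun_eq by auto
qed

lemma mean_gibbs_pair_test_fun:
  fixes \<eta> :: "nat \<Rightarrow> 'a \<Rightarrow> real ^ 'd"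
  assumes x: "\<And>m. m < k \<Longrightarrow> bounded_feature M r (\<eta> m)" and Q: "prob_space Q"
    and Z: "\<And>w. w \<in> space Q \<Longrightarrow> (\<lambda>t. Z t w) \<in> bfun M" and Zm: "(\<lambda>(w, t). Z t w) \<in> borel_measurable (Q \<Otimes>\<^sub>M M)"
  shows "(\<integral>st. test_fun k \<eta> a H \<theta> (fst st) (snd st) \<partial>mean_gibbs_pair Q M Z)
    = (\<integral>w. response M k \<eta> H (bias_term k \<eta> a H \<theta>) (\<lambda>t. Z t w) \<partial>Q)"
proof -
  have "(\<integral>st. test_fun k \<eta> a H \<theta> (fst st) (snd st) \<partial>mean_gibbs_pair Q M Z)
    = (\<integral>w. gibbs_mean M (\<lambda>t. Z t w) (\<lambda>s. gibbs_mean M (\<lambda>t. Z t w) (\<lambda>t. test_fun k \<eta> a H \<theta> (fst (s, t)) (snd (s, t)))) \<partial>Q)"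
    by (rule integral_mean_gibbs_pair[OF Q Z Zm bfun_test_fun[OF x]])
  also have "\<dots> = (\<integral>w. response M k \<eta> H (bias_term k \<eta> a H \<theta>) (\<lambda>t. Z t w) \<partial>Q)"
    by (rule Bochner_Integration.integral_cong[OF refl])
       (simp only: fst_conv snd_conv test_fun_eq response_def gibbs_mean_pair_bilinear[OF Z bfun_bias_term[OF x] x])
  finally show ?thesis .
qed

lemma response_field_measurable:
  fixes \<eta> x :: "nat \<Rightarrow> 'a \<Rightarrow> real ^ 'd"
  assumes \<eta>: "\<And>m. m < k \<Longrightarrow> bounded_feature M r (\<eta> m)" and x: "\<And>m. m < k \<Longrightarrow> x m \<in> borel_measurable M"
    and D: "D \<in> borel_measurable M" and b: "b \<in> borel_measurable M"
  shows "(\<lambda>\<xi>. response M k \<eta> H b (linear_field k x D \<xi>)) \<in> borel_measurable (\<Pi>\<^sub>M m\<in>{..<k}. borel)"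
proof -
  have c: "(\<lambda>t. \<eta> m t $ i) \<in> borel_measurable M" if "m < k" for m i
    using bounded_feature_comp(1)[OF \<eta>[OF that]] by (rule bfun_measurable)
  note [measurable] = b
  show ?thesis unfolding response_def
    by (intro borel_measurable_add borel_measurable_sum borel_measurable_times borel_measurable_const
        gibbs_mean_field_measurable[OF x D] gibbs_cov_field_measurable[OF x D] c) (auto, measurable)
qed

text \<open>
  The random part of the perturbation is absorbed into the features, its bias into the drift.
\<close>

lemma Phi_gauss_eq:
  fixes \<eta> :: "nat \<Rightarrow> 'a \<Rightarrow> real ^ 'd" and \<mu> \<gamma> :: "'w measure" and \<theta> :: 'a
  assumes \<eta>: "\<And>m. m < k \<Longrightarrow> bounded_feature M r (\<eta> m)" and r: "0 \<le> r" and \<beta>: "\<bar>\<beta>\<bar> \<le> 1"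
    and N: "prob_space N" "sets N = sets (\<Pi>\<^sub>M m\<in>{..<k}. borel)"
    and B: "\<And>x. pseudoinverse k (block_diag k (noise_hessian \<gamma> W Ws)) (block_diag k H x) = block_diag k B x"
  defines "E \<equiv> gauss_drift k (cross_hessian \<gamma> W Ws) (model_hessian \<mu> W) \<eta> \<theta>"
  shows "Phi_gauss n k \<eta> \<mu> \<gamma> W Ws N M a H \<theta> \<beta> = 1 / real n *
    (\<integral>\<xi>. response M k \<eta> H (bias_term k \<eta> a H \<theta>)
       (linear_field k (\<lambda>m t. \<eta> m t + \<beta> *\<^sub>R (B *v \<eta> m t)) (\<lambda>t. E t + \<beta> * bias_term k \<eta> a H \<theta> t) \<xi>) \<partial>N)"
    and "E \<in> bfun M"
proof -
  let ?Z = "\<lambda>t \<xi>. gauss_process k \<eta> (cross_hessian \<gamma> W Ws) (model_hessian \<mu> W) \<theta> t \<xi>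
        + \<beta> * perturbation k \<eta> (noise_hessian \<gamma> W Ws) a H \<theta> t \<xi>"
  let ?x = "\<lambda>m t. \<eta> m t + \<beta> *\<^sub>R (B *v \<eta> m t)" and ?D = "\<lambda>t. E t + \<beta> * bias_term k \<eta> a H \<theta> t"
  have Z: "?Z t \<xi> = linear_field k ?x ?D \<xi> t" for t \<xi>
    unfolding gauss_process_def perturbation_def B
    by (simp add: linear_field_def E_def gauss_drift_def dsum_inner_def block_diag_def
        global_feature_def inner_add_right sum.distrib sum_distrib_left sum_subtractf algebra_simps)
  obtain \<kappa> where \<kappa>: "0 \<le> \<kappa>" "\<And>v. norm (B *v v) \<le> \<kappa> * norm v" by (rule matrix_bound_exists[of B]) blast
  have fx: "bounded_feature M ((1 + \<kappa>) * r) (?x m)" if "m < k" for m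
    by (rule bounded_feature_perturbed(3)[OF \<eta>[OF that] \<kappa>(2,1) \<beta> r])
  show E: "E \<in> bfun M"
    unfolding E_def gauss_drift_def[abs_def] using bounded_feature_inner(1)[OF \<eta>] bfun_quadratic[OF \<eta> \<eta>]
    by (intro bfun_sum bfun_diff bfun_mult bfun_const) auto
  have D: "?D \<in> bfun M" using E bfun_bias_term[OF \<eta>] by auto
  have m: "(\<lambda>(\<xi>, t). linear_field k ?x ?D \<xi> t) \<in> borel_measurable (N \<Otimes>\<^sub>M M)"
  proof -
    have "sets (N \<Otimes>\<^sub>M M) = sets ((\<Pi>\<^sub>M m\<in>{..<k}. (borel :: (real ^ 'd) measure)) \<Otimes>\<^sub>M M)"
      by (intro sets_pair_measure_cong N refl)
    then show ?thesis
      using linear_field_measurable[of k ?x ?D] fx bfun_measurable[OF D]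
      by (subst measurable_cong_sets[OF _ refl]) (auto simp: bounded_feature_def)
  qed
  show "Phi_gauss n k \<eta> \<mu> \<gamma> W Ws N M a H \<theta> \<beta> = 1 / real n *
    (\<integral>\<xi>. response M k \<eta> H (bias_term k \<eta> a H \<theta>) (linear_field k ?x ?D \<xi>) \<partial>N)"
    unfolding Phi_gauss_def Z
    by (subst mean_gibbs_pair_test_fun[OF \<eta> N(1)]) (use m linear_field_bfun[OF fx D] in auto)
qed

text \<open>
  The observations enter only through the recentred blocks \<open>W - e m\<close>; the means \<open>e m\<close> go
  into the drift.
\<close>

lemma Phi_lik_eq:
  fixes \<eta> :: "nat \<Rightarrow> 'a \<Rightarrow> real ^ 'd" and W Ws :: "'w \<Rightarrow> real ^ 'd" and \<theta> :: 'a and \<mu> \<gamma> :: "'w measure" and k :: nat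
  assumes \<eta>: "\<And>m. m < k \<Longrightarrow> bounded_feature M r (\<eta> m)"
    and W: "W \<in> borel_measurable \<gamma>"
  defines "law \<equiv> \<lambda>m. tilted \<gamma> Ws (global_feature k \<eta> \<theta> m)"
  defines "e \<equiv> \<lambda>m. \<integral>x. W x \<partial>law m"
  defines "D \<equiv> lik_drift k \<mu> W e \<eta>"
  assumes D: "D \<in> bfun M" and law: "\<And>m. prob_space (law m)"
  shows "Phi_lik n k \<eta> \<mu> \<gamma> W Ws M a H \<theta> = 1 / real n *
    (\<integral>\<xi>. response M k \<eta> H (bias_term k \<eta> a H \<theta>) (linear_field k \<eta> D \<xi>)
      \<partial>(\<Pi>\<^sub>M m\<in>{..<k}. distr (law m) borel (\<lambda>x. W x - e m)))"
proof -
  let ?P = "\<Pi>\<^sub>M m\<in>{..<k}. law m" and ?N = "\<Pi>\<^sub>M m\<in>{..<k}. (borel :: (real ^ 'd) measure)"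
  let ?\<xi> = "\<lambda>w. \<lambda>m\<in>{..<k}. W (w m) - e m"
  let ?G = "\<lambda>\<xi>. response M k \<eta> H (bias_term k \<eta> a H \<theta>) (linear_field k \<eta> D \<xi>)"
  have P: "data_law k \<eta> \<gamma> Ws \<theta> = ?P"
    unfolding data_law_def by (rule PiM_cong) (auto simp: law_def tilted_def global_feature_def)
  have W': "(\<lambda>x. W x - e m) \<in> measurable (law m) borel" for m
    using W by (simp add: law_def tilted_def)
  have \<eta>m: "\<eta> m \<in> borel_measurable M" if "m < k" for m using \<eta>[OF that] by (simp add: bounded_feature_def)
  have bm: "bias_term k \<eta> a H \<theta> \<in> borel_measurable M" by (rule bfun_measurable[OF bfun_bias_term[OF \<eta>]])
  have \<xi>: "?\<xi> \<in> measurable ?P ?N"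
  proof (rule measurable_restrict)
    fix m assume "m \<in> {..<k}"
    from measurable_compose[OF measurable_component_singleton[OF this, of law] W'[of m]]
    show "(\<lambda>w. W (w m) - e m) \<in> borel_measurable ?P" .
  qed
  have Z: "log_lik k \<eta> \<mu> W t w = linear_field k \<eta> D (?\<xi> w) t" for t w
    by (simp add: log_lik_def linear_field_def D_def lik_drift_def inner_diff_left sum_subtractf)
  have Zm: "(\<lambda>(w, t). log_lik k \<eta> \<mu> W t w) \<in> borel_measurable (?P \<Otimes>\<^sub>M M)"
  proof -
    have "(\<lambda>z. (?\<xi> (fst z), snd z)) \<in> measurable (?P \<Otimes>\<^sub>M M) (?N \<Otimes>\<^sub>M M)"
      by (intro measurable_Pair measurable_compose[OF measurable_fst \<xi>] measurable_snd)
    from measurable_compose[OF this linear_field_measurable[OF \<eta>m bfun_measurable[OF D]]]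
    show ?thesis unfolding Z by (simp add: case_prod_beta')
  qed
  have "Phi_lik n k \<eta> \<mu> \<gamma> W Ws M a H \<theta> = 1 / real n * (\<integral>w. response M k \<eta> H (bias_term k \<eta> a H \<theta>) (\<lambda>t. log_lik k \<eta> \<mu> W t w) \<partial>?P)"
    unfolding Phi_lik_def P
  proof (subst mean_gibbs_pair_test_fun[OF \<eta> _ _ Zm])
    show "prob_space ?P" by (rule prob_space_PiM) (rule law)
    show "(\<lambda>t. log_lik k \<eta> \<mu> W t w) \<in> bfun M" for w unfolding Z by (rule linear_field_bfun[OF \<eta> D])
  qed simp_all
  also have "(\<integral>w. response M k \<eta> H (bias_term k \<eta> a H \<theta>) (\<lambda>t. log_lik k \<eta> \<mu> W t w) \<partial>?P) = (\<integral>w. ?G (?\<xi> w) \<partial>?P)"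
    unfolding Z ..
  also have "\<dots> = (\<integral>\<xi>. ?G \<xi> \<partial>distr ?P ?N ?\<xi>)"
    by (rule integral_distr[OF \<xi>, symmetric]) (rule response_field_measurable[OF \<eta> \<eta>m bfun_measurable[OF D] bm])
  also have "distr ?P ?N ?\<xi> = (\<Pi>\<^sub>M m\<in>{..<k}. distr (law m) borel (\<lambda>x. W x - e m))"
    by (rule distr_PiM_componentwise[OF _ law W']) simp
  finally show ?thesis .
qed

end

section \<open>Error terms and the final comparison\<close>

text \<open>
  The terms linear in the common mean \<open>w\<close> cancel, which is where equality of the means of
  \<open>W\<close> under the model and the true base measure is needed.
\<close>

lemma drift_difference_bound:
  fixes \<eta> :: "nat \<Rightarrow> 'p \<Rightarrow> real ^ 'd"
  assumes c: "0 \<le> c1" "0 \<le> c2"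
    and e: "\<And>m. m < k \<Longrightarrow> norm (e m - w - A *v \<eta> m \<theta>) \<le> c1 * (norm (\<eta> m \<theta>))\<^sup>2"
    and l: "\<And>m. m < k \<Longrightarrow> \<bar>log_mgf \<mu> W (\<eta> m t) - w \<bullet> \<eta> m t - \<eta> m t \<bullet> (K *v \<eta> m t) / 2\<bar> \<le> c2 * norm (\<eta> m t) ^ 3"
    and r: "\<And>m. m < k \<Longrightarrow> norm (\<eta> m \<theta>) \<le> r" "\<And>m. m < k \<Longrightarrow> norm (\<eta> m t) \<le> r"
  shows "\<bar>lik_drift k \<mu> W e \<eta> t - gauss_drift k A K \<eta> \<theta> t\<bar> \<le> real k * ((c1 + c2) * r ^ 3)"
proof -
  have "\<bar>(e m \<bullet> \<eta> m t - log_mgf \<mu> W (\<eta> m t)) - ((A *v \<eta> m \<theta>) \<bullet> \<eta> m t - 1 / 2 * ((K *v \<eta> m t) \<bullet> \<eta> m t))\<bar> \<le> (c1 + c2) * r ^ 3"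
    if m: "m < k" for m
  proof -
    have r0: "0 \<le> r" using order.trans[OF norm_ge_zero r(1)[OF m]] .
    have "\<bar>(e m - w - A *v \<eta> m \<theta>) \<bullet> \<eta> m t\<bar> \<le> norm (e m - w - A *v \<eta> m \<theta>) * norm (\<eta> m t)" by (rule Cauchy_Schwarz_ineq2)
    also have "\<dots> \<le> (c1 * r\<^sup>2) * r"
      using r[OF m] c r0 by (intro mult_mono order.trans[OF e[OF m]] mult_left_mono power_mono) auto
    finally have 1: "\<bar>(e m - w - A *v \<eta> m \<theta>) \<bullet> \<eta> m t\<bar> \<le> c1 * r ^ 3" by (simp add: power2_eq_square power3_eq_cube mult.assoc)
    have 2: "\<bar>log_mgf \<mu> W (\<eta> m t) - w \<bullet> \<eta> m t - \<eta> m t \<bullet> (K *v \<eta> m t) / 2\<bar> \<le> c2 * r ^ 3"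
      using r[OF m] c by (intro order.trans[OF l[OF m]] mult_left_mono power_mono) auto
    have "(e m \<bullet> \<eta> m t - log_mgf \<mu> W (\<eta> m t)) - ((A *v \<eta> m \<theta>) \<bullet> \<eta> m t - 1 / 2 * ((K *v \<eta> m t) \<bullet> \<eta> m t))
      = (e m - w - A *v \<eta> m \<theta>) \<bullet> \<eta> m t - (log_mgf \<mu> W (\<eta> m t) - w \<bullet> \<eta> m t - \<eta> m t \<bullet> (K *v \<eta> m t) / 2)"
      by (simp add: inner_diff_left inner_commute[of "\<eta> m t" "K *v \<eta> m t"])
    then show ?thesis using 1 2 by (simp add: distrib_right)
  qed
  then have "\<bar>lik_drift k \<mu> W e \<eta> t - gauss_drift k A K \<eta> \<theta> t\<bar> \<le> (\<Sum>m<k. (c1 + c2) * r ^ 3)"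
    unfolding lik_drift_def gauss_drift_def sum_subtractf[symmetric]
    by (intro order.trans[OF sum_abs] sum_mono) simp
  then show ?thesis by simp
qed

lemma feature_radius_bound:
  fixes \<eta> :: "nat \<Rightarrow> 'p::topological_space \<Rightarrow> real ^ 'd"
  assumes "compact \<Theta>" "\<And>m. m < k \<Longrightarrow> continuous_on \<Theta> (\<eta> m)" and m: "m < k" and u: "u \<in> \<Theta>"
  shows "norm (\<eta> m u) \<le> feature_radius \<Theta> k \<eta>"
proof -
  have "compact ((\<lambda>u. norm (\<eta> m u)) ` \<Theta>)"
    using assms by (intro compact_continuous_image continuous_on_norm) auto
  then have "bdd_above ((\<lambda>u. norm (\<eta> m u)) ` \<Theta>)" by (intro bounded_imp_bdd_above compact_imp_bounded)
  then have "norm (\<eta> m u) \<le> (SUP u\<in>\<Theta>. norm (\<eta> m u))" using u by (rule cSUP_upper2) simp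
  also have "\<dots> \<le> feature_radius \<Theta> k \<eta>"
    unfolding feature_radius_def using m by (intro Max_ge) auto
  finally show ?thesis .
qed

text \<open>
  Turns the two growth conditions into the form in which they are used: small features, and
  \<open>M r\<^sup>2\<close> of order \<open>n\<close>.
\<close>

lemma radius_small:
  fixes M :: "nat \<Rightarrow> nat" and r :: "nat \<Rightarrow> real"
  assumes M: "(\<lambda>n. real (M n)) \<in> \<omega>(\<lambda>n. real n)"
    and r: "\<forall>\<^sub>F n in sequentially. r n \<le> c * sqrt (real n / real (M n))" and \<rho>: "0 < \<rho>"
  shows "\<forall>\<^sub>F n in sequentially. 0 < n \<and> 0 < M n \<and> r n \<le> \<rho> \<and> (0 \<le> r n \<longrightarrow> real (M n) * (r n)\<^sup>2 \<le> c\<^sup>2 * real n)"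
proof -
  \<comment> \<open>If \<open>M n \<ge> K n\<close>, then \<open>\<bar>c\<bar> sqrt (n / M n) \<le> \<bar>c\<bar> / (\<bar>c\<bar> / \<rho> + 1) \<le> \<rho>\<close>.\<close>
  define K where "K = (\<bar>c\<bar> / \<rho> + 1)\<^sup>2"
  have K1: "0 < \<bar>c\<bar> / \<rho> + 1" using \<rho> by (simp add: add_nonneg_pos)
  then have K: "0 < K" by (simp add: K_def)
  have "\<forall>\<^sub>F n in sequentially. K * norm (real n) \<le> norm (real (M n))"
    using landau_omega.smallD[OF M K] by simp
  then show ?thesis using r eventually_gt_at_top[of 0]
  proof eventually_elim
    case (elim n)
    have n: "0 < real n" using elim by simp
    have M_ge: "K * real n \<le> real (M n)" using elim by simp
    then have M0: "0 < real (M n)" using K n by (intro less_le_trans[OF mult_pos_pos[OF K n]])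
    have "real n / real (M n) \<le> 1 / K" using M_ge M0 K by (simp add: field_simps)
    then have "sqrt (real n / real (M n)) \<le> sqrt (1 / K)" by simp
    also have "\<dots> = 1 / (\<bar>c\<bar> / \<rho> + 1)" using K1 by (simp add: K_def real_sqrt_divide)
    finally have s: "sqrt (real n / real (M n)) \<le> 1 / (\<bar>c\<bar> / \<rho> + 1)" .
    have "c * sqrt (real n / real (M n)) \<le> \<bar>c\<bar> * sqrt (real n / real (M n))" by (intro mult_right_mono) auto
    also have "\<dots> \<le> \<bar>c\<bar> * (1 / (\<bar>c\<bar> / \<rho> + 1))" using s by (intro mult_left_mono) auto
    also have "\<dots> \<le> \<rho>"
    proof -
      have "\<bar>c\<bar> \<le> \<rho> * (\<bar>c\<bar> / \<rho> + 1)" using \<rho> by (simp add: distrib_left)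
      then show ?thesis using K1 by (simp add: pos_divide_le_eq)
    qed
    finally have "r n \<le> \<rho>" using elim by linarith
    moreover have "real (M n) * (r n)\<^sup>2 \<le> c\<^sup>2 * real n" if "0 \<le> r n"
    proof -
      have "(r n)\<^sup>2 \<le> (c * sqrt (real n / real (M n)))\<^sup>2" using elim that by (intro power_mono) auto
      also have "\<dots> = c\<^sup>2 * (real n / real (M n))" by (simp add: power_mult_distrib)
      finally have "real (M n) * (r n)\<^sup>2 \<le> real (M n) * (c\<^sup>2 * (real n / real (M n)))" by (intro mult_left_mono) auto
      also have "\<dots> = c\<^sup>2 * real n" using M0 by simp
      finally show ?thesis .
    qed
    ultimately show ?case using elim M0 by simp
  qed
qed

text \<open>
  Every error is \<open>k r\<^sup>2\<close> times \<open>r\<close>, \<open>\<epsilon>\<close> or \<open>r / \<epsilon>\<close>, and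
  \<open>r \<le> r / \<epsilon>\<close>.
\<close>

lemma comparison_error_bound:
  fixes \<epsilon> d \<sigma> c \<kappa> r :: real
  assumes nn: "0 \<le> c" "0 \<le> \<kappa>" "0 \<le> \<sigma>" "0 \<le> r" "0 \<le> cD" and \<epsilon>: "0 < \<epsilon>" "\<epsilon> < 1" and kr: "real k * r\<^sup>2 \<le> C0 * real n" and n: "0 < n"
    and le: "\<beta> * (X - Y) \<le> \<bar>\<beta>\<bar> * (2 * (real k * (6 * ((1 + \<kappa>) * r) ^ 3 * c + 2 * d\<^sup>2 * (c * r) * ((1 + \<kappa>) * r)\<^sup>2 + 6 * d\<^sup>2 * \<sigma> * ((1 + \<kappa>) * r) ^ 3 * (1 + c)))
        + \<bar>\<beta>\<bar> * (real k * (d\<^sup>2 * (\<sigma> * (2 * ((1 + \<kappa>) * r)\<^sup>2)))))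
      + 2 * (real k * (cD * r ^ 3) + real k * (12 * ((1 + \<kappa>) * r) ^ 3 * c + 2 * d\<^sup>2 * (c * r) * ((1 + \<kappa>) * r)\<^sup>2))"
    and \<beta>: "\<beta> = \<epsilon> \<or> \<beta> = - \<epsilon>"
  defines "I \<equiv> 6 * (1 + \<kappa>) ^ 3 * c + 2 * d\<^sup>2 * c * (1 + \<kappa>)\<^sup>2 + 6 * d\<^sup>2 * \<sigma> * (1 + \<kappa>) ^ 3 * (1 + c)"
    and "J \<equiv> d\<^sup>2 * (\<sigma> * (2 * (1 + \<kappa>)\<^sup>2))"
    and "L \<equiv> cD + (12 * (1 + \<kappa>) ^ 3 * c + 2 * d\<^sup>2 * c * (1 + \<kappa>)\<^sup>2)"
  shows "sgn \<beta> * (X - Y) / real n \<le> C0 * (2 * I + J + 2 * L) * (\<epsilon> + r / \<epsilon>)"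
proof -
  have I: "0 \<le> I" and J: "0 \<le> J" and L: "0 \<le> L" using nn by (auto simp: I_def J_def L_def)
  have ab: "\<bar>\<beta>\<bar> = \<epsilon>" and bs: "\<beta> = \<epsilon> * sgn \<beta>" using \<beta> \<epsilon> by auto
  define q where "q = real k * r\<^sup>2"
  have q: "0 \<le> q" by (simp add: q_def)
  have "6 * ((1 + \<kappa>) * r) ^ 3 * c + 2 * d\<^sup>2 * (c * r) * ((1 + \<kappa>) * r)\<^sup>2 + 6 * d\<^sup>2 * \<sigma> * ((1 + \<kappa>) * r) ^ 3 * (1 + c) = I * r ^ 3"
    "12 * ((1 + \<kappa>) * r) ^ 3 * c + 2 * d\<^sup>2 * (c * r) * ((1 + \<kappa>) * r)\<^sup>2 = (L - cD) * r ^ 3"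
    "d\<^sup>2 * (\<sigma> * (2 * ((1 + \<kappa>) * r)\<^sup>2)) = J * r\<^sup>2"
    unfolding I_def J_def L_def by (simp_all add: power_mult_distrib power2_eq_square power3_eq_cube algebra_simps)
  note e = this
  have "\<beta> * (X - Y) \<le> \<epsilon> * (2 * (real k * (I * r ^ 3)) + \<epsilon> * (real k * (J * r\<^sup>2))) + 2 * (real k * (cD * r ^ 3) + real k * ((L - cD) * r ^ 3))"
    using le unfolding e ab .
  also have "\<dots> = \<epsilon> * (2 * I * (q * r) + J * (q * \<epsilon>) + 2 * L * (q * (r / \<epsilon>)))"
    using \<epsilon> by (simp add: q_def power2_eq_square power3_eq_cube field_simps)
  finally have "\<epsilon> * (sgn \<beta> * (X - Y)) \<le> \<epsilon> * (2 * I * (q * r) + J * (q * \<epsilon>) + 2 * L * (q * (r / \<epsilon>)))"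
    by (subst (asm) bs) (simp only: mult.assoc)
  then have "sgn \<beta> * (X - Y) \<le> 2 * I * (q * r) + J * (q * \<epsilon>) + 2 * L * (q * (r / \<epsilon>))"
    using \<epsilon> by simp
  also have "\<dots> \<le> 2 * I * (q * (\<epsilon> + r / \<epsilon>)) + J * (q * (\<epsilon> + r / \<epsilon>)) + 2 * L * (q * (\<epsilon> + r / \<epsilon>))"
  proof -
    have "r * \<epsilon> \<le> r * 1" using nn \<epsilon> by (intro mult_left_mono) auto
    then have "r \<le> r / \<epsilon>" using \<epsilon> by (simp add: field_simps)
    moreover have "0 \<le> r / \<epsilon>" using nn \<epsilon> by simp
    ultimately have "r \<le> \<epsilon> + r / \<epsilon>" "\<epsilon> \<le> \<epsilon> + r / \<epsilon>" "r / \<epsilon> \<le> \<epsilon> + r / \<epsilon>" using \<epsilon> by linarith+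
    then show ?thesis using I J L q by (intro add_mono mult_left_mono) auto
  qed
  also have "\<dots> = q * ((2 * I + J + 2 * L) * (\<epsilon> + r / \<epsilon>))" by (simp add: algebra_simps)
  also have "\<dots> \<le> (C0 * real n) * ((2 * I + J + 2 * L) * (\<epsilon> + r / \<epsilon>))"
    unfolding q_def using I J L nn \<epsilon> by (intro mult_right_mono kr) auto
  finally show ?thesis using n by (simp add: pos_divide_le_eq mult_ac)
qed

text \<open>
  Applied to the law without tilt, this makes the noise Hessian a covariance matrix.
\<close>

lemma centered_law_exact_covariance:
  fixes S :: "real ^ 'd ^ 'd"
  assumes Q: "centered_law S 0 c Q"
  shows "transpose S = S" "0 \<le> (S *v u) \<bullet> u"
proof -
  have S: "S $ i $ j = (\<integral>\<zeta>. \<zeta> $ i * \<zeta> $ j \<partial>Q)" for i j using Q by (simp add: centered_law_def)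
  have "S $ i $ j = S $ j $ i" for i j unfolding S by (simp only: mult.commute)
  then show "transpose S = S" by (simp add: transpose_def vec_eq_iff)
  note int = centered_law_integrable_prod[OF Q]
  have "0 \<le> (\<integral>\<zeta>. (\<zeta> \<bullet> u)\<^sup>2 \<partial>Q)" by simp
  also have "(\<integral>\<zeta>. (\<zeta> \<bullet> u)\<^sup>2 \<partial>Q) = (\<integral>\<zeta>. (\<Sum>i\<in>UNIV. \<Sum>j\<in>UNIV. (u $ i * u $ j) * (\<zeta> $ i * \<zeta> $ j)) \<partial>Q)"
    by (simp add: inner_cart power2_eq_square sum_product mult_ac)
  also have "\<dots> = (\<Sum>i\<in>UNIV. \<Sum>j\<in>UNIV. (u $ i * u $ j) * S $ i $ j)"
    by (simp add: S Bochner_Integration.integral_sum Bochner_Integration.integrable_sum int)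
  also have "\<dots> = (S *v u) \<bullet> u"
    by (simp add: inner_cart matrix_vector_mult_def sum_distrib_right sum_distrib_left mult_ac)
  finally show "0 \<le> (S *v u) \<bullet> u" .
qed

theorem theorem7:
  fixes \<Theta> T :: "nat \<Rightarrow> 'p :: topological_space set"
    and \<pi> :: "nat \<Rightarrow> 'p measure"
    and M :: "nat \<Rightarrow> nat"
    and \<Omega>0 \<mu> \<gamma> :: "'w measure"
    and W0 Ws :: "'w \<Rightarrow> real ^ 'd"
    and \<eta> :: "nat \<Rightarrow> nat \<Rightarrow> 'p \<Rightarrow> real ^ 'd"
    and N :: "nat \<Rightarrow> (nat \<Rightarrow> real ^ 'd) measure"
    and H0 :: "real ^ 'd ^ 'd"
    and a :: real
    and r :: "nat \<Rightarrow> real"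
  assumes Theta: "\<And>n. compact (\<Theta> n)"
    and T: "\<And>n. T n \<subseteq> \<Theta> n" "\<And>n. compact (T n)" "\<And>n. metrizable_space (top_of_set (T n))"
    and prior: "\<And>n. prob_space (\<pi> n)" "\<And>n. sets (\<pi> n) = sets (restrict_space borel (T n))"
    and base: "prob_space \<mu>" "sets \<mu> = sets \<Omega>0" "prob_space \<gamma>" "sets \<gamma> = sets \<Omega>0"
    and W: "W0 \<in> borel_measurable \<Omega>0" "Ws \<in> borel_measurable \<Omega>0"
    and eta: "\<And>n m. m < M n \<Longrightarrow> continuous_on (\<Theta> n) (\<eta> n m)"
    and regular: "exp_family_regular \<mu> \<gamma> W0 Ws"
    and N: "\<And>n. centered_gaussian (M n) (block_diag (M n) (noise_hessian \<gamma> W0 Ws)) (N n)"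
    and r_def: "\<And>n. r n = feature_radius (\<Theta> n) (M n) (\<eta> n)"
    and M: "(\<lambda>n. real (M n)) \<in> \<omega>(\<lambda>n. real n)"
    and r: "\<exists>c. \<forall>\<^sub>F n in sequentially. r n \<le> c * sqrt (real n / real (M n))"
    and H0: "transpose H0 = H0" "span (columns H0) \<subseteq> span (columns (noise_hessian \<gamma> W0 Ws))"
    and a: "a \<in> {-1, 0}"
  shows "\<exists>C. \<forall>\<^sub>F \<epsilon> in at_right 0. \<forall>\<^sub>F n in sequentially. \<forall>\<theta>\<in>\<Theta> n.
    Phi_gauss n (M n) (\<eta> n) \<mu> \<gamma> W0 Ws (N n) (\<pi> n) a H0 \<theta> (- \<epsilon>) - C * (\<epsilon> + r n / \<epsilon>)
      \<le> Phi_lik n (M n) (\<eta> n) \<mu> \<gamma> W0 Ws (\<pi> n) a H0 \<theta> \<and>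
    Phi_lik n (M n) (\<eta> n) \<mu> \<gamma> W0 Ws (\<pi> n) a H0 \<theta>
      \<le> Phi_gauss n (M n) (\<eta> n) \<mu> \<gamma> W0 Ws (N n) (\<pi> n) a H0 \<theta> \<epsilon> + C * (\<epsilon> + r n / \<epsilon>)"
proof -
  have W\<mu>: "W0 \<in> borel_measurable \<mu>" and W\<gamma>: "W0 \<in> borel_measurable \<gamma>" and Ws\<gamma>: "Ws \<in> borel_measurable \<gamma>"
    using W by (simp_all add: measurable_cong_sets[OF base(2) refl] measurable_cong_sets[OF base(4) refl])
  let ?S = "noise_hessian \<gamma> W0 Ws" and ?A = "cross_hessian \<gamma> W0 Ws" and ?K = "model_hessian \<mu> W0"
  let ?d = "real CARD('d)"
  obtain \<rho> where \<rho>: "0 < \<rho>" "\<And>u. norm u < \<rho> \<Longrightarrow> integrable \<mu> (\<lambda>x. exp (W0 x \<bullet> u))"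
    "\<And>v u. norm v < \<rho> \<Longrightarrow> norm u < \<rho> \<Longrightarrow> integrable \<gamma> (\<lambda>x. exp (W0 x \<bullet> v + Ws x \<bullet> u))"
    and mean: "(\<integral>x. W0 x \<partial>\<mu>) = (\<integral>x. W0 x \<partial>\<gamma>)"
    using regular unfolding exp_family_regular_def by blast
  define \<delta> where "\<delta> = \<rho> / (2 * ?d)"
  have \<delta>: "0 < \<delta>" "\<delta> * ?d < \<rho>" using \<rho>(1) by (auto simp: \<delta>_def)
  have int\<mu>: "integrable \<mu> (\<lambda>x. exp (\<delta> * norm (W0 x)))"
    by (rule exp_norm_integrable[OF \<rho>(1) W\<mu> \<rho>(2)]) (use \<delta> in auto)
  have int\<gamma>: "integrable \<gamma> (\<lambda>x. exp (\<delta> * norm (W0 x)) * exp (\<delta> * norm (Ws x)))"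
    by (rule exp_norm_prod_integrable[OF \<rho>(1) W\<gamma> Ws\<gamma> \<rho>(3)]) (use \<delta> in auto)
  obtain c1 r1 where c1: "0 \<le> c1" "0 < r1"
    and tilt: "\<And>u. norm u \<le> r1 \<Longrightarrow> prob_space (tilted \<gamma> Ws u)"
      "\<And>u. norm u \<le> r1 \<Longrightarrow> centered_law ?S (c1 * norm u) c1
        (distr (tilted \<gamma> Ws u) borel (\<lambda>x. W0 x - (\<integral>x. W0 x \<partial>tilted \<gamma> Ws u)))"
      "\<And>u. norm u \<le> r1 \<Longrightarrow> norm ((\<integral>x. W0 x \<partial>tilted \<gamma> Ws u) - (\<integral>x. W0 x \<partial>\<gamma>) - ?A *v u) \<le> c1 * (norm u)\<^sup>2"
    using tilted_law[OF base(3) \<delta>(1) W\<gamma> Ws\<gamma> int\<gamma>] by metis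
  obtain c2 r2 where c2: "0 \<le> c2" "0 < r2"
    and mgf: "\<And>b. norm b \<le> r2 \<Longrightarrow> \<bar>log_mgf \<mu> W0 b - (\<integral>x. W0 x \<partial>\<mu>) \<bullet> b - b \<bullet> (?K *v b) / 2\<bar> \<le> c2 * norm b ^ 3"
    using log_mgf_expansion[OF base(1) \<delta>(1) W\<mu> int\<mu>] by metis
  \<comment> \<open>Without tilt the covariance error vanishes, so \<open>?S\<close> is a genuine covariance.\<close>
  have exact: "centered_law ?S 0 c1 (distr (tilted \<gamma> Ws 0) borel (\<lambda>x. W0 x - (\<integral>x. W0 x \<partial>tilted \<gamma> Ws 0)))"
    using tilt(2)[of 0] c1(2) by simp
  note S = centered_law_exact_covariance[OF exact]
  obtain B where B: "?S ** B = H0" "\<And>k x. pseudoinverse k (block_diag k ?S) (block_diag k H0 x) = block_diag k B x"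
    using perturbation_direction[OF S(1) H0(2)] by metis
  obtain \<kappa> where \<kappa>: "0 \<le> \<kappa>" "\<And>v. norm (B *v v) \<le> \<kappa> * norm v" using matrix_bound_exists[of B] by metis
  define \<sigma> where "\<sigma> = norm ?S"
  have \<sigma>: "\<bar>?S $ i $ j\<bar> \<le> \<sigma>" for i j
    unfolding \<sigma>_def using component_le_norm_cart[of "?S $ i" j] Finite_Cartesian_Product.norm_nth_le[of ?S i] by linarith
  define cG where "cG = ?d ^ 3 * (\<Sum>i\<in>UNIV. sqrt (?S $ i $ i) ^ 3 * (\<integral>z. \<bar>z\<bar> ^ 3 \<partial>std_normal_distribution))"
  define c where "c = max c1 cG"
  have c: "c1 \<le> c" "cG \<le> c" "0 \<le> c" using c1 by (auto simp: c_def)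
  obtain c0 where c0: "\<forall>\<^sub>F n in sequentially. r n \<le> c0 * sqrt (real n / real (M n))" using r by blast
  define I where "I = 6 * (1 + \<kappa>) ^ 3 * c + 2 * ?d\<^sup>2 * c * (1 + \<kappa>)\<^sup>2 + 6 * ?d\<^sup>2 * \<sigma> * (1 + \<kappa>) ^ 3 * (1 + c)"
  define J where "J = ?d\<^sup>2 * (\<sigma> * (2 * (1 + \<kappa>)\<^sup>2))"
  define L where "L = (c1 + c2) + (12 * (1 + \<kappa>) ^ 3 * c + 2 * ?d\<^sup>2 * c * (1 + \<kappa>)\<^sup>2)"
  let ?C = "c0\<^sup>2 * (2 * I + J + 2 * L)"
  have rmin: "0 < min r1 r2" using c1 c2 by simp
  have main: "sgn \<beta> * (Phi_lik n (M n) (\<eta> n) \<mu> \<gamma> W0 Ws (\<pi> n) a H0 \<theta>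
      - Phi_gauss n (M n) (\<eta> n) \<mu> \<gamma> W0 Ws (N n) (\<pi> n) a H0 \<theta> \<beta>) \<le> ?C * (\<epsilon> + r n / \<epsilon>)"
    if \<epsilon>: "0 < \<epsilon>" "\<epsilon> < 1" and \<beta>: "\<beta> = \<epsilon> \<or> \<beta> = - \<epsilon>" and n: "0 < n" and k: "0 < M n" and rn: "r n \<le> min r1 r2"
      and kr: "0 \<le> r n \<longrightarrow> real (M n) * (r n)\<^sup>2 \<le> c0\<^sup>2 * real n" and \<theta>: "\<theta> \<in> \<Theta> n" for \<epsilon> \<beta> n \<theta>
  proof -
    interpret prob_space "\<pi> n" by (rule prior(1))
    let ?k = "M n" and ?\<eta> = "\<eta> n"
    have \<beta>1: "\<bar>\<beta>\<bar> \<le> 1" using \<beta> \<epsilon> by auto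
    have space: "space (\<pi> n) = T n" using sets_eq_imp_space_eq[OF prior(2)] by (simp add: space_restrict_space)
    have radius: "norm (?\<eta> m u) \<le> r n" if "m < ?k" "u \<in> \<Theta> n" for m u
      unfolding r_def by (rule feature_radius_bound[OF Theta eta that])
    have r0: "0 \<le> r n" using order.trans[OF norm_ge_zero radius[OF k \<theta>]] .
    have \<eta>: "bounded_feature (\<pi> n) (r n) (?\<eta> m)" if m: "m < ?k" for m
    proof -
      have "?\<eta> m \<in> borel_measurable (restrict_space borel (T n))"
        by (rule borel_measurable_continuous_on_restrict[OF continuous_on_subset[OF eta[OF m] T(1)]])
      then show ?thesis unfolding bounded_feature_def space
        using radius[OF m] T(1) by (auto simp: measurable_cong_sets[OF prior(2) refl])
    qed
    \<comment> \<open>Extended by 0 to \<open>m \<ge> ?k\<close>, so that every tilt is small and every factor a probability measure.\<close>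
    define u where "u = global_feature ?k ?\<eta> \<theta>"
    have u: "norm (u m) \<le> r n" for m using radius[OF _ \<theta>] r0 by (simp add: u_def global_feature_def)
    then have u1: "norm (u m) \<le> r1" for m using rn by (meson min.boundedE order.trans)
    define law where "law m = tilted \<gamma> Ws (u m)" for m
    define e where "e m = (\<integral>x. W0 x \<partial>law m)" for m
    define Q where "Q m = distr (law m) borel (\<lambda>x. W0 x - e m)" for m
    have law: "prob_space (law m)" for m unfolding law_def by (rule tilt(1)[OF u1])
    have Q: "centered_law ?S (c * r n) c (Q m)" for m
    proof (rule centered_law_mono[OF _ _ c(1)])
      show "centered_law ?S (c1 * norm (u m)) c1 (Q m)" unfolding Q_def e_def law_def by (rule tilt(2)[OF u1])
      show "c1 * norm (u m) \<le> c * r n" using c c1 u by (intro mult_mono) auto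
    qed
    interpret G: gaussian_blocks ?k ?S "N n" by (standard, rule N, rule S(1), rule S(2))
    \<comment> \<open>Indices beyond the blocks repeat block 0, to keep the moment conditions for all \<open>m\<close>.\<close>
    define R where "R m = G.marginal (if m < ?k then m else 0)" for m
    have R: "centered_law ?S (c * r n) c (R m)" for m
    proof (rule centered_law_mono[OF _ _ c(2)])
      show "centered_law ?S 0 cG (R m)" unfolding R_def cG_def by (rule G.centered_law_marginal) (use k in auto)
      show "0 \<le> c * r n" using c r0 by simp
    qed
    have NR: "N n = (\<Pi>\<^sub>M m\<in>{..<?k}. R m)"
      by (rule trans[OF G.eq_prod_marginals PiM_cong]) (auto simp: R_def)
    let ?b = "bias_term ?k ?\<eta> a H0 \<theta>"
    let ?E = "gauss_drift ?k ?A ?K ?\<eta> \<theta>" and ?D = "lik_drift ?k \<mu> W0 e ?\<eta>"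
    let ?xb = "\<lambda>m t. ?\<eta> m t + \<beta> *\<^sub>R (B *v ?\<eta> m t)"
    have E: "?E \<in> bfun (\<pi> n)" by (rule Phi_gauss_eq(2)[OF \<eta> r0 \<beta>1 G.prob_N G.sets_N B(2)])
    have DE: "\<bar>?D t - ?E t\<bar> \<le> real ?k * ((c1 + c2) * r n ^ 3)" if t: "t \<in> space (\<pi> n)" for t
    proof (rule drift_difference_bound[OF c1(1) c2(1)])
      have t\<Theta>: "t \<in> \<Theta> n" using t T(1) space by auto
      fix m assume m: "m < ?k"
      have um: "u m = ?\<eta> m \<theta>" using m by (simp add: u_def global_feature_def)
      show "norm (e m - (\<integral>x. W0 x \<partial>\<gamma>) - ?A *v ?\<eta> m \<theta>) \<le> c1 * (norm (?\<eta> m \<theta>))\<^sup>2"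
        using tilt(3)[OF u1[of m]] unfolding e_def law_def um .
      have "norm (?\<eta> m t) \<le> r2" using radius[OF m t\<Theta>] rn by linarith
      from mgf[OF this] show "\<bar>log_mgf \<mu> W0 (?\<eta> m t) - (\<integral>x. W0 x \<partial>\<gamma>) \<bullet> ?\<eta> m t - ?\<eta> m t \<bullet> (?K *v ?\<eta> m t) / 2\<bar> \<le> c2 * norm (?\<eta> m t) ^ 3"
        unfolding mean .
      show "norm (?\<eta> m \<theta>) \<le> r n" "norm (?\<eta> m t) \<le> r n" by (rule radius[OF m \<theta>], rule radius[OF m t\<Theta>])
    qed
    have D: "?D \<in> bfun (\<pi> n)"
    proof -
      have "(\<lambda>t. e m \<bullet> ?\<eta> m t - log_mgf \<mu> W0 (?\<eta> m t)) \<in> borel_measurable (\<pi> n)" if "m < ?k" for m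
      proof -
        have [measurable]: "?\<eta> m \<in> borel_measurable (\<pi> n)" using \<eta>[OF that] by (simp add: bounded_feature_def)
        have [measurable]: "log_mgf \<mu> W0 \<in> borel_measurable borel" by (rule borel_measurable_log_mgf[OF base(1) W\<mu>])
        show ?thesis by measurable
      qed
      then have Dm: "?D \<in> borel_measurable (\<pi> n)" unfolding lik_drift_def[abs_def] by (intro borel_measurable_sum) auto
      obtain b where b: "\<And>t. t \<in> space (\<pi> n) \<Longrightarrow> \<bar>?E t\<bar> \<le> b" by (rule bfunE[OF E]) blast
      show ?thesis
      proof (rule bfunI[OF Dm])
        fix t assume t: "t \<in> space (\<pi> n)"
        show "\<bar>?D t\<bar> \<le> b + real ?k * ((c1 + c2) * r n ^ 3)" using b[OF t] DE[OF t] by linarith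
      qed
    qed
    let ?X = "\<integral>\<xi>. response (\<pi> n) ?k ?\<eta> H0 ?b (linear_field ?k ?\<eta> ?D \<xi>) \<partial>(\<Pi>\<^sub>M m\<in>{..<?k}. Q m)"
    let ?Y = "\<integral>\<xi>. response (\<pi> n) ?k ?\<eta> H0 ?b (linear_field ?k ?xb (\<lambda>t. ?E t + \<beta> * ?b t) \<xi>) \<partial>(\<Pi>\<^sub>M m\<in>{..<?k}. R m)"
    have X: "Phi_lik n ?k ?\<eta> \<mu> \<gamma> W0 Ws (\<pi> n) a H0 \<theta> = 1 / real n * ?X"
      unfolding Q_def e_def[abs_def] law_def[abs_def] u_def
      by (rule Phi_lik_eq[where k = "M n" and \<eta> = "\<eta> n", OF \<eta> W\<gamma>
            D[unfolded e_def[abs_def] law_def[abs_def] u_def] law[unfolded law_def u_def]])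
    have Y: "Phi_gauss n ?k ?\<eta> \<mu> \<gamma> W0 Ws (N n) (\<pi> n) a H0 \<theta> \<beta> = 1 / real n * ?Y"
      unfolding NR[symmetric] by (rule Phi_gauss_eq(1)[OF \<eta> r0 \<beta>1 G.prob_N G.sets_N B(2)])
    have "\<beta> * (?X - ?Y) \<le> \<bar>\<beta>\<bar> * (2 * (real ?k * (6 * ((1 + \<kappa>) * r n) ^ 3 * c + 2 * ?d\<^sup>2 * (c * r n) * ((1 + \<kappa>) * r n)\<^sup>2
          + 6 * ?d\<^sup>2 * \<sigma> * ((1 + \<kappa>) * r n) ^ 3 * (1 + c)))
        + \<bar>\<beta>\<bar> * (real ?k * (?d\<^sup>2 * (\<sigma> * (2 * ((1 + \<kappa>) * r n)\<^sup>2)))))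
      + 2 * (real ?k * ((c1 + c2) * r n ^ 3) + real ?k * (12 * ((1 + \<kappa>) * r n) ^ 3 * c + 2 * ?d\<^sup>2 * (c * r n) * ((1 + \<kappa>) * r n)\<^sup>2))"
      by (rule response_comparison[OF Q R \<eta> r0 S(1) H0(1) B(1) \<sigma> \<kappa>(2,1) D E DE bfun_bias_term[OF \<eta>] \<beta>1])
    from comparison_error_bound[OF c(3) \<kappa>(1) _ r0 _ \<epsilon> _ n this \<beta>, of "c0\<^sup>2"]
    have "sgn \<beta> * (?X - ?Y) / real n \<le> ?C * (\<epsilon> + r n / \<epsilon>)"
      using c1 c2 kr r0 by (simp add: \<sigma>_def I_def J_def L_def)
    then show ?thesis unfolding X Y by (simp add: right_diff_distrib diff_divide_distrib)
  qed
  show ?thesis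
  proof (rule exI[of _ ?C])
    have "\<forall>\<^sub>F \<epsilon> :: real in at_right 0. 0 < \<epsilon> \<and> \<epsilon> < 1"
      unfolding eventually_at_right_field by (intro exI[of _ 1]) auto
    then show "\<forall>\<^sub>F \<epsilon> in at_right 0. \<forall>\<^sub>F n in sequentially. \<forall>\<theta>\<in>\<Theta> n.
      Phi_gauss n (M n) (\<eta> n) \<mu> \<gamma> W0 Ws (N n) (\<pi> n) a H0 \<theta> (- \<epsilon>) - ?C * (\<epsilon> + r n / \<epsilon>)
        \<le> Phi_lik n (M n) (\<eta> n) \<mu> \<gamma> W0 Ws (\<pi> n) a H0 \<theta> \<and>
      Phi_lik n (M n) (\<eta> n) \<mu> \<gamma> W0 Ws (\<pi> n) a H0 \<theta>
        \<le> Phi_gauss n (M n) (\<eta> n) \<mu> \<gamma> W0 Ws (N n) (\<pi> n) a H0 \<theta> \<epsilon> + ?C * (\<epsilon> + r n / \<epsilon>)"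
    proof eventually_elim
      case (elim \<epsilon>)
      show ?case
        using radius_small[OF M c0 rmin]
      proof eventually_elim
        case (elim n)
        show ?case
        proof
          fix \<theta> assume \<theta>: "\<theta> \<in> \<Theta> n"
          have "sgn \<epsilon> = 1" "sgn (- \<epsilon>) = -1" using \<open>0 < \<epsilon> \<and> \<epsilon> < 1\<close> by auto
          then show "Phi_gauss n (M n) (\<eta> n) \<mu> \<gamma> W0 Ws (N n) (\<pi> n) a H0 \<theta> (- \<epsilon>) - ?C * (\<epsilon> + r n / \<epsilon>)
              \<le> Phi_lik n (M n) (\<eta> n) \<mu> \<gamma> W0 Ws (\<pi> n) a H0 \<theta> \<and>
            Phi_lik n (M n) (\<eta> n) \<mu> \<gamma> W0 Ws (\<pi> n) a H0 \<theta>
              \<le> Phi_gauss n (M n) (\<eta> n) \<mu> \<gamma> W0 Ws (N n) (\<pi> n) a H0 \<theta> \<epsilon> + ?C * (\<epsilon> + r n / \<epsilon>)"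
            using main[of \<epsilon> \<epsilon> n \<theta>] main[of \<epsilon> "- \<epsilon>" n \<theta>] \<open>0 < \<epsilon> \<and> \<epsilon> < 1\<close> elim \<theta> by simp
        qed
      qed
    qed
  qed
qed

end
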